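(* Let $I=[\eta,\xi]\subset\mathbb{R}$ be a compact interval, let $0<c_1\le c_2$, and let $f\in\mathcal{F}(I;c_1,c_2)$ have a Lipschitz continuous second derivative. Let $\varepsilon\in(0,1)$. Then for all integers $Q>1$ and all $\delta$ with $Q^{-1+\varepsilon}<\delta\le 1/2$, $$\frac{2\sqrt3}{9\zeta(3)}+O(Q^{-\varepsilon/2})\le \frac{\widetilde{N}_f(Q,\delta)}{|I|\delta Q^2}\le \frac{1}{\zeta(3)}+O(Q^{-\varepsilon/2}),$$ where the implied constants depend only on $I$, $c_1$, $c_2$, $\varepsilon$ and the Lipschitz constant of $f''$.
   Context: $\mathcal{F}(I;c_1,c_2)$ denotes the set of $C^2$ functions $f:I\to\mathbb{R}$ with $c_1\le |f''(x)|\le c_2$ for all $x\in I$. $|I|$ is the length of $I$, and $\zeta$ is the Riemann zeta function. For $Q\ge1$ and $\delta>0$, $$\widetilde{N}_f(Q,\delta)=\#\left\{\left(\tfrac aq,\tfrac bq\right)\in\mathbb{Q}^2:\ q\le Q,\ a/q\in I,\ \gcd(a,b,q)=1,\ \left|f\left(\tfrac aq\right)-\tfrac bq\right|<\tfrac{\delta}{Q}\right\},$$ where $a,b\in\mathbb{Z}$, $q\in\mathbb{N}$. *)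

theory Defs
  imports "HOL-Analysis.Analysis"
begin

text \<open>
  Derivatives on an interval \<open>I\<close> are taken relative to \<open>I\<close>, hence one-sided at its endpoints, so
  that values of \<open>f\<close> outside \<open>I\<close> play no role. On a nondegenerate interval such a derivative
  is unique whenever it exists.
\<close>

definition deriv_on :: "real set \<Rightarrow> (real \<Rightarrow> real) \<Rightarrow> real \<Rightarrow> real" where
  "deriv_on I f x = vector_derivative f (at x within I)"

definition C2_on :: "real set \<Rightarrow> (real \<Rightarrow> real) \<Rightarrow> bool" where
  "C2_on I f \<longleftrightarrow>
     f differentiable_on I \<and>
     deriv_on I f differentiable_on I \<and>
     continuous_on I (deriv_on I (deriv_on I f))"

definition curve_class :: "real set \<Rightarrow> real \<Rightarrow> real \<Rightarrow> (real \<Rightarrow> real) set" where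
  "curve_class I c1 c2 =
     {f. C2_on I f \<and>
         (\<forall>x\<in>I. c1 \<le> \<bar>deriv_on I (deriv_on I f) x\<bar> \<and> \<bar>deriv_on I (deriv_on I f) x\<bar> \<le> c2)}"

text \<open>The set below consists of points, not of triples \<open>(a, b, q)\<close>.\<close>

definition near_points :: "real set \<Rightarrow> (real \<Rightarrow> real) \<Rightarrow> real \<Rightarrow> real \<Rightarrow> (real \<times> real) set" where
  "near_points I f Q \<delta> =
     {(real_of_int a / real q, real_of_int b / real q) | (a :: int) (b :: int) (q :: nat).
        1 \<le> q \<and> real q \<le> Q \<and> real_of_int a / real q \<in> I \<and> gcd (gcd a b) (int q) = 1 \<and>
        \<bar>f (real_of_int a / real q) - real_of_int b / real q\<bar> < \<delta> / Q}"

definition num_near_points :: "real set \<Rightarrow> (real \<Rightarrow> real) \<Rightarrow> real \<Rightarrow> real \<Rightarrow> nat" where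
  "num_near_points I f Q \<delta> = card (near_points I f Q \<delta>)"

text \<open>The Dirichlet series of the Riemann zeta function; meaningful for \<open>s > 1\<close> only.\<close>

definition zeta :: "real \<Rightarrow> real" where
  "zeta s = (\<Sum>n. 1 / real (Suc n) powr s)"

end

theory Submission
  imports Defs
begin

text \<open>
  The number of triples \<open>(a, b, q)\<close>, primitive or not, is \<open>2/3 |I| \<delta> Q\<^sup>2 (1 + o(1))\<close>. Since
  \<open>2 \<surd>3 / 9 < 2/3 (1 - \<Sum>\<^sub>d\<^sub>\<ge>\<^sub>2 1/d\<^sup>3)\<close> and \<open>2/3 < 1 / \<zeta>(3)\<close>, this leaves a fixed amount of room for
  all large \<open>Q\<close>; small \<open>Q\<close> are absorbed by the implied constant.

  The interval is cut into arcs of length about \<open>(\<delta>/Q)\<^sup>1\<^sup>/\<^sup>2\<close>, on which the curve is replaced by its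
  tangent. The triples belonging to an arc are then the points of a lattice in \<open>\<real>\<^sup>3\<close> lying in a
  truncated pyramid, and their number is close to the volume unless a reduced basis of
  the lattice contains a long vector. In that case the dual lattice has a short vector, which is a
  rational point close to the dual curve with denominator \<open>O(1/\<delta>)\<close>, so few arcs are
  exceptional provided that there are only \<open>O(R\<^sup>1\<^sup>+\<^sup>\<epsilon>)\<close> primitive triples with denominator of size \<open>R\<close>
  within \<open>1/R\<^sup>2\<close> of a curve.

  This last bound is self-improving. Triples within a cell of width about \<open>1/R\<close> are
  coplanar, hence they lie on a line, which is a rational point near the dual curve. A line of
  height \<open>h\<close> carries \<open>O(R/h)\<close> triples and there are \<open>O(R)\<close> cells, so a bound \<open>O(H\<^sup>1\<^sup>+\<^sup>\<theta>)\<close> for the dual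
  curve yields the exponent \<open>1 + \<theta> / (1 + \<theta>)\<close>: the exponents are \<open>1 + 1/k\<close> with \<open>k = 1, 2, 3, \<dots>\<close>.
\<close>

subsection \<open>Contact elements and rational points near them\<close>

text \<open>On an arc whose lattice is skew, the number of triples may far exceed the volume, and
  two quantities govern the excess. The longest vector of a reduced basis gives a rational point
  near the dual curve. The shortest vector, if it is really short, gives one near the curve itself.
  So both curves must be controlled. The excess on an arc is bounded by a multiple of the inverse
  denominator of its point, which is why sums of inverse denominators (\<open>weight\<close>) are
  estimated and not mere counts.

  It suffices that \<open>weight S Y\<close> is O(\<open>Y powr \<theta>\<close>) with \<theta> at
  most \<epsilon> / 8, which a finite number of improvement steps provides. Each step passes to the
  dual and worsens the constants, so the bounds are proved for all sets of elements with given
  constants and not for one curve.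

  Common factors are removed by subtracting full counts for every d \<ge> 2. There the window
  \<delta> / d may be too narrow for the main estimate; it is then widened, at a cost of lower
  order.\<close>

text \<open>
  An element \<open>(x, y, p)\<close> is a point of a curve together with the slope of its tangent. Stated for such
  triples, the two-sided curvature bound is preserved, up to constants, by the Legendre transform
  \<open>dual\<close>, without any reference to the inverse of the derivative.
\<close>

definition contact :: "real \<Rightarrow> real \<Rightarrow> real \<Rightarrow> (real \<times> real \<times> real) set \<Rightarrow> bool" where
  "contact c C X S \<longleftrightarrow> (\<forall>(x,y,p)\<in>S. \<forall>(x',y',p')\<in>S.
     \<bar>x' - x\<bar> \<le> X \<and> c * \<bar>x' - x\<bar> \<le> \<bar>p' - p\<bar> \<and> \<bar>p' - p\<bar> \<le> C * \<bar>x' - x\<bar> \<and>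
     c * (x' - x)\<^sup>2 \<le> y' - y - p * (x' - x) \<and> y' - y - p * (x' - x) \<le> C * (x' - x)\<^sup>2)"

definition dual :: "(real \<times> real \<times> real) set \<Rightarrow> (real \<times> real \<times> real) set" where
  "dual S = (\<lambda>(x,y,p). (p, x * p - y, x)) ` S"

definition tang :: "real \<times> real \<times> real \<Rightarrow> real \<Rightarrow> real" where
  "tang s z = (case s of (x,y,p) \<Rightarrow> y + p * (z - x))"

text \<open>The second condition refers to the tangent and not to the curve, so that both are bounds
  on linear forms in \<open>(a,b,q)\<close>, the shape in which lattice vectors and lines produce
  them. As \<open>a / q\<close> is within \<open>1 / q\<close> of \<open>x\<close>, curve and
  tangent differ there by O(1 / q^2), which is the size of the tolerance itself.\<close>

definition near :: "real \<times> real \<times> real \<Rightarrow> int \<times> int \<times> int \<Rightarrow> bool" where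
  "near s v = (case s of (x,y,p) \<Rightarrow> case v of (a,b,q) \<Rightarrow>
     \<bar>of_int a - x * of_int q\<bar> \<le> 1 \<and>
     of_int q * \<bar>of_int b - y * of_int q - p * (of_int a - x * of_int q)\<bar> \<le> 1)"

definition Near :: "(real \<times> real \<times> real) set \<Rightarrow> (int \<times> int \<times> int) set" where
  "Near S = {(a,b,q). 1 \<le> q \<and> gcd a (gcd b q) = 1 \<and> (\<exists>s\<in>S. near s (a,b,q))}"

definition den :: "int \<times> int \<times> int \<Rightarrow> real" where
  "den v = of_int (snd (snd v))"

definition Near_upto :: "(real \<times> real \<times> real) set \<Rightarrow> real \<Rightarrow> (int \<times> int \<times> int) set" where
  "Near_upto S Y = {v \<in> Near S. den v \<le> Y}"

definition abscissa :: "int \<times> int \<times> int \<Rightarrow> real" where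
  "abscissa v = of_int (fst v) / den v"

definition ordinate :: "int \<times> int \<times> int \<Rightarrow> real" where
  "ordinate v = of_int (fst (snd v)) / den v"

lemma den_ge_1: "v \<in> Near S \<Longrightarrow> 1 \<le> den v"
  by (auto simp: Near_def den_def)

lemma contact_mono:
  assumes "contact c C X S" "c' \<le> c" "C \<le> C'" "X \<le> X'"
  shows "contact c' C' X' S"
  unfolding contact_def
proof (clarify)
  fix x y p x' y' p' assume a: "(x,y,p) \<in> S" "(x',y',p') \<in> S"
  have h: "\<bar>x' - x\<bar> \<le> X" "c * \<bar>x' - x\<bar> \<le> \<bar>p' - p\<bar>" "\<bar>p' - p\<bar> \<le> C * \<bar>x' - x\<bar>"
     "c * (x' - x)\<^sup>2 \<le> y' - y - p * (x' - x)" "y' - y - p * (x' - x) \<le> C * (x' - x)\<^sup>2"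
    using assms(1) a unfolding contact_def by fastforce+
  have "c' * \<bar>x' - x\<bar> \<le> c * \<bar>x' - x\<bar>" "C * \<bar>x' - x\<bar> \<le> C' * \<bar>x' - x\<bar>"
     "c' * (x' - x)\<^sup>2 \<le> c * (x' - x)\<^sup>2" "C * (x' - x)\<^sup>2 \<le> C' * (x' - x)\<^sup>2"
    using assms by (auto intro!: mult_right_mono)
  then show "\<bar>x' - x\<bar> \<le> X' \<and> c' * \<bar>x' - x\<bar> \<le> \<bar>p' - p\<bar> \<and> \<bar>p' - p\<bar> \<le> C' * \<bar>x' - x\<bar> \<and>
     c' * (x' - x)\<^sup>2 \<le> y' - y - p * (x' - x) \<and> y' - y - p * (x' - x) \<le> C' * (x' - x)\<^sup>2"
    using h assms(4) by linarith
qed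

lemma contactD:
  assumes "contact c C X S" "(x,y,p) \<in> S" "(x',y',p') \<in> S"
  shows "\<bar>x' - x\<bar> \<le> X" "c * \<bar>x' - x\<bar> \<le> \<bar>p' - p\<bar>" "\<bar>p' - p\<bar> \<le> C * \<bar>x' - x\<bar>"
     "c * (x' - x)\<^sup>2 \<le> y' - y - p * (x' - x)" "y' - y - p * (x' - x) \<le> C * (x' - x)\<^sup>2"
  using assms unfolding contact_def by fastforce+

text \<open>The gap between curve and tangent for a dual pair is the gap of the original pair with
  the two elements exchanged, see \<open>e\<close>; it remains to convert \<open>x' - x\<close> into
  \<open>p' - p\<close>. The crude powers in \<open>c / C\<^sup>2\<close> and
  \<open>C / c\<^sup>2\<close> let one pair of constants serve gaps and slopes alike.\<close>

lemma contact_dual: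
  assumes S: "contact c C X S" and c: "0 < c" "c \<le> 1" "1 \<le> C"
  shows "contact (c / C\<^sup>2) (C / c\<^sup>2) (C * X) (dual S)"
proof -
  have "\<bar>p' - p\<bar> \<le> C * X \<and> c / C\<^sup>2 * \<bar>p' - p\<bar> \<le> \<bar>x' - x\<bar> \<and> \<bar>x' - x\<bar> \<le> C / c\<^sup>2 * \<bar>p' - p\<bar> \<and>
     c / C\<^sup>2 * (p' - p)\<^sup>2 \<le> (x' * p' - y') - (x * p - y) - x * (p' - p) \<and>
     (x' * p' - y') - (x * p - y) - x * (p' - p) \<le> C / c\<^sup>2 * (p' - p)\<^sup>2"
    if a: "(x,y,p) \<in> S" "(x',y',p') \<in> S" for x y p x' y' p'
  proof -
    note h = contactD[OF S a] and k = contactD[OF S a(2,1)]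
    have e: "(x' * p' - y') - (x * p - y) - x * (p' - p) = y - y' - p' * (x - x')"
      by (simp add: algebra_simps)
    have 1: "\<bar>p' - p\<bar> \<le> C * X"
      using h(1,3) c mult_left_mono[of "\<bar>x' - x\<bar>" X C] by linarith
    have c2: "c\<^sup>2 \<le> c" using c by (simp add: power2_eq_square mult_left_le)
    have C2: "C \<le> C\<^sup>2" using c by (simp add: power2_eq_square)
    have "c * \<bar>p' - p\<bar> \<le> 1 * \<bar>p' - p\<bar>" using c by (intro mult_right_mono) auto
    also have "\<dots> \<le> C * \<bar>x' - x\<bar>" using h by simp
    also have "\<dots> \<le> C\<^sup>2 * \<bar>x' - x\<bar>" using C2 by (intro mult_right_mono) auto
    finally have 2: "c / C\<^sup>2 * \<bar>p' - p\<bar> \<le> \<bar>x' - x\<bar>" using c by (simp add: field_simps)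
    have "c\<^sup>2 * \<bar>x' - x\<bar> \<le> c * \<bar>x' - x\<bar>" using c2 by (intro mult_right_mono) auto
    also have "\<dots> \<le> 1 * \<bar>p' - p\<bar>" using h by simp
    also have "\<dots> \<le> C * \<bar>p' - p\<bar>" using c by (intro mult_right_mono) auto
    finally have 3: "\<bar>x' - x\<bar> \<le> C / c\<^sup>2 * \<bar>p' - p\<bar>" using c by (simp add: field_simps)
    have "\<bar>p' - p\<bar>\<^sup>2 \<le> (C * \<bar>x' - x\<bar>)\<^sup>2" using h(3) by (intro power_mono) auto
    then have "(p' - p)\<^sup>2 \<le> C\<^sup>2 * (x' - x)\<^sup>2" by (simp add: power_mult_distrib)
    then have "c * (p' - p)\<^sup>2 \<le> c * (C\<^sup>2 * (x' - x)\<^sup>2)" using c by (intro mult_left_mono) auto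
    then have "c / C\<^sup>2 * (p' - p)\<^sup>2 \<le> c * (x' - x)\<^sup>2" using c by (simp add: field_simps)
    then have 4: "c / C\<^sup>2 * (p' - p)\<^sup>2 \<le> y - y' - p' * (x - x')"
      using k(4) by (simp add: power2_commute)
    have "(c * \<bar>x' - x\<bar>)\<^sup>2 \<le> \<bar>p' - p\<bar>\<^sup>2" using h(2) c by (intro power_mono) auto
    then have "c\<^sup>2 * (x' - x)\<^sup>2 \<le> (p' - p)\<^sup>2" by (simp add: power_mult_distrib)
    then have "C * (c\<^sup>2 * (x' - x)\<^sup>2) \<le> C * (p' - p)\<^sup>2" using c by (intro mult_left_mono) auto
    then have "C * (x' - x)\<^sup>2 \<le> C / c\<^sup>2 * (p' - p)\<^sup>2" using c by (simp add: field_simps)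
    then have 5: "y - y' - p' * (x - x') \<le> C / c\<^sup>2 * (p' - p)\<^sup>2"
      using k(5) by (simp add: power2_commute)
    show ?thesis using 1 2 3 4 5 e by simp
  qed
  then show ?thesis unfolding contact_def dual_def by auto
qed

text \<open>The difference of two tangents is the convexity gap at the second base point plus a
  slope difference times \<open>z - x'\<close>. The first is quadratic in the distance of the
  elements, the second a perturbation as long as \<open>z\<close> stays close to the second base
  point.\<close>

lemma tang_diff_bounds:
  assumes S: "contact c C X S" and c: "0 \<le> c" and s: "s \<in> S" "s' \<in> S"
  shows "\<bar>tang s' z - tang s z\<bar> \<le> C * (fst s' - fst s)\<^sup>2 + C * \<bar>fst s' - fst s\<bar> * \<bar>z - fst s'\<bar>"
    and "tang s' z - tang s z \<ge> c * (fst s' - fst s)\<^sup>2 - C * \<bar>fst s' - fst s\<bar> * \<bar>z - fst s'\<bar>"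
proof -
  obtain x y p where s1: "s = (x,y,p)" by (cases s)
  obtain x' y' p' where s2: "s' = (x',y',p')" by (cases s')
  note h = contactD[OF S s[unfolded s1 s2]]
  have e: "tang s' z - tang s z = (y' - y - p * (x' - x)) + (p' - p) * (z - x')"
    by (simp add: tang_def s1 s2 algebra_simps)
  have m: "\<bar>(p' - p) * (z - x')\<bar> \<le> C * \<bar>x' - x\<bar> * \<bar>z - x'\<bar>"
    unfolding abs_mult using h(3) by (intro mult_right_mono) auto
  have k: "\<bar>y' - y - p * (x' - x)\<bar> \<le> C * (x' - x)\<^sup>2"
    using h(4,5) mult_nonneg_nonneg[OF c, of "(x' - x)\<^sup>2"] by auto
  show "tang s' z - tang s z \<ge> c * (fst s' - fst s)\<^sup>2 - C * \<bar>fst s' - fst s\<bar> * \<bar>z - fst s'\<bar>"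
    unfolding e using m h(4) by (auto simp: s1 s2)
  show "\<bar>tang s' z - tang s z\<bar> \<le> C * (fst s' - fst s)\<^sup>2 + C * \<bar>fst s' - fst s\<bar> * \<bar>z - fst s'\<bar>"
    unfolding e using m k by (auto simp: s1 s2)
qed

lemma near_bounds:
  assumes n: "near s v" and R: "0 < R" "R \<le> den v"
  shows "\<bar>abscissa v - fst s\<bar> \<le> 1 / R" "\<bar>ordinate v - tang s (abscissa v)\<bar> \<le> 1 / R\<^sup>2"
proof -
  obtain x y p where s: "s = (x,y,p)" by (cases s)
  obtain a b q where v: "v = (a,b,q)" by (cases v)
  have q: "0 < real_of_int q" "R \<le> real_of_int q" using R by (auto simp: v den_def)
  have h: "\<bar>of_int a - x * of_int q\<bar> \<le> 1"
     "of_int q * \<bar>of_int b - y * of_int q - p * (of_int a - x * of_int q)\<bar> \<le> 1"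
    using n by (auto simp: near_def s v)
  have "\<bar>abscissa v - fst s\<bar> = \<bar>of_int a - x * of_int q\<bar> / of_int q"
  proof -
    have "abscissa v - fst s = (of_int a - x * of_int q) / of_int q"
      using q by (simp add: abscissa_def v s den_def field_simps)
    then show ?thesis using q by (simp add: abs_divide)
  qed
  also have "\<dots> \<le> 1 / R" using h q R by (intro frac_le) auto
  finally show "\<bar>abscissa v - fst s\<bar> \<le> 1 / R" .
  have "ordinate v - tang s (abscissa v) = (of_int b - y * of_int q - p * (of_int a - x * of_int q)) / of_int q"
    using q by (simp add: abscissa_def ordinate_def tang_def v s den_def field_simps)
  then have "\<bar>ordinate v - tang s (abscissa v)\<bar> =
     of_int q * \<bar>of_int b - y * of_int q - p * (of_int a - x * of_int q)\<bar> / (of_int q)\<^sup>2"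
    using q by (simp add: abs_divide power2_eq_square)
  also have "\<dots> \<le> 1 / R\<^sup>2" using h q R by (intro frac_le power_mono) auto
  finally show "\<bar>ordinate v - tang s (abscissa v)\<bar> \<le> 1 / R\<^sup>2" .
qed

lemma card_le_if_separated:
  fixes z :: "'a \<Rightarrow> real"
  assumes g: "0 < g" and w: "0 \<le> w" and V: "\<And>v. v \<in> V \<Longrightarrow> l \<le> z v \<and> z v \<le> l + w"
    and sep: "\<And>v v'. v \<in> V \<Longrightarrow> v' \<in> V \<Longrightarrow> v \<noteq> v' \<Longrightarrow> g \<le> \<bar>z v - z v'\<bar>"
  shows "finite V" "real (card V) \<le> 1 + w / g"
proof -
  let ?f = "\<lambda>v. \<lfloor>(z v - l) / g\<rfloor>"
  have inj: "inj_on ?f V"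
  proof (rule inj_onI, rule ccontr)
    fix v v' assume a: "v \<in> V" "v' \<in> V" "?f v = ?f v'" "v \<noteq> v'"
    have "\<bar>(z v - l) / g - (z v' - l) / g\<bar> < 1" using a(3) by linarith
    then have "\<bar>z v - z v'\<bar> < g" using g by (simp add: diff_divide_distrib[symmetric] abs_divide)
    then show False using sep[of v v'] a by simp
  qed
  have sub: "?f ` V \<subseteq> {0..\<lfloor>w / g\<rfloor>}"
  proof
    fix k assume "k \<in> ?f ` V"
    then obtain v where v: "v \<in> V" "k = ?f v" by auto
    have "0 \<le> (z v - l) / g" "(z v - l) / g \<le> w / g"
      using V[OF v(1)] g by (auto simp: divide_right_mono)
    then show "k \<in> {0..\<lfloor>w / g\<rfloor>}" by (auto simp: v(2) intro: floor_mono)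
  qed
  show "finite V" using finite_imageD[OF finite_subset[OF sub] inj] by simp
  have "card V = card (?f ` V)" by (simp add: card_image inj)
  also have "\<dots> \<le> card {0..\<lfloor>w / g\<rfloor>}" by (intro card_mono sub) simp
  finally have "real (card V) \<le> real (nat (\<lfloor>w / g\<rfloor> + 1))" by simp
  also have "\<dots> = of_int \<lfloor>w / g\<rfloor> + 1"
  proof -
    have "0 \<le> \<lfloor>w / g\<rfloor> + 1" using g w by simp
    then show ?thesis by simp
  qed
  also have "\<dots> \<le> 1 + w / g" by linarith
  finally show "real (card V) \<le> 1 + w / g" .
qed

lemma card_int_interval_le:
  fixes l w :: real assumes "0 \<le> w"
  shows "finite {k::int. l \<le> of_int k \<and> of_int k \<le> l + w}"
    "real (card {k::int. l \<le> of_int k \<and> of_int k \<le> l + w}) \<le> 1 + w"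
  using card_le_if_separated[of 1 w "{k::int. l \<le> of_int k \<and> of_int k \<le> l + w}" l "of_int"] assms
  by (auto simp flip: of_int_diff)

text \<open>\<open>\<nu> / h\<close> is the slope \<open>p\<close> of the line and
  \<open>c / h\<close> its value of \<open>x * p - y\<close>, so \<open>(\<nu>,c,h)\<close> is a
  rational point in the coordinates of \<open>dual\<close>, with denominator
  \<open>h\<close>.\<close>

definition on_line :: "int \<times> int \<times> int \<Rightarrow> int \<times> int \<times> int \<Rightarrow> bool" where
  "on_line n v = (case n of (\<nu>,c,h) \<Rightarrow> case v of (a,b,q) \<Rightarrow> \<nu> * a - h * b = c * q)"

lemma gcd3_mult: "gcd (k * a) (gcd (k * b) (k * c)) = \<bar>k\<bar> * gcd a (gcd b (c::int))"
proof -
  have "gcd (k * a) (\<bar>k\<bar> * gcd b c) = gcd (k * a) (k * gcd b c)"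
    by (cases "k \<ge> 0") (simp_all add: gcd_neg2 flip: minus_mult_left)
  then show ?thesis by (simp add: gcd_mult_left abs_mult)
qed

text \<open>Elimination from the two line equations shows that \<open>h\<close> divides
  \<open>m * \<nu>\<close> and \<open>m * c\<close>, hence \<open>m\<close> itself because the line
  is primitive. So abscissas on the line differ by multiples of \<open>h / (q * q')\<close>.\<close>

lemma line_spacing:
  assumes n: "gcd \<nu> (gcd c h) = 1" "1 \<le> h" and v: "on_line (\<nu>,c,h) v" "on_line (\<nu>,c,h) w"
    and d: "1 \<le> den v" "den v \<le> B" "1 \<le> den w" "den w \<le> B" and ne: "abscissa v \<noteq> abscissa w"
  shows "of_int h / B\<^sup>2 \<le> \<bar>abscissa v - abscissa w\<bar>"
proof -
  obtain a b q where ve: "v = (a,b,q)" by (cases v)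
  obtain a' b' q' where we: "w = (a',b',q')" by (cases w)
  define m where "m = a * q' - a' * q"
  have l: "\<nu> * a - h * b = c * q" "\<nu> * a' - h * b' = c * q'" using v by (auto simp: on_line_def ve we)
  have "h * (b * q' - b' * q) = \<nu> * m"
    unfolding m_def using l by algebra
  moreover have "h * (a' * b - a * b') = c * m"
    unfolding m_def using l by algebra
  ultimately have "h dvd m * \<nu>" "h dvd m * c" "h dvd m * h"
    by (metis dvd_triv_left mult.commute)+
  then have "h dvd gcd (m * \<nu>) (gcd (m * c) (m * h))" by simp
  also have "gcd (m * \<nu>) (gcd (m * c) (m * h)) = \<bar>m\<bar>"
    unfolding gcd3_mult n(1) by simp
  finally have hd: "h dvd m" by simp
  have q: "0 < real_of_int q" "real_of_int q \<le> B" "0 < real_of_int q'" "real_of_int q' \<le> B"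
    using d by (auto simp: ve we den_def)
  have e: "abscissa v - abscissa w = of_int m / (of_int q * of_int q')"
    using q by (simp add: abscissa_def ve we den_def m_def field_simps)
  have "m \<noteq> 0" using ne e by auto
  then have "h \<le> \<bar>m\<bar>" using hd n(2) dvd_imp_le_int[of m h] by simp
  then have "real_of_int h \<le> \<bar>of_int m\<bar>" by linarith
  moreover have "real_of_int q * of_int q' \<le> B\<^sup>2" unfolding power2_eq_square
    using q by (intro mult_mono) auto
  moreover have "0 < real_of_int q * of_int q'" using q by simp
  ultimately have "of_int h / B\<^sup>2 \<le> \<bar>real_of_int m\<bar> / (of_int q * of_int q')"
    using n(2) by (intro frac_le) auto
  then show ?thesis using e q by (simp add: abs_divide abs_mult)
qed

text \<open>\<open>q\<close> divides \<open>q'\<close> times each entry of the first triple, hence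
  \<open>q'\<close> times their gcd, which is \<open>q'\<close>; the same holds with the roles
  exchanged.\<close>

lemma primitive_eqI:
  assumes "gcd a (gcd b q) = (1::int)" "gcd a' (gcd b' q') = 1" "1 \<le> q" "1 \<le> q'"
    "a * q' = a' * q" "b * q' = b' * q"
  shows "(a,b,q) = (a',b',q')"
proof -
  have "q dvd q' * a" "q dvd q' * b" "q dvd q' * q" using assms(5,6) by (simp_all add: mult.commute)
  then have "q dvd gcd (q' * a) (gcd (q' * b) (q' * q))" by simp
  also have "\<dots> = \<bar>q'\<bar>" unfolding gcd3_mult assms(1) by simp
  finally have 1: "q dvd q'" by simp
  have "q' dvd q * a'" "q' dvd q * b'" "q' dvd q * q'"
    using assms(5,6) by (simp_all add: mult.commute flip: assms(5,6))
  then have "q' dvd gcd (q * a') (gcd (q * b') (q * q'))" by simp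
  also have "\<dots> = \<bar>q\<bar>" unfolding gcd3_mult assms(2) by simp
  finally have 2: "q' dvd q" by simp
  have "q = q'" using 1 2 assms(3,4) zdvd_antisym_nonneg[of q q'] by simp
  then show ?thesis using assms by simp
qed

lemma Near_eqI:
  assumes "v \<in> Near S" "w \<in> Near S'" "abscissa v = abscissa w" "ordinate v = ordinate w"
  shows "v = w"
proof -
  obtain a b q where ve: "v = (a,b,q)" by (cases v)
  obtain a' b' q' where we: "w = (a',b',q')" by (cases w)
  have "real_of_int (a * q') = of_int (a' * q)" "real_of_int (b * q') = of_int (b' * q)"
    using assms by (auto simp: ve we abscissa_def ordinate_def den_def Near_def field_simps)
  then have "a * q' = a' * q" "b * q' = b' * q" by linarith+
  then show ?thesis using primitive_eqI[of a b q a' b' q'] assms by (auto simp: ve we Near_def)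
qed

text \<open>The line is the cross product of the two triples divided by its content
  \<open>g\<close>, whose sign is chosen to make \<open>h\<close> positive. The condition on the
  third triple says that the three have determinant 0.\<close>

lemma line_through:
  assumes ne: "a * q' - a' * q \<noteq> (0::int)"
  obtains \<nu> c h where "gcd \<nu> (gcd c h) = 1" "1 \<le> h"
    "\<And>a'' b'' q''. (b * q' - b' * q) * a'' - (a * q' - a' * q) * b'' = (a' * b - a * b') * q'' \<Longrightarrow>
       on_line (\<nu>,c,h) (a'',b'',q'')"
proof -
  define g where "g = gcd (b * q' - b' * q) (gcd (a' * b - a * b') (a * q' - a' * q)) * sgn (a * q' - a' * q)"
  have g0: "gcd (b * q' - b' * q) (gcd (a' * b - a * b') (a * q' - a' * q)) \<noteq> 0" using ne by simp
  have gne: "g \<noteq> 0" using ne unfolding g_def by (simp add: sgn_if)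
  have ag: "\<bar>g\<bar> = gcd (b * q' - b' * q) (gcd (a' * b - a * b') (a * q' - a' * q))"
    unfolding g_def using ne by (simp add: abs_mult abs_sgn_eq)
  have dvd: "g dvd b * q' - b' * q" "g dvd a' * b - a * b'" "g dvd a * q' - a' * q"
    using ag by (metis abs_dvd_iff gcd_dvd1 gcd_dvd2 dvd_trans)+
  obtain \<nu> where \<nu>: "b * q' - b' * q = g * \<nu>" using dvd by (elim dvdE)
  obtain c where c: "a' * b - a * b' = g * c" using dvd by (elim dvdE)
  obtain h where h: "a * q' - a' * q = g * h" using dvd by (elim dvdE)
  have "\<bar>g\<bar> * gcd \<nu> (gcd c h) = \<bar>g\<bar>"
    using ag unfolding \<nu> c h gcd3_mult by simp
  then have 1: "gcd \<nu> (gcd c h) = 1" using gne by simp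
  have "0 < gcd (b * q' - b' * q) (gcd (a' * b - a * b') (a * q' - a' * q))"
    using g0 gcd_ge_0_int by (metis order_le_less)
  then have "sgn g = sgn (a * q' - a' * q)" unfolding g_def sgn_mult sgn_sgn by (simp add: sgn_if)
  then have "sgn g = sgn g * sgn h" unfolding h sgn_mult .
  then have "sgn h = 1" using gne by (metis mult_cancel_left2 sgn_0_0)
  then have 2: "1 \<le> h" by (auto simp: sgn_if split: if_splits)
  have 3: "on_line (\<nu>,c,h) (a'',b'',q'')"
    if "(b * q' - b' * q) * a'' - (a * q' - a' * q) * b'' = (a' * b - a * b') * q''" for a'' b'' q''
  proof -
    have "g * (\<nu> * a'' - h * b'') = g * (c * q'')" using that unfolding \<nu> c h by (simp add: algebra_simps)
    then show ?thesis using gne by (simp add: on_line_def)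
  qed
  show ?thesis using that[OF 1 2 3] .
qed

subsection \<open>Counting near triples in dyadic ranges\<close>

text \<open>There are O(1 + X q) choices of \<open>a\<close>. Two elements that serve the same
  \<open>a\<close> lie within \<open>2 / q\<close> of each other, so their tangents agree at
  \<open>a / q\<close> up to 6 C / q^2, which leaves O(1) choices of \<open>b\<close>.\<close>

lemma Near_fixed_den:
  fixes q :: int
  assumes S: "contact c C X S" and c: "0 < c" "1 \<le> C" "0 \<le> X" and q: "1 \<le> q"
  defines "E \<equiv> {v \<in> Near S. snd (snd v) = q}"
  shows "finite E" "real (card E) \<le> (3 + 2 * X * of_int q) * (12 * C + 5)"
proof -
  define A where "A = {a. \<exists>b. (a,b,q) \<in> E}"
  define B where "B a = {b. (a,b,q) \<in> E}" for a
  have qr: "1 \<le> real_of_int q" using q by simp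
  have A: "finite A \<and> real (card A) \<le> 3 + 2 * X * of_int q"
  proof (cases "S = {}")
    case True
    then have "A = {}" by (auto simp: A_def E_def Near_def)
    then show ?thesis using c qr by simp
  next
    case False
    then obtain x y p where s: "(x,y,p) \<in> S" by auto
    have "A \<subseteq> {k::int. x * of_int q - X * of_int q - 1 \<le> of_int k \<and> of_int k \<le> (x * of_int q - X * of_int q - 1) + (2 * X * of_int q + 2)}"
    proof
      fix a assume "a \<in> A"
      then obtain b x' y' p' where a: "(x',y',p') \<in> S" "near (x',y',p') (a,b,q)"
        by (auto simp: A_def E_def Near_def)
      have "\<bar>(x' - x) * of_int q\<bar> \<le> X * of_int q"
        unfolding abs_mult using contactD(1)[OF S s a(1)] qr by (simp add: mult_right_mono)
      moreover have "\<bar>of_int a - x' * of_int q\<bar> \<le> 1" using a(2) by (auto simp: near_def)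
      ultimately have "- X * of_int q - 1 \<le> of_int a - x * of_int q" "of_int a - x * of_int q \<le> X * of_int q + 1"
        by (auto simp: abs_le_iff algebra_simps)
      then show "a \<in> {k::int. x * of_int q - X * of_int q - 1 \<le> of_int k \<and> of_int k \<le> (x * of_int q - X * of_int q - 1) + (2 * X * of_int q + 2)}"
        by (auto simp: algebra_simps)
    qed
    note sub = this
    have w: "0 \<le> 2 * X * of_int q + 2" using c qr by simp
    note k = card_int_interval_le[OF w, of "x * of_int q - X * of_int q - 1"]
    show ?thesis using finite_subset[OF sub k(1)] card_mono[OF k(1) sub] k(2) by linarith
  qed
  have B: "finite (B a) \<and> real (card (B a)) \<le> 12 * C + 5" for a
  proof (cases "B a = {}")
    case True then show ?thesis using c by simp
  next
    case False
    then obtain b0 where b0: "(a,b0,q) \<in> E" by (auto simp: B_def)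
    then obtain s0 where s0: "s0 \<in> S" "near s0 (a,b0,q)" by (auto simp: E_def Near_def)
    have "B a \<subseteq> {k::int. of_int b0 - (6 * C + 2) \<le> of_int k \<and> of_int k \<le> (of_int b0 - (6 * C + 2)) + (12 * C + 4)}"
    proof
      fix b assume "b \<in> B a"
      then obtain s where s: "s \<in> S" "near s (a,b,q)" by (auto simp: B_def E_def Near_def)
      define z where "z = abscissa (a,b,q)"
      have zz: "abscissa (a,b0,q) = z" by (simp add: z_def abscissa_def den_def)
      have dq: "den (a,b,q) = of_int q" "den (a,b0,q) = of_int q" by (auto simp: den_def)
      have n0: "\<bar>z - fst s0\<bar> \<le> 1 / of_int q" "\<bar>ordinate (a,b0,q) - tang s0 z\<bar> \<le> 1 / (of_int q)\<^sup>2"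
        using near_bounds[OF s0(2), of "of_int q"] qr by (auto simp: dq zz)
      have n1: "\<bar>z - fst s\<bar> \<le> 1 / of_int q" "\<bar>ordinate (a,b,q) - tang s z\<bar> \<le> 1 / (of_int q)\<^sup>2"
        using near_bounds[OF s(2), of "of_int q"] qr by (auto simp: dq z_def)
      have d: "\<bar>fst s - fst s0\<bar> \<le> 2 * (1 / of_int q)" using n0 n1 by linarith
      have "\<bar>tang s z - tang s0 z\<bar> \<le> C * (fst s - fst s0)\<^sup>2 + C * \<bar>fst s - fst s0\<bar> * \<bar>z - fst s\<bar>"
        using tang_diff_bounds(1)[OF S _ s0(1) s(1)] c by simp
      also have "\<dots> \<le> C * (2 * (1 / of_int q))\<^sup>2 + C * (2 * (1 / of_int q)) * (1 / of_int q)"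
        using c d n1 abs_le_square_iff[of "fst s - fst s0" "2 * (1 / of_int q)"] qr
        by (intro add_mono mult_mono mult_left_mono) auto
      finally have "\<bar>tang s z - tang s0 z\<bar> \<le> 6 * C * (1 / of_int q)\<^sup>2" by (simp add: power2_eq_square)
      then have "\<bar>ordinate (a,b,q) - ordinate (a,b0,q)\<bar> \<le> (6 * C + 2) * (1 / of_int q)\<^sup>2"
        using n0 n1 by (simp add: algebra_simps power_divide)
      moreover have "ordinate (a,b,q) - ordinate (a,b0,q) = (of_int b - of_int b0) / of_int q"
        by (simp add: ordinate_def den_def diff_divide_distrib)
      ultimately have "\<bar>real_of_int b - of_int b0\<bar> \<le> (6 * C + 2) / of_int q"
        using qr by (simp add: abs_divide power2_eq_square field_simps)
      also have "\<dots> \<le> (6 * C + 2) / 1" using c qr by (intro divide_left_mono) auto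
      finally show "b \<in> {k::int. of_int b0 - (6 * C + 2) \<le> of_int k \<and> of_int k \<le> (of_int b0 - (6 * C + 2)) + (12 * C + 4)}"
        by (auto simp: abs_le_iff)
    qed
    note sub = this
    have w: "0 \<le> 12 * C + 4" using c by simp
    note k = card_int_interval_le[OF w, of "of_int b0 - (6 * C + 2)"]
    show ?thesis using finite_subset[OF sub k(1)] card_mono[OF k(1) sub] k(2) by linarith
  qed
  have E: "E = (\<lambda>(a,b). (a,b,q)) ` (Sigma A B)"
    by (force simp: A_def B_def E_def)
  show "finite E" unfolding E using A B by auto
  have "card E \<le> card (Sigma A B)" unfolding E using A B by (intro card_image_le) auto
  also have "card (Sigma A B) = (\<Sum>a\<in>A. card (B a))" using A B by (intro card_SigmaI) auto
  finally have "real (card E) \<le> (\<Sum>a\<in>A. real (card (B a)))" by (simp flip: of_nat_sum)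
  also have "\<dots> \<le> (\<Sum>a\<in>A. 12 * C + 5)" using B by (intro sum_mono) auto
  also have "\<dots> = real (card A) * (12 * C + 5)" by simp
  also have "\<dots> \<le> (3 + 2 * X * of_int q) * (12 * C + 5)" using A c by (intro mult_right_mono) auto
  finally show "real (card E) \<le> (3 + 2 * X * of_int q) * (12 * C + 5)" .
qed

lemma Near_upto_decomp: "Near_upto S Y = (\<Union>q\<in>{1..\<lfloor>Y\<rfloor>}. {v \<in> Near S. snd (snd v) = q})"
  by (auto simp: Near_upto_def den_def Near_def le_floor_iff)

lemma Near_upto_finite:
  assumes "contact c C X S" "0 < c" "1 \<le> C" "0 \<le> X"
  shows "finite (Near_upto S Y)"
  unfolding Near_upto_decomp using Near_fixed_den(1)[OF assms] by auto

text \<open>Inverse denominators are summed because a line of height \<open>h\<close> carries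
  O(\<open>R / h\<close>) triples. A count O(\<open>R * R powr \<tau>\<close>) in every dyadic range
  amounts to O(\<open>Y powr \<tau>\<close>) for this sum, so the iteration closes within
  it.\<close>

definition weight :: "(real \<times> real \<times> real) set \<Rightarrow> real \<Rightarrow> real" where
  "weight S Y = (\<Sum>v\<in>Near_upto S Y. 1 / den v)"

text \<open>The start of the iteration: O(q) triples of denominator \<open>q\<close>, each of weight
  1 / q, give the exponent \<theta> = 1.\<close>

lemma weight_trivial:
  assumes S: "contact c C X S" and c: "0 < c" "1 \<le> C" "0 \<le> X" and Y: "0 \<le> Y"
  shows "weight S Y \<le> (3 + 2 * X) * (12 * C + 5) * Y"
proof -
  have "weight S Y = (\<Sum>q\<in>{1..\<lfloor>Y\<rfloor>}. \<Sum>v\<in>{v \<in> Near S. snd (snd v) = q}. 1 / den v)"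
    unfolding weight_def Near_upto_decomp
    by (rule sum.UNION_disjoint) (auto intro: Near_fixed_den(1)[OF S c])
  also have "\<dots> = (\<Sum>q\<in>{1..\<lfloor>Y\<rfloor>}. real (card {v \<in> Near S. snd (snd v) = q}) / of_int q)"
    by (intro sum.cong) (auto simp: den_def)
  also have "\<dots> \<le> (\<Sum>q\<in>{1..\<lfloor>Y\<rfloor>}. (3 + 2 * X) * (12 * C + 5))"
  proof (intro sum_mono)
    fix q assume q: "q \<in> {1..\<lfloor>Y\<rfloor>}"
    then have q1: "1 \<le> q" "1 \<le> real_of_int q" by auto
    have "real (card {v \<in> Near S. snd (snd v) = q}) \<le> (3 + 2 * X * of_int q) * (12 * C + 5)"
      by (rule Near_fixed_den(2)[OF S c q1(1)])
    also have "\<dots> \<le> (3 * of_int q + 2 * X * of_int q) * (12 * C + 5)"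
      using c q1 by (intro mult_right_mono) auto
    also have "\<dots> = (3 + 2 * X) * (12 * C + 5) * of_int q" by (simp add: algebra_simps)
    finally show "real (card {v \<in> Near S. snd (snd v) = q}) / of_int q \<le> (3 + 2 * X) * (12 * C + 5)"
      using q1 by (simp add: field_simps)
  qed
  also have "\<dots> = of_int \<lfloor>Y\<rfloor> * ((3 + 2 * X) * (12 * C + 5))" using Y by simp
  also have "\<dots> \<le> Y * ((3 + 2 * X) * (12 * C + 5))" using c by (intro mult_right_mono) auto
  finally show ?thesis by (simp add: mult.commute)
qed

section \<open>Triples with denominators between R and 2 R\<close>

locale dyadic =
  fixes c C X R :: real and S :: "(real \<times> real \<times> real) set"
  assumes S: "contact c C X S" and c: "0 < c" "c \<le> 1" "1 \<le> C" "0 \<le> X" and R: "1 \<le> R"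
begin

definition D where "D = {v \<in> Near S. R \<le> den v \<and> den v < 2 * R}"

lemma D_finite: "finite D"
  by (rule finite_subset[OF _ Near_upto_finite[OF S, of "2 * R"]])
    (use c R in \<open>auto simp: D_def Near_upto_def\<close>)

definition sv where "sv v = (SOME s. s \<in> S \<and> near s v)"

lemma sv: assumes "v \<in> D" shows "sv v \<in> S" "near (sv v) v"
proof -
  have "\<exists>s. s \<in> S \<and> near s v" using assms by (auto simp: D_def Near_def)
  from someI_ex[OF this] show "sv v \<in> S" "near (sv v) v" by (auto simp: sv_def)
qed

lemma sv_bounds:
  assumes "v \<in> D"
  shows "\<bar>abscissa v - fst (sv v)\<bar> \<le> 1 / R" "\<bar>ordinate v - tang (sv v) (abscissa v)\<bar> \<le> 1 / R\<^sup>2"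
  using near_bounds[OF sv(2)[OF assms], of R] assms R by (auto simp: D_def)

lemma D_eqI: "v \<in> D \<Longrightarrow> w \<in> D \<Longrightarrow> abscissa v = abscissa w \<Longrightarrow> ordinate v = ordinate w \<Longrightarrow> v = w"
  using Near_eqI[of v S w S] by (auto simp: D_def)

lemma on_line_ordinate:
  assumes "on_line (\<nu>,k,h) v" "1 \<le> h" "v \<in> D"
  shows "ordinate v = (of_int \<nu> * abscissa v - of_int k) / of_int h"
proof -
  obtain a b q where v: "v = (a,b,q)" by (cases v)
  have q: "0 < real_of_int q" using assms(3) R by (auto simp: D_def den_def v)
  have "of_int \<nu> * of_int a - of_int h * of_int b = (of_int k * of_int q :: real)"
    using assms(1) unfolding v on_line_def by (simp flip: of_int_mult of_int_diff)
  then show ?thesis using q assms(2)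
    by (simp add: ordinate_def abscissa_def v den_def field_simps)
qed

text \<open>Strict convexity against a line. Over the tangent at the element of the middle triple,
  both outer triples have height at least 3 / R^2 and the middle one at most 1 / R^2, yet along the
  line this height is affine in the abscissa. The separation is chosen so that the quadratic term
  \<open>c * d\<^sup>2\<close> exceeds the perturbation C d / R by 4 / R^2, of which the tolerance
  costs 1 / R^2.\<close>

lemma no_three_far:
  assumes h: "1 \<le> h" and v: "v1 \<in> D" "v2 \<in> D" "v3 \<in> D"
    and l: "on_line (\<nu>,k,h) v1" "on_line (\<nu>,k,h) v2" "on_line (\<nu>,k,h) v3"
    and g: "abscissa v1 + (2 + (C + 2) / c) / R \<le> abscissa v2" "abscissa v2 + (2 + (C + 2) / c) / R \<le> abscissa v3"
  shows False
proof -
  define T where "T = tang (sv v2)"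
  have far: "ordinate w - T (abscissa w) \<ge> 3 / R\<^sup>2"
    if w: "w \<in> D" "(2 + (C + 2) / c) / R \<le> \<bar>abscissa w - abscissa v2\<bar>" for w
  proof -
    define d where "d = \<bar>fst (sv w) - fst (sv v2)\<bar>"
    have "\<bar>abscissa w - abscissa v2\<bar> \<le> d + 2 / R"
      using sv_bounds(1)[OF w(1)] sv_bounds(1)[OF v(2)] unfolding d_def by linarith
    then have "(2 + (C + 2) / c) / R - 2 / R \<le> d" using w(2) by linarith
    then have d: "(C + 2) / c / R \<le> d" by (simp add: add_divide_distrib)
    have "(C + 2) / R \<le> c * d" using d c R by (simp add: field_simps)
    then have cd: "2 / R \<le> c * d - C / R" by (simp add: add_divide_distrib)
    have "2 / R \<le> (C + 2) / c / R" using c R by (intro divide_right_mono) (auto simp: field_simps)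
    then have d2: "2 / R \<le> d" using d by linarith
    have "T (abscissa w) + (c * d\<^sup>2 - C * d * \<bar>abscissa w - fst (sv w)\<bar>) \<le> tang (sv w) (abscissa w)"
      using tang_diff_bounds(2)[OF S _ sv(1)[OF v(2)] sv(1)[OF w(1)], of "abscissa w"] c
      by (simp add: T_def d_def)
    moreover have "C * d * \<bar>abscissa w - fst (sv w)\<bar> \<le> C * d * (1 / R)"
      using sv_bounds(1)[OF w(1)] c by (intro mult_left_mono) (auto simp: d_def)
    moreover have "c * d\<^sup>2 - C * d * (1 / R) = d * (c * d - C / R)"
      by (simp add: power2_eq_square algebra_simps)
    moreover have "2 / R * (2 / R) \<le> d * (c * d - C / R)"
      using d2 cd R by (intro mult_mono) (auto simp: d_def)
    ultimately have "T (abscissa w) + 4 / R\<^sup>2 \<le> tang (sv w) (abscissa w)"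
      by (simp add: power2_eq_square)
    then show ?thesis using sv_bounds(2)[OF w(1)] by (simp add: abs_le_iff)
  qed
  have pos: "0 < (2 + (C + 2) / c) / R" using c R by (simp add: add_pos_pos)
  define z1 z2 z3 where z: "z1 = abscissa v1" "z2 = abscissa v2" "z3 = abscissa v3"
  have f1: "ordinate v1 - T z1 \<ge> 3 / R\<^sup>2" using far[OF v(1)] g pos by (simp add: z)
  have f3: "ordinate v3 - T z3 \<ge> 3 / R\<^sup>2" using far[OF v(3)] g pos by (simp add: z)
  have f2: "ordinate v2 - T z2 \<le> 1 / R\<^sup>2" using sv_bounds(2)[OF v(2)] by (simp add: T_def z)
  obtain x y p where s: "sv v2 = (x,y,p)" by (cases "sv v2")
  define \<alpha> \<beta> where "\<alpha> = of_int \<nu> / of_int h - p" and "\<beta> = - of_int k / of_int h - y + p * x"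
  have aff: "ordinate w - T (abscissa w) = \<alpha> * abscissa w + \<beta>" if "w \<in> D" "on_line (\<nu>,k,h) w" for w
    using on_line_ordinate[OF that(2) h that(1)]
    by (simp add: T_def tang_def s \<alpha>_def \<beta>_def diff_divide_distrib algebra_simps)
  \<comment> \<open>The height at \<open>z2\<close> as weighted mean of the heights at
    \<open>z1\<close> and \<open>z3\<close>, cleared of denominators.\<close>
  have "(z3 - z2) * (\<alpha> * z1 + \<beta>) + (z2 - z1) * (\<alpha> * z3 + \<beta>) = (z3 - z1) * (\<alpha> * z2 + \<beta>)" by algebra
  moreover have "(z3 - z2) * (3 / R\<^sup>2) \<le> (z3 - z2) * (\<alpha> * z1 + \<beta>)"
    using f1 aff[OF v(1) l(1)] g pos by (intro mult_left_mono) (auto simp: z)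
  moreover have "(z2 - z1) * (3 / R\<^sup>2) \<le> (z2 - z1) * (\<alpha> * z3 + \<beta>)"
    using f3 aff[OF v(3) l(3)] g pos by (intro mult_left_mono) (auto simp: z)
  moreover have "(z3 - z1) * (\<alpha> * z2 + \<beta>) \<le> (z3 - z1) * (1 / R\<^sup>2)"
    using f2 aff[OF v(2) l(2)] g pos by (intro mult_left_mono) (auto simp: z)
  moreover have "(z3 - z2) * (3 / R\<^sup>2) + (z2 - z1) * (3 / R\<^sup>2) = (z3 - z1) * (3 / R\<^sup>2)"
    by algebra
  ultimately have "(z3 - z1) * (3 / R\<^sup>2) \<le> (z3 - z1) * (1 / R\<^sup>2)" by linarith
  moreover have "0 < z3 - z1" using g pos by (simp add: z)
  ultimately have "3 / R\<^sup>2 \<le> 1 / R\<^sup>2" using mult_le_cancel_left_pos by blast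
  then show False using R by (simp add: divide_le_cancel)
qed


text \<open>By \<open>no_three_far\<close> the triples on a line form at most two clusters of length
  \<open>G / R\<close>, and within a cluster they are at least h / (4 R^2) apart. The hypothesis
  \<open>of_int h \<le> R\<close> absorbs the additive constant.\<close>

lemma card_on_line:
  assumes n: "gcd \<nu> (gcd k h) = 1" "1 \<le> h" "of_int h \<le> R"
  shows "real (card {v \<in> D. on_line (\<nu>,k,h) v}) \<le> (2 + 8 * (2 + (C + 2) / c)) * R / of_int h"
proof -
  define G where "G = 2 + (C + 2) / c"
  have G: "0 \<le> G" using c by (simp add: G_def)
  define V where "V = {v \<in> D. on_line (\<nu>,k,h) v}"
  have fV: "finite V" using D_finite by (simp add: V_def)
  have hr: "1 \<le> real_of_int h" using n by simp
  have sep: "of_int h / (2 * R)\<^sup>2 \<le> \<bar>abscissa v - abscissa w\<bar>" if "v \<in> V" "w \<in> V" "v \<noteq> w" for v w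
  proof (rule line_spacing[OF n(1,2)])
    have vw: "v \<in> D" "w \<in> D" "on_line (\<nu>,k,h) v" "on_line (\<nu>,k,h) w" using that by (auto simp: V_def)
    show "abscissa v \<noteq> abscissa w"
      using D_eqI[OF vw(1,2)] on_line_ordinate[OF vw(3) n(2) vw(1)] on_line_ordinate[OF vw(4) n(2) vw(2)] that(3)
      by auto
  qed (use that R in \<open>auto simp: V_def D_def\<close>)
  have cluster: "real (card {v \<in> V. l \<le> abscissa v \<and> abscissa v \<le> l + G / R}) \<le> 1 + 4 * G * R / of_int h" for l
  proof -
    have "real (card {v \<in> V. l \<le> abscissa v \<and> abscissa v \<le> l + G / R}) \<le> 1 + (G / R) / (of_int h / (2 * R)\<^sup>2)"
      by (rule card_le_if_separated(2)[where z = abscissa and l = l]) (use hr R G sep in auto)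
    also have "(G / R) / (of_int h / (2 * R)\<^sup>2) = 4 * G * R / of_int h"
      using R hr by (simp add: field_simps power2_eq_square)
    finally show ?thesis .
  qed
  have pos: "0 \<le> G * R / of_int h" using G R hr by simp
  have total: "real (card V) \<le> 2 + 8 * G * R / of_int h"
  proof (cases "V = {}")
    case True then show ?thesis using pos by simp
  next
    case False
    \<comment> \<open>One cluster starts at the smallest abscissa, the other at the smallest one
      beyond the first cluster; anything beyond the second would complete a forbidden
      configuration.\<close>
    define z0 where "z0 = Min (abscissa ` V)"
    have "z0 \<in> abscissa ` V" unfolding z0_def using fV False by (intro Min_in) auto
    then obtain v0 where v0: "v0 \<in> V" "abscissa v0 = z0" by auto
    have ge: "z0 \<le> abscissa v" if "v \<in> V" for v using that fV by (simp add: z0_def)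
    define V1 where "V1 = {v \<in> V. z0 \<le> abscissa v \<and> abscissa v \<le> z0 + G / R}"
    define V2 where "V2 = {v \<in> V. z0 + G / R < abscissa v}"
    have "real (card V2) \<le> 1 + 4 * G * R / of_int h"
    proof (cases "V2 = {}")
      case True then show ?thesis using pos by simp
    next
      case ne: False
      define z1 where "z1 = Min (abscissa ` V2)"
      have fV2: "finite V2" using fV by (simp add: V2_def)
      have "z1 \<in> abscissa ` V2" unfolding z1_def using fV2 ne by (intro Min_in) auto
      then obtain v1 where v1: "v1 \<in> V2" "abscissa v1 = z1" by auto
      have "V2 \<subseteq> {v \<in> V. z1 \<le> abscissa v \<and> abscissa v \<le> z1 + G / R}"
      proof
        fix v assume v: "v \<in> V2"
        have "z1 \<le> abscissa v" using v fV2 by (simp add: z1_def)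
        moreover have "\<not> z1 + G / R < abscissa v"
        proof
          assume "z1 + G / R < abscissa v"
          then show False
            using no_three_far[OF n(2), of v0 v1 v \<nu> k] v v0 v1 by (auto simp: V_def V2_def G_def)
        qed
        ultimately show "v \<in> {v \<in> V. z1 \<le> abscissa v \<and> abscissa v \<le> z1 + G / R}" using v by (auto simp: V2_def)
      qed
      then have "card V2 \<le> card {v \<in> V. z1 \<le> abscissa v \<and> abscissa v \<le> z1 + G / R}"
        using fV by (intro card_mono) auto
      then show ?thesis using cluster[of z1] by linarith
    qed
    moreover have "real (card V1) \<le> 1 + 4 * G * R / of_int h" unfolding V1_def by (rule cluster)
    moreover have "card V \<le> card V1 + card V2"
    proof -
      have "V = V1 \<union> V2" using ge by (auto simp: V1_def V2_def)
      then show ?thesis using card_Un_le[of V1 V2] by simp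
    qed
    ultimately show ?thesis by linarith
  qed
  also have "\<dots> \<le> 2 * (R / of_int h) + 8 * G * R / of_int h"
  proof -
    have "1 \<le> R / of_int h" using n(3) hr by simp
    then show ?thesis by linarith
  qed
  also have "\<dots> = (2 + 8 * G) * R / of_int h" by (simp add: add_divide_distrib distrib_right)
  finally show ?thesis by (simp add: V_def G_def)
qed

text \<open>
  With this cell size three triples in a cell have a determinant smaller than \<open>1\<close>, and the line through
  two of them is \<open>near\<close> the dual curve with the same constant \<open>1\<close>, so that the bound can be iterated.
\<close>

definition c0 where "c0 = 1 / (16 * C)"

text \<open>The last two facts are what the cell size is made for: \<open>16 * c0\<^sup>2\<close>
  bounds a determinant of three triples in a cell, and \<open>16 * c0\<^sup>2 * (3 + 12 * C)\<close>
  the second condition of \<open>near\<close> for the line through them.\<close>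

lemma c0: "0 < c0" "c0 \<le> 1/16" "16 * c0\<^sup>2 * (3 + 12 * C) \<le> 1" "16 * c0\<^sup>2 < 1"
proof -
  show "0 < c0" "c0 \<le> 1/16" using c by (auto simp: c0_def field_simps)
  have "16 * c0\<^sup>2 * (3 + 12 * C) \<le> 16 * c0\<^sup>2 * (16 * C)" using c by (intro mult_left_mono) auto
  also have "\<dots> = 1 / C" using c by (simp add: c0_def power2_eq_square field_simps)
  also have "\<dots> \<le> 1" using c by simp
  finally show "16 * c0\<^sup>2 * (3 + 12 * C) \<le> 1" .
  have "c0\<^sup>2 \<le> (1/16)\<^sup>2" using \<open>c0 \<le> 1/16\<close> \<open>0 < c0\<close> by (intro power_mono) auto
  then show "16 * c0\<^sup>2 < 1" by (simp add: power2_eq_square)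
qed

definition k1 where "k1 v = \<lfloor>abscissa v * R / c0\<rfloor>"
definition ref where "ref v = sv (SOME w. w \<in> D \<and> k1 w = k1 v)"
text \<open>The height above a tangent depending only on the cell, so that it differs from the ordinate by an
  affine function on each cell.\<close>

definition e where "e v = ordinate v - tang (ref v) (abscissa v)"
definition k2 where "k2 v = \<lfloor>e v * R\<^sup>2 / c0\<rfloor>"
definition bin where "bin v = (k1 v, k2 v)"

lemma floor_eq_close:
  fixes u v t :: real
  assumes "\<lfloor>u * t / g\<rfloor> = \<lfloor>v * t / g\<rfloor>" "0 < t" "0 < g"
  shows "\<bar>u - v\<bar> < g / t"
proof -
  have "\<bar>u * t / g - v * t / g\<bar> < 1" using assms(1) by linarith
  moreover have "u * t / g - v * t / g = (u - v) * (t / g)" by (simp add: left_diff_distrib diff_divide_distrib)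
  ultimately have "\<bar>u - v\<bar> * (t / g) < 1" using assms(2,3) by (simp add: abs_mult)
  then show ?thesis using assms(2,3) by (simp add: field_simps)
qed

lemma k1_close: "k1 v = k1 w \<Longrightarrow> \<bar>abscissa v - abscissa w\<bar> < c0 / R"
proof -
  assume "k1 v = k1 w"
  then show ?thesis using floor_eq_close[of "abscissa v" R c0 "abscissa w"] R c0(1) by (simp add: k1_def)
qed

text \<open>\<open>ref v\<close> is the element of some triple within \<open>c0 / R\<close> of
  \<open>v\<close>, hence it is at distance O(1 / R) from \<open>sv v\<close>; exchanging the two
  tangents costs (9 + 3) C / R^2.\<close>

lemma ref:
  assumes "v \<in> D"
  shows "ref v \<in> S" "\<bar>abscissa v - fst (ref v)\<bar> \<le> 2 / R"
    "\<bar>fst (sv v) - fst (ref v)\<bar> \<le> 3 / R" "\<bar>e v\<bar> \<le> (1 + 12 * C) / R\<^sup>2"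
proof -
  define w where "w = (SOME w. w \<in> D \<and> k1 w = k1 v)"
  have "\<exists>w. w \<in> D \<and> k1 w = k1 v" using assms by blast
  from someI_ex[OF this] have w: "w \<in> D" "k1 w = k1 v" by (auto simp: w_def)
  have r: "ref v = sv w" by (simp add: ref_def w_def)
  show rS: "ref v \<in> S" unfolding r by (rule sv(1)[OF w(1)])
  have k: "\<bar>abscissa v - abscissa w\<bar> < c0 / R" using k1_close w(2) by simp
  have "c0 / R \<le> 1 / R" using c0(2) R by (simp add: divide_right_mono)
  then show 1: "\<bar>abscissa v - fst (ref v)\<bar> \<le> 2 / R" using k sv_bounds(1)[OF w(1)] unfolding r by linarith
  show d: "\<bar>fst (sv v) - fst (ref v)\<bar> \<le> 3 / R" using 1 sv_bounds(1)[OF assms] by (simp add: abs_le_iff)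
  have "\<bar>tang (sv v) (abscissa v) - tang (ref v) (abscissa v)\<bar> \<le>
      C * (fst (sv v) - fst (ref v))\<^sup>2 + C * \<bar>fst (sv v) - fst (ref v)\<bar> * \<bar>abscissa v - fst (sv v)\<bar>"
    using tang_diff_bounds(1)[OF S _ rS sv(1)[OF assms]] c by simp
  also have "\<dots> \<le> C * (3 / R)\<^sup>2 + C * (3 / R) * (1 / R)"
    using c d R sv_bounds(1)[OF assms] abs_le_square_iff[of "fst (sv v) - fst (ref v)" "3 / R"]
    by (intro add_mono mult_mono mult_left_mono) auto
  also have "\<dots> = 12 * C / R\<^sup>2" by (simp add: power2_eq_square)
  finally have "\<bar>tang (sv v) (abscissa v) - tang (ref v) (abscissa v)\<bar> \<le> 12 * C / R\<^sup>2" .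
  then show "\<bar>e v\<bar> \<le> (1 + 12 * C) / R\<^sup>2"
    using sv_bounds(2)[OF assms] unfolding e_def by (simp add: add_divide_distrib abs_le_iff)
qed

lemma same_bin:
  assumes "bin v = bin w"
  shows "ref v = ref w" "\<bar>abscissa v - abscissa w\<bar> < c0 / R" "\<bar>e v - e w\<bar> < c0 / R\<^sup>2"
proof -
  have b: "k1 v = k1 w" "k2 v = k2 w" using assms by (auto simp: bin_def)
  show "ref v = ref w" by (simp add: ref_def b)
  show "\<bar>abscissa v - abscissa w\<bar> < c0 / R" using b k1_close by blast
  show "\<bar>e v - e w\<bar> < c0 / R\<^sup>2"
    using floor_eq_close[of "e v" "R\<^sup>2" c0 "e w"] R c0(1) b(2) by (simp add: k2_def)
qed

definition B0 where "B0 = (2 * X + 6) / c0 * (2 * (1 + 12 * C) / c0 + 2)"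

text \<open>The abscissas fill an interval of bounded length, which gives O(R) values of
  \<open>k1\<close>; \<open>e v * R\<^sup>2\<close> is bounded, which gives O(1) values of
  \<open>k2\<close>.\<close>

lemma card_bins: "finite (bin ` D)" "real (card (bin ` D)) \<le> B0 * R"
proof -
  show "finite (bin ` D)" using D_finite by simp
  show "real (card (bin ` D)) \<le> B0 * R"
  proof (cases "D = {}")
    case True then show ?thesis using c c0 R by (simp add: B0_def)
  next
    case False
    then obtain v0 where v0: "v0 \<in> D" by auto
    define x0 where "x0 = fst (sv v0)"
    define K1 where "K1 = {k::int. (x0 - X - 1) * R / c0 - 1 \<le> of_int k \<and> of_int k \<le> ((x0 - X - 1) * R / c0 - 1) + ((2 * X + 2) * R / c0 + 1)}"
    define K2 where "K2 = {k::int. - ((1 + 12 * C) / c0) - 1 \<le> of_int k \<and> of_int k \<le> (- ((1 + 12 * C) / c0) - 1) + (2 * (1 + 12 * C) / c0 + 1)}"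
    have w1: "0 \<le> (2 * X + 2) * R / c0 + 1" using c R c0 by simp
    have w2: "0 \<le> 2 * (1 + 12 * C) / c0 + 1" using c R c0 by simp
    have f1: "finite K1" "real (card K1) \<le> 1 + ((2 * X + 2) * R / c0 + 1)"
      unfolding K1_def using card_int_interval_le[OF w1] by blast+
    have f2: "finite K2" "real (card K2) \<le> 1 + (2 * (1 + 12 * C) / c0 + 1)"
      unfolding K2_def using card_int_interval_le[OF w2] by blast+
    have "bin ` D \<subseteq> K1 \<times> K2"
    proof
      fix \<beta> assume "\<beta> \<in> bin ` D"
      then obtain v where v: "v \<in> D" "\<beta> = bin v" by auto
      have "\<bar>fst (sv v) - x0\<bar> \<le> X"
        using contactD(1)[OF S, of "x0" _ _ "fst (sv v)"] sv(1)[OF v(1)] sv(1)[OF v0]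
        by (metis prod.collapse x0_def)
      moreover have "\<bar>abscissa v - fst (sv v)\<bar> \<le> 1"
        using sv_bounds(1)[OF v(1)] R by (smt (verit) divide_le_eq_1)
      ultimately have "x0 - X - 1 \<le> abscissa v" "abscissa v \<le> x0 - X - 1 + (2 * X + 2)" by (auto simp: abs_le_iff)
      then have "(x0 - X - 1) * R / c0 \<le> abscissa v * R / c0"
         "abscissa v * R / c0 \<le> (x0 - X - 1 + (2 * X + 2)) * R / c0"
        using R c0 by (intro divide_right_mono mult_right_mono; simp)+
      then have "k1 v \<in> K1" unfolding K1_def k1_def distrib_right add_divide_distrib mem_Collect_eq by linarith
      moreover have "k2 v \<in> K2"
      proof -
        have "\<bar>e v * R\<^sup>2 / c0\<bar> = \<bar>e v\<bar> * R\<^sup>2 / c0" using R c0 by (simp add: abs_mult abs_divide)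
        also have "\<dots> \<le> (1 + 12 * C) / R\<^sup>2 * R\<^sup>2 / c0"
          using ref(4)[OF v(1)] c0 by (intro divide_right_mono mult_right_mono) auto
        also have "\<dots> = (1 + 12 * C) / c0" using R by simp
        finally have "- ((1 + 12 * C) / c0) \<le> e v * R\<^sup>2 / c0" "e v * R\<^sup>2 / c0 \<le> (1 + 12 * C) / c0"
          unfolding abs_le_iff by linarith+
        moreover have "2 * (1 + 12 * C) / c0 = (1 + 12 * C) / c0 + (1 + 12 * C) / c0" by (simp add: add_divide_distrib)
        ultimately show ?thesis unfolding K2_def k2_def mem_Collect_eq by linarith
      qed
      ultimately show "\<beta> \<in> K1 \<times> K2" by (simp add: v bin_def)
    qed
    then have "card (bin ` D) \<le> card (K1 \<times> K2)" using f1 f2 by (intro card_mono) auto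
    then have "real (card (bin ` D)) \<le> real (card K1) * real (card K2)"
      unfolding card_cartesian_product by (simp flip: of_nat_mult)
    also have "\<dots> \<le> ((2 * X + 6) / c0 * R) * (2 * (1 + 12 * C) / c0 + 2)"
    proof (intro mult_mono)
      have "2 \<le> 4 * R / c0"
      proof -
        have "2 * c0 \<le> 4 * R" using c0 R by linarith
        then show ?thesis using c0 by (simp add: field_simps)
      qed
      then show "real (card K1) \<le> (2 * X + 6) / c0 * R"
        using f1(2) by (simp add: add_divide_distrib distrib_right)
      show "real (card K2) \<le> 2 * (1 + 12 * C) / c0 + 2" using f2(2) by simp
    qed (use c c0 R in auto)
    finally show ?thesis by (simp add: B0_def mult_ac)
  qed
qed

text \<open>Distinct triples on a vertical line have ordinates at least 1 / (4 R^2) apart, and this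
  exceeds the cell height because \<open>c0\<close> is below 1 / 4.\<close>

lemma bin_distinct_abscissa:
  assumes v: "v \<in> D" "w \<in> D" "bin v = bin w" "v \<noteq> w"
  shows "abscissa v \<noteq> abscissa w"
proof
  assume eq: "abscissa v = abscissa w"
  have "\<bar>ordinate v - ordinate w\<bar> < c0 / R\<^sup>2"
    using same_bin(3)[OF v(3)] unfolding e_def same_bin(1)[OF v(3)] eq by simp
  obtain a b q where ve: "v = (a,b,q)" by (cases v)
  obtain a' b' q' where we: "w = (a',b',q')" by (cases w)
  have q: "1 \<le> real_of_int q" "real_of_int q \<le> 2 * R" "1 \<le> real_of_int q'" "real_of_int q' \<le> 2 * R"
    using v R by (auto simp: D_def ve we den_def)
  have "ordinate v - ordinate w = of_int (b * q' - b' * q) / (of_int q * of_int q')"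
    using q by (simp add: ordinate_def ve we den_def field_simps)
  moreover have ne: "b * q' - b' * q \<noteq> 0"
  proof
    assume "b * q' - b' * q = 0"
    then have "ordinate v = ordinate w" using \<open>ordinate v - ordinate w = _\<close> by simp
    then show False using D_eqI[OF v(1,2) eq] v(4) by simp
  qed
  ultimately have "1 / (of_int q * of_int q') \<le> \<bar>ordinate v - ordinate w\<bar>"
  proof -
    have "1 \<le> \<bar>b * q' - b' * q\<bar>" using ne by linarith
    then have "1 \<le> \<bar>real_of_int (b * q' - b' * q)\<bar>" by linarith
    then show ?thesis unfolding \<open>ordinate v - ordinate w = _\<close> abs_divide using q
      by (simp add: abs_mult divide_right_mono)
  qed
  moreover have "1 / (2 * R * (2 * R)) \<le> 1 / (of_int q * of_int q')"
    using q R by (intro divide_left_mono mult_mono) auto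
  ultimately have "1 / (2 * R * (2 * R)) < c0 / R\<^sup>2" using \<open>\<bar>ordinate v - ordinate w\<bar> < c0 / R\<^sup>2\<close> by linarith
  then have "1 / 4 / R\<^sup>2 < c0 / R\<^sup>2" by (simp add: power2_eq_square)
  moreover have "0 < R\<^sup>2" using R by simp
  ultimately have "1 / 4 < c0" using divide_less_cancel[of "1/4" "R\<^sup>2" c0] by simp
  then show False using c0 by simp
qed

text \<open>Passing from ordinates to heights \<open>e\<close> subtracts one affine function from
  all three triples, which does not change their determinant. It is \<open>q * q' * q''\<close>
  times a 2 by 2 determinant \<open>E\<close> below 2 c0^2 / R^3, thus an integer of absolute value
  below \<open>16 * c0\<^sup>2 < 1\<close>.\<close>

lemma bin_coplanar:
  assumes v: "(a,b,q) \<in> D" "(a',b',q') \<in> D" "(a'',b'',q'') \<in> D"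
    and bin: "bin (a',b',q') = bin (a,b,q)" "bin (a'',b'',q'') = bin (a,b,q)"
  shows "(b * q' - b' * q) * a'' - (a * q' - a' * q) * b'' = (a' * b - a * b') * q''"
proof -
  define m where "m = (b * q' - b' * q) * a'' - (a * q' - a' * q) * b'' - (a' * b - a * b') * q''"
  define v1 v2 v3 where vs: "v1 = (a,b,q)" "v2 = (a',b',q')" "v3 = (a'',b'',q'')"
  have q: "1 \<le> real_of_int q" "real_of_int q \<le> 2 * R" "1 \<le> real_of_int q'" "real_of_int q' \<le> 2 * R"
     "1 \<le> real_of_int q''" "real_of_int q'' \<le> 2 * R"
    using v R by (auto simp: D_def den_def)
  have s2: "ref v2 = ref v1" "\<bar>abscissa v2 - abscissa v1\<bar> < c0 / R" "\<bar>e v2 - e v1\<bar> < c0 / R\<^sup>2"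
    using same_bin[OF bin(1)] by (auto simp: vs)
  have s3: "ref v3 = ref v1" "\<bar>abscissa v3 - abscissa v1\<bar> < c0 / R" "\<bar>e v3 - e v1\<bar> < c0 / R\<^sup>2"
    using same_bin[OF bin(2)] by (auto simp: vs)
  obtain x y p where s: "ref v1 = (x,y,p)" by (cases "ref v1")
  have aq: "real_of_int a = of_int q * abscissa v1" "real_of_int b = of_int q * ordinate v1"
    "real_of_int a' = of_int q' * abscissa v2" "real_of_int b' = of_int q' * ordinate v2"
    "real_of_int a'' = of_int q'' * abscissa v3" "real_of_int b'' = of_int q'' * ordinate v3"
    using q by (simp_all add: abscissa_def ordinate_def den_def vs)
  have oe: "ordinate v1 = e v1 + (y + p * (abscissa v1 - x))" "ordinate v2 = e v2 + (y + p * (abscissa v2 - x))"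
     "ordinate v3 = e v3 + (y + p * (abscissa v3 - x))"
    by (simp_all add: e_def s2 s3 s tang_def)
  define E where "E = (abscissa v2 - abscissa v1) * (e v3 - e v1) - (abscissa v3 - abscissa v1) * (e v2 - e v1)"
  have "real_of_int m = of_int q * of_int q' * of_int q'' * E"
    unfolding m_def E_def of_int_diff of_int_mult aq oe by algebra
  moreover have "\<bar>E\<bar> < c0 / R * (c0 / R\<^sup>2) + c0 / R * (c0 / R\<^sup>2)"
  proof -
    have "\<bar>E\<bar> \<le> \<bar>abscissa v2 - abscissa v1\<bar> * \<bar>e v3 - e v1\<bar> + \<bar>abscissa v3 - abscissa v1\<bar> * \<bar>e v2 - e v1\<bar>"
      unfolding E_def by (simp flip: abs_mult)
    also have "\<dots> < c0 / R * (c0 / R\<^sup>2) + c0 / R * (c0 / R\<^sup>2)"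
      using s2 s3 c0(1) R by (intro add_strict_mono mult_strict_mono) auto
    finally show ?thesis .
  qed
  moreover have "0 < real_of_int q * of_int q' * of_int q''" using q by simp
  moreover have "real_of_int q * of_int q' * of_int q'' \<le> (2 * R) * (2 * R) * (2 * R)"
    using q R by (intro mult_mono) auto
  moreover have "\<bar>real_of_int q * of_int q' * of_int q''\<bar> = of_int q * of_int q' * of_int q''"
    using q by simp
  ultimately have "\<bar>real_of_int m\<bar> < (2 * R) * (2 * R) * (2 * R) * (c0 / R * (c0 / R\<^sup>2) + c0 / R * (c0 / R\<^sup>2))"
    by (simp only: abs_mult[of _ E]) (intro mult_le_less_imp_less; simp)
  also have "\<dots> = 16 * c0\<^sup>2" using R by (simp add: field_simps power2_eq_square)
  finally have "\<bar>real_of_int m\<bar> < 1" using c0 by linarith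
  then have "m = 0" by linarith
  then show ?thesis by (simp add: m_def)
qed


text \<open>Two triples of the cell are at least h / (4 R^2) and less than \<open>c0 / R\<close>
  apart, which forces h < 4 c0 R. Their heights differ by less than c0 / R^2, so line and reference
  tangent have nearly the same slope, |\<nu> - p h| \<le> 4 c0. Together with the bound for
  \<open>e v\<close> this puts the line near the dual of the element \<open>ref v\<close>.\<close>

lemma bin_line:
  assumes v: "v \<in> D" "w \<in> D" "bin w = bin v" "w \<noteq> v"
  obtains \<nu> k h where "(\<nu>,k,h) \<in> Near (dual S)" "1 \<le> h" "of_int h \<le> R" "gcd \<nu> (gcd k h) = 1"
    "\<And>t. t \<in> D \<Longrightarrow> bin t = bin v \<Longrightarrow> on_line (\<nu>,k,h) t"
proof -
  obtain a b q where ve: "v = (a,b,q)" by (cases v)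
  obtain a' b' q' where we: "w = (a',b',q')" by (cases w)
  have q: "1 \<le> real_of_int q" "1 \<le> real_of_int q'" using v R by (auto simp: D_def ve we den_def)
  have zne: "abscissa v \<noteq> abscissa w" using bin_distinct_abscissa[OF v(1,2)] v(3,4) by auto
  have "a * q' - a' * q \<noteq> 0"
  proof
    assume "a * q' - a' * q = 0"
    then have "real_of_int a * of_int q' = of_int a' * of_int q" by (simp flip: of_int_mult)
    then show False using zne q by (simp add: abscissa_def den_def ve we field_simps)
  qed
  then obtain \<nu> k h where n: "gcd \<nu> (gcd k h) = 1" "1 \<le> h"
    and nl: "\<And>a'' b'' q''. (b * q' - b' * q) * a'' - (a * q' - a' * q) * b'' = (a' * b - a * b') * q'' \<Longrightarrow>
       on_line (\<nu>,k,h) (a'',b'',q'')"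
    using line_through[of a q' a' q b b'] by blast
  have line: "on_line (\<nu>,k,h) t" if "t \<in> D" "bin t = bin v" for t
  proof -
    obtain a'' b'' q'' where t: "t = (a'',b'',q'')" by (cases t)
    show ?thesis unfolding t by (rule nl, rule bin_coplanar) (use v that in \<open>auto simp: ve we t\<close>)
  qed
  have hr: "1 \<le> real_of_int h" using n by simp
  define z z' where z: "z = abscissa v" "z' = abscissa w"
  have sp: "of_int h / (2 * R)\<^sup>2 \<le> \<bar>z - z'\<bar>" unfolding z
    by (rule line_spacing[OF n line[OF v(1)] line[OF v(2)]]) (use v zne R in \<open>auto simp: D_def\<close>)
  have same: "ref w = ref v" "\<bar>z' - z\<bar> < c0 / R" "\<bar>e w - e v\<bar> < c0 / R\<^sup>2"
    using same_bin[OF v(3)] by (auto simp: z)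
  have "of_int h / (2 * R)\<^sup>2 < c0 / R" using sp same(2) by linarith
  then have h4: "of_int h < 4 * c0 * R" using R by (simp add: field_simps power2_eq_square)
  also have "\<dots> \<le> R" using c0(2) R by simp
  finally have hR: "of_int h \<le> R" by simp
  obtain x y p where s: "ref v = (x,y,p)" by (cases "ref v")
  have sS: "(x,y,p) \<in> S" using ref(1)[OF v(1)] by (simp add: s)
  have ev: "e v = (of_int \<nu> * z - of_int k) / of_int h - (y + p * (z - x))"
    using on_line_ordinate[OF line[OF v(1)] n(2) v(1)] by (simp add: e_def s tang_def z)
  have ew: "e w = (of_int \<nu> * z' - of_int k) / of_int h - (y + p * (z' - x))"
    using on_line_ordinate[OF line[OF v(2) v(3)] n(2) v(2)] by (simp add: e_def s tang_def z same(1))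
  define \<sigma> where "\<sigma> = of_int \<nu> - p * of_int h"
  have "of_int h * (e v - e w) = \<sigma> * (z - z')"
    unfolding ev ew \<sigma>_def using hr by (simp add: field_simps)
  then have "\<bar>\<sigma>\<bar> * \<bar>z - z'\<bar> = of_int h * \<bar>e v - e w\<bar>"
    using hr by (metis abs_mult abs_of_pos less_le_trans zero_less_one)
  also have "\<dots> \<le> of_int h * (c0 / R\<^sup>2)" using same(3) hr by (intro mult_left_mono) auto
  finally have "\<bar>\<sigma>\<bar> * (of_int h / (2 * R)\<^sup>2) \<le> of_int h * (c0 / R\<^sup>2)"
    using mult_left_mono[OF sp, of "\<bar>\<sigma>\<bar>"] by linarith
  then have \<sigma>: "\<bar>\<sigma>\<bar> \<le> 4 * c0" using hr R by (simp add: field_simps power2_eq_square)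
  \<comment> \<open>The form that \<open>near\<close> asks for in the dual, expressed through the
    slope defect \<open>\<sigma>\<close> and the height of \<open>v\<close> over the reference
    tangent.\<close>
  have t: "of_int k - (x * p - y) * of_int h - x * \<sigma> = \<sigma> * (z - x) - of_int h * e v"
    unfolding ev \<sigma>_def using hr by (simp add: field_simps)
  have "\<bar>\<sigma> * (z - x) - of_int h * e v\<bar> \<le> \<bar>\<sigma>\<bar> * \<bar>z - x\<bar> + of_int h * \<bar>e v\<bar>"
    using hr abs_triangle_ineq4[of "\<sigma> * (z - x)" "of_int h * e v"] by (simp add: abs_mult)
  also have "\<dots> \<le> 4 * c0 * (2 / R) + of_int h * ((1 + 12 * C) / R\<^sup>2)"
    using \<sigma> ref(2,4)[OF v(1)] hr c0 by (intro add_mono mult_mono) (auto simp: s z)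
  finally have t2: "\<bar>of_int k - (x * p - y) * of_int h - x * \<sigma>\<bar> \<le> 4 * c0 * (2 / R) + of_int h * ((1 + 12 * C) / R\<^sup>2)"
    unfolding t .
  have "of_int h * \<bar>of_int k - (x * p - y) * of_int h - x * \<sigma>\<bar> \<le> (4 * c0 * R) * (4 * c0 * (2 / R) + (4 * c0 * R) * ((1 + 12 * C) / R\<^sup>2))"
  proof (rule mult_mono)
    have "of_int h * ((1 + 12 * C) / R\<^sup>2) \<le> (4 * c0 * R) * ((1 + 12 * C) / R\<^sup>2)"
      using h4 c by (intro mult_right_mono) auto
    then show "\<bar>of_int k - (x * p - y) * of_int h - x * \<sigma>\<bar> \<le> 4 * c0 * (2 / R) + (4 * c0 * R) * ((1 + 12 * C) / R\<^sup>2)"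
      using t2 by linarith
  qed (use h4 hr c0 R in auto)
  also have "\<dots> = 16 * c0\<^sup>2 * (3 + 12 * C)" using R by (simp add: field_simps power2_eq_square)
  also have "\<dots> \<le> 1" by (rule c0(3))
  finally have t3: "of_int h * \<bar>of_int k - (x * p - y) * of_int h - x * \<sigma>\<bar> \<le> 1" .
  have "near (p, x * p - y, x) (\<nu>,k,h)"
    using \<sigma> c0 t3 by (auto simp: near_def \<sigma>_def)
  moreover have "(p, x * p - y, x) \<in> dual S" using sS by (force simp: dual_def)
  ultimately have "(\<nu>,k,h) \<in> Near (dual S)" using n by (auto simp: Near_def)
  from that[OF this n(2) hR n(1) line] show ?thesis .
qed

text \<open>Lines of height at most \<open>Y\<close> are counted as a whole, which produces the
  weight of the dual. Outside of them a cell with two or more triples lies on a line of height above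
  \<open>Y\<close>, and the spacing on that line leaves at most \<open>1 + R / Y\<close> triples in
  the cell.\<close>

lemma card_D_le:
  assumes Y: "0 < Y"
  shows "real (card D) \<le> B0 * R * (1 + R / Y) + (2 + 8 * (2 + (C + 2) / c)) * R * weight (dual S) Y"
proof -
  define K where "K = (2 + 8 * (2 + (C + 2) / c)) * R"
  have K: "0 \<le> K" using c R by (simp add: K_def)
  have wit: "\<exists>n\<in>Near (dual S). den n \<le> R \<and> gcd (fst n) (gcd (fst (snd n)) (snd (snd n))) = 1 \<and>
      (\<forall>t\<in>D. bin t = bin v \<longrightarrow> on_line n t)"
    if "v \<in> D" "w \<in> D" "bin w = bin v" "w \<noteq> v" for v w
    using bin_line[OF that] by (metis (no_types, lifting) den_def fst_conv snd_conv)
  define N where "N = {n \<in> Near (dual S). den n \<le> Y \<and> den n \<le> R}"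
  have cd: "contact (c / C\<^sup>2) (C / c\<^sup>2) (C * X) (dual S)" by (rule contact_dual[OF S c(1-3)])
  have C2: "1 \<le> C / c\<^sup>2"
  proof -
    have "c\<^sup>2 \<le> 1" using c by (simp add: power_le_one)
    then show ?thesis using c by (simp add: field_simps)
  qed
  have fN': "finite (Near_upto (dual S) Y)" by (rule Near_upto_finite[OF cd _ C2]) (use c in auto)
  have fN: "finite N" by (rule finite_subset[OF _ fN']) (auto simp: N_def Near_upto_def)
  define D2 where "D2 = (\<Union>n\<in>N. {v \<in> D. on_line n v})"
  define D1 where "D1 = D - D2"
  have prim: "gcd (fst n) (gcd (fst (snd n)) (snd (snd n))) = 1 \<and> 1 \<le> snd (snd n)" if "n \<in> Near (dual S)" for n
    using that by (auto simp: Near_def)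
  have "real (card D2) \<le> (\<Sum>n\<in>N. real (card {v \<in> D. on_line n v}))"
    unfolding D2_def using card_UN_le[OF fN, of "\<lambda>n. {v \<in> D. on_line n v}"] by (simp flip: of_nat_sum)
  also have "\<dots> \<le> (\<Sum>n\<in>N. K * (1 / den n))"
  proof (intro sum_mono)
    fix n assume n: "n \<in> N"
    obtain \<nu> k h where ne: "n = (\<nu>,k,h)" by (cases n)
    have "real (card {v \<in> D. on_line (\<nu>,k,h) v}) \<le> K / of_int h"
      unfolding K_def by (rule card_on_line) (use n prim[of n] in \<open>auto simp: N_def ne den_def\<close>)
    then show "real (card {v \<in> D. on_line n v}) \<le> K * (1 / den n)" by (simp add: ne den_def)
  qed
  also have "\<dots> = K * (\<Sum>n\<in>N. 1 / den n)" by (simp add: sum_distrib_left)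
  also have "\<dots> \<le> K * weight (dual S) Y"
    unfolding weight_def using K fN'
    by (intro mult_left_mono sum_mono2) (auto simp: N_def Near_upto_def den_def Near_def)
  finally have 2: "real (card D2) \<le> K * weight (dual S) Y" .
  have fib: "real (card {v \<in> D1. bin v = \<beta>}) \<le> 1 + R / Y" for \<beta>
  proof (cases "\<exists>v\<in>D1. \<exists>w\<in>D1. bin v = \<beta> \<and> bin w = \<beta> \<and> w \<noteq> v")
    case False
    have "card {v \<in> D1. bin v = \<beta>} \<le> 1"
    proof (cases "{v \<in> D1. bin v = \<beta>} = {}")
      case ne: False
      then obtain v where v: "v \<in> D1" "bin v = \<beta>" by auto
      then have "{v \<in> D1. bin v = \<beta>} \<subseteq> {v}" using False by auto
      then show ?thesis using card_mono[of "{v}"] by simp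
    qed (simp only: card.empty)
    moreover have "0 \<le> R / Y" using R Y by simp
    ultimately show ?thesis by linarith
  next
    case True
    then obtain v w where vw: "v \<in> D1" "w \<in> D1" "bin v = \<beta>" "bin w = \<beta>" "w \<noteq> v" by blast
    then obtain n where n: "n \<in> Near (dual S)" "den n \<le> R" "\<forall>t\<in>D. bin t = bin v \<longrightarrow> on_line n t"
      using wit[of v w] by (auto simp: D1_def)
    have "Y < den n"
    proof (rule ccontr)
      assume "\<not> Y < den n"
      then have "n \<in> N" using n by (auto simp: N_def)
      then have "v \<in> D2" using n vw by (auto simp: D2_def D1_def)
      then show False using vw by (auto simp: D1_def)
    qed
    obtain \<nu> k h where ne: "n = (\<nu>,k,h)" by (cases n)
    have pn: "gcd \<nu> (gcd k h) = 1" "1 \<le> h" using prim[OF n(1)] by (auto simp: ne)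
    have hr: "1 \<le> real_of_int h" "Y < real_of_int h" using pn \<open>Y < den n\<close> by (auto simp: ne den_def)
    have ol: "on_line (\<nu>,k,h) t" if "t \<in> D1" "bin t = \<beta>" for t
      using n(3) that vw(3) by (auto simp: D1_def ne)
    have sep: "of_int h / (2 * R)\<^sup>2 \<le> \<bar>abscissa t - abscissa t'\<bar>"
      if "t \<in> D1" "bin t = \<beta>" "t' \<in> D1" "bin t' = \<beta>" "t \<noteq> t'" for t t'
      by (rule line_spacing[OF pn ol[OF that(1,2)] ol[OF that(3,4)]])
        (use that R bin_distinct_abscissa[of t t'] in \<open>auto simp: D1_def D_def\<close>)
    have "real (card {v \<in> D1. bin v = \<beta>}) \<le> 1 + (c0 / R) / (of_int h / (2 * R)\<^sup>2)"
    proof (rule card_le_if_separated(2)[where z = abscissa and l = "of_int (fst \<beta>) * c0 / R"])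
      fix t assume "t \<in> {v \<in> D1. bin v = \<beta>}"
      then have "\<lfloor>abscissa t * R / c0\<rfloor> = fst \<beta>" by (auto simp: bin_def k1_def)
      then have "of_int (fst \<beta>) \<le> abscissa t * R / c0" "abscissa t * R / c0 \<le> of_int (fst \<beta>) + 1" by linarith+
      then show "of_int (fst \<beta>) * c0 / R \<le> abscissa t \<and> abscissa t \<le> of_int (fst \<beta>) * c0 / R + c0 / R"
        using R c0 by (auto simp: field_simps)
    qed (use hr R c0 sep in auto)
    also have "(c0 / R) / (of_int h / (2 * R)\<^sup>2) = 4 * c0 * R / of_int h"
      using R hr by (simp add: field_simps power2_eq_square)
    also have "\<dots> \<le> R / Y" using hr c0 R Y by (intro frac_le) auto
    finally show ?thesis by simp
  qed
  have "D1 = (\<Union>\<beta>\<in>bin ` D. {v \<in> D1. bin v = \<beta>})" by (auto simp: D1_def)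
  then have "card D1 \<le> (\<Sum>\<beta>\<in>bin ` D. card {v \<in> D1. bin v = \<beta>})"
    using card_UN_le[OF card_bins(1), of "\<lambda>\<beta>. {v \<in> D1. bin v = \<beta>}"] by simp
  then have "real (card D1) \<le> (\<Sum>\<beta>\<in>bin ` D. real (card {v \<in> D1. bin v = \<beta>}))" by (simp flip: of_nat_sum)
  also have "\<dots> \<le> (\<Sum>\<beta>\<in>bin ` D. 1 + R / Y)" by (intro sum_mono fib)
  also have "\<dots> = real (card (bin ` D)) * (1 + R / Y)" by simp
  also have "\<dots> \<le> B0 * R * (1 + R / Y)" using card_bins(2) R Y by (intro mult_right_mono) auto
  finally have 1: "real (card D1) \<le> B0 * R * (1 + R / Y)" .
  have "card D \<le> card D1 + card D2"
  proof -
    have "D = D1 \<union> D2" by (auto simp: D1_def D2_def)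
    then show ?thesis using card_Un_le[of D1 D2] by simp
  qed
  then show ?thesis using 1 2 by (simp add: K_def)
qed

end

subsection \<open>The self-improving bound\<close>

lemma power_two_bracket:
  fixes y :: real assumes "1 \<le> y" obtains n where "2 ^ n \<le> y" "y < 2 ^ Suc n"
proof -
  have ex: "\<exists>n. y < 2 ^ Suc n"
  proof -
    obtain n where "y < 2 ^ n" using real_arch_pow[of 2 y] by auto
    also have "(2::real) ^ n \<le> 2 ^ Suc n" by simp
    finally show ?thesis by blast
  qed
  define n where "n = (LEAST n. y < 2 ^ Suc n)"
  have 1: "y < 2 ^ Suc n" unfolding n_def by (rule LeastI_ex[OF ex])
  have "2 ^ n \<le> y"
  proof (cases n)
    case 0 then show ?thesis using assms by simp
  next
    case (Suc m)
    then have "\<not> y < 2 ^ Suc m" using not_less_Least[of m "\<lambda>n. y < 2 ^ Suc n"] by (simp add: n_def)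
    then show ?thesis by (simp add: Suc)
  qed
  then show ?thesis using 1 that by blast
qed

text \<open>The block of denominators between 2^i and 2^(i+1) contributes at most
  \<open>A * \<rho> ^ i\<close>, and the geometric sum is dominated by its last term.\<close>

lemma weight_dyadic:
  assumes S: "contact c C X S" and c: "0 < c" "c \<le> 1" "1 \<le> C" "0 \<le> X"
    and A: "0 \<le> A" and \<tau>: "0 < \<tau>" and Y: "1 \<le> Y"
    and D: "\<And>R. 1 \<le> R \<Longrightarrow> real (card (dyadic.D R S)) \<le> A * R * R powr \<tau>"
  shows "weight S Y \<le> A * (2 powr \<tau> / (2 powr \<tau> - 1)) * Y powr \<tau>"
proof -
  obtain n where n: "2 ^ n \<le> Y" "Y < 2 ^ Suc n" using power_two_bracket[OF Y] by blast
  define \<rho> :: real where "\<rho> = 2 powr \<tau>"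
  have \<rho>: "1 < \<rho>" using \<tau> by (simp add: \<rho>_def)
  have dy: "dyadic c C X R S" if "1 \<le> R" for R using S c that by unfold_locales
  define Di where "Di i = dyadic.D (2 ^ i) S" for i :: nat
  have fD: "finite (Di i)" for i unfolding Di_def by (rule dyadic.D_finite[OF dy]) simp
  have De: "Di i = {v \<in> Near S. 2 ^ i \<le> den v \<and> den v < 2 * 2 ^ i}" for i
    unfolding Di_def by (rule dyadic.D_def[OF dy]) simp
  have sub: "Near_upto S Y \<subseteq> (\<Union>i\<le>n. Di i)"
  proof
    fix v assume v: "v \<in> Near_upto S Y"
    then have vN: "v \<in> Near S" "den v \<le> Y" by (auto simp: Near_upto_def)
    obtain m where m: "2 ^ m \<le> den v" "den v < 2 ^ Suc m" using power_two_bracket[OF den_ge_1[OF vN(1)]] by blast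
    have "(2::real) ^ m < 2 ^ Suc n" using m(1) vN(2) n(2) by linarith
    then have "m < Suc n" by (metis one_less_numeral_iff power_less_imp_less_exp semiring_norm(76))
    then show "v \<in> (\<Union>i\<le>n. Di i)" using m vN by (auto simp: De)
  qed
  have "weight S Y \<le> (\<Sum>v\<in>(\<Union>i\<le>n. Di i). 1 / den v)"
    unfolding weight_def using sub fD by (intro sum_mono2) (auto simp: De den_def Near_def)
  also have "\<dots> \<le> (\<Sum>i\<le>n. \<Sum>v\<in>Di i. 1 / den v)"
  proof -
    have "(\<Sum>v\<in>(\<Union>i\<in>{..n}. Di i). 1 / den v) = (\<Sum>i\<in>{..n}. \<Sum>v\<in>Di i. 1 / den v)"
    proof (rule sum.UNION_disjoint)
      show "\<forall>i\<in>{..n}. \<forall>j\<in>{..n}. i \<noteq> j \<longrightarrow> Di i \<inter> Di j = {}"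
      proof (intro ballI impI, rule ccontr)
        fix i j :: nat assume "i \<noteq> j" "Di i \<inter> Di j \<noteq> {}"
        then obtain v where v: "2 ^ i \<le> den v" "den v < 2 ^ Suc i" "2 ^ j \<le> den v" "den v < 2 ^ Suc j" by (auto simp: De)
        have "(2::real) ^ i < 2 ^ Suc j" "(2::real) ^ j < 2 ^ Suc i" using v by linarith+
        then have "i < Suc j" "j < Suc i" by (metis one_less_numeral_iff power_less_imp_less_exp semiring_norm(76))+
        then show False using \<open>i \<noteq> j\<close> by simp
      qed
    qed (auto simp: fD)
    then show ?thesis by simp
  qed
  also have "\<dots> \<le> (\<Sum>i\<le>n. A * \<rho> ^ i)"
  proof (intro sum_mono)
    fix i
    have "(\<Sum>v\<in>Di i. 1 / den v) \<le> (\<Sum>v\<in>Di i. 1 / 2 ^ i)"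
      by (intro sum_mono divide_left_mono) (auto simp: De den_def Near_def)
    also have "\<dots> = real (card (Di i)) / 2 ^ i" by simp
    also have "\<dots> \<le> A * 2 ^ i * (2 ^ i) powr \<tau> / 2 ^ i"
      unfolding Di_def using D[of "2 ^ i"] by (intro divide_right_mono) auto
    also have "\<dots> = A * \<rho> ^ i"
      by (simp add: \<rho>_def powr_power powr_realpow[symmetric] powr_powr mult.commute)
    finally show "(\<Sum>v\<in>Di i. 1 / den v) \<le> A * \<rho> ^ i" .
  qed
  also have "\<dots> = A * (\<Sum>i\<le>n. \<rho> ^ i)" by (simp add: sum_distrib_left)
  also have "\<dots> = A * ((\<rho> ^ Suc n - 1) / (\<rho> - 1))"
    using \<rho> geometric_sum[of \<rho> "Suc n"] by (simp add: lessThan_Suc_atMost)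
  also have "\<dots> \<le> A * ((\<rho> * Y powr \<tau>) / (\<rho> - 1))"
  proof -
    have "\<rho> ^ n = (2 ^ n) powr \<tau>" 
      by (simp add: \<rho>_def powr_power powr_realpow[symmetric] powr_powr mult.commute)
    also have "\<dots> \<le> Y powr \<tau>" using n \<tau> by (intro powr_mono2) auto
    finally have "\<rho> * \<rho> ^ n \<le> \<rho> * Y powr \<tau>" using \<rho> by simp
    then have "\<rho> ^ Suc n - 1 \<le> \<rho> * Y powr \<tau>" unfolding power_Suc by linarith
    then show ?thesis using A \<rho> by (intro mult_left_mono divide_right_mono) auto
  qed
  also have "\<dots> = A * (\<rho> / (\<rho> - 1)) * Y powr \<tau>" by simp
  finally show ?thesis by (simp add: \<rho>_def)
qed

text \<open>The constant is uniform in \<open>S\<close>, and the induction generalises over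
  \<open>c\<close>, \<open>C\<close>, \<open>X\<close>, because the step applies the previous bound
  to \<open>dual S\<close>, which has other constants.\<close>

lemma weight_bound:
  assumes "0 < c" "c \<le> 1" "1 \<le> C" "0 \<le> X"
  shows "\<exists>A\<ge>0. \<forall>S Y. contact c C X S \<longrightarrow> 1 \<le> Y \<longrightarrow> weight S Y \<le> A * Y powr (1 / real (Suc k))"
  using assms
proof (induction k arbitrary: c C X)
  case 0
  show ?case
  proof (intro exI[of _ "(3 + 2 * X) * (12 * C + 5)"] conjI allI impI)
    fix S Y assume "contact c C X S" "1 \<le> (Y::real)"
    then show "weight S Y \<le> (3 + 2 * X) * (12 * C + 5) * Y powr (1 / real (Suc 0))"
      using weight_trivial[of c C X S Y] 0 by simp
  qed (use 0 in auto)
next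
  case (Suc k)
  note c = Suc.prems
  have c2: "c\<^sup>2 \<le> 1" "1 \<le> C\<^sup>2" using c by (auto simp: power_le_one)
  have c3: "c \<le> C\<^sup>2" "c\<^sup>2 \<le> C" using c c2 by linarith+
  have dc: "0 < c / C\<^sup>2" "c / C\<^sup>2 \<le> 1" "1 \<le> C / c\<^sup>2" "0 \<le> C * X"
    using c c2 c3 by (auto simp: divide_le_eq le_divide_eq)
  obtain A where A: "0 \<le> A" "\<And>S Y. contact (c / C\<^sup>2) (C / c\<^sup>2) (C * X) S \<Longrightarrow> 1 \<le> Y \<Longrightarrow> weight S Y \<le> A * Y powr (1 / real (Suc k))"
    using Suc.IH[OF dc] by blast
  define \<tau> where "\<tau> = 1 / real (Suc (Suc k))"
  have \<tau>: "0 < \<tau>" "\<tau> < 1" "(1 - \<tau>) * (1 / real (Suc k)) = \<tau>"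
    by (auto simp: \<tau>_def field_simps)
  define K where "K = 2 + 8 * (2 + (C + 2) / c)"
  have K: "0 \<le> K" using c by (simp add: K_def)
  define B where "B = (2 * X + 6) / (1 / (16 * C)) * (2 * (1 + 12 * C) / (1 / (16 * C)) + 2)"
  have B: "0 \<le> B" using c by (simp add: B_def)
  have main: "weight S Y \<le> (2 * B + K * A) * (2 powr \<tau> / (2 powr \<tau> - 1)) * Y powr \<tau>"
    if S: "contact c C X S" and Y: "1 \<le> Y" for S Y
  proof (rule weight_dyadic[OF S c _ \<tau>(1) Y])
    show "0 \<le> 2 * B + K * A" using A B K by simp
    fix R :: real assume R: "1 \<le> R"
    interpret dyadic c C X R S using S c R by unfold_locales
    \<comment> \<open>The threshold \<open>Y = R powr (1 - \<tau>)\<close> balances both terms: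
      \<open>R / Y\<close> is \<open>R powr \<tau>\<close>, and \<open>Y powr (1 / (k + 1))\<close>
      is \<open>R powr \<tau>\<close> exactly for \<open>\<tau> = 1 / (k + 2)\<close>.\<close>
    have "real (card D) \<le> B0 * R * (1 + R / R powr (1 - \<tau>)) + K * R * weight (dual S) (R powr (1 - \<tau>))"
      unfolding K_def using R by (intro card_D_le) simp
    also have "B0 = B" by (simp add: B0_def B_def c0_def)
    also have "R / R powr (1 - \<tau>) = R powr \<tau>" using R by (simp add: powr_diff)
    also have "B * R * (1 + R powr \<tau>) + K * R * weight (dual S) (R powr (1 - \<tau>)) \<le> B * R * (R powr \<tau> + R powr \<tau>) + K * R * (A * R powr \<tau>)"
    proof (intro add_mono mult_left_mono)
      show "1 \<le> R powr \<tau>" using R \<tau> by (simp add: ge_one_powr_ge_zero)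
      have "weight (dual S) (R powr (1 - \<tau>)) \<le> A * (R powr (1 - \<tau>)) powr (1 / real (Suc k))"
        using R \<tau> by (intro A(2) contact_dual[OF S c(1-3)]) (simp add: ge_one_powr_ge_zero)
      then show "weight (dual S) (R powr (1 - \<tau>)) \<le> A * R powr \<tau>" by (simp only: powr_powr \<tau>(3))
    qed (use B K R in auto)
    also have "\<dots> = (2 * B + K * A) * R * R powr \<tau>" by (simp add: algebra_simps)
    finally show "real (card D) \<le> (2 * B + K * A) * R * R powr \<tau>" .
  qed
  have "0 \<le> (2 * B + K * A) * (2 powr \<tau> / (2 powr \<tau> - 1))"
    using A B K \<tau> by (intro mult_nonneg_nonneg divide_nonneg_nonneg) (auto simp: ge_one_powr_ge_zero)
  then show ?case using main unfolding \<tau>_def by blast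
qed

subsection \<open>Reduced bases of three-dimensional lattices\<close>

definition lat :: "real^3 \<Rightarrow> real^3 \<Rightarrow> real^3 \<Rightarrow> (real^3) set" where
  "lat u v w = {of_int i *\<^sub>R u + of_int j *\<^sub>R v + of_int k *\<^sub>R w | i j k. True}"

definition triple :: "real^3 \<Rightarrow> real^3 \<Rightarrow> real^3 \<Rightarrow> real" where
  "triple u v w = u \<bullet> cross3 v w"

text \<open>Cramer's rule: pairing with the cross product of two basis vectors isolates the
  coordinate along the third.\<close>

lemma triple_coords:
  fixes u v w :: "real^3"
  defines "z i j k \<equiv> i *\<^sub>R u + j *\<^sub>R v + k *\<^sub>R w"
  shows "z i j k \<bullet> cross3 v w = i * triple u v w" "z i j k \<bullet> cross3 w u = j * triple u v w"
    "z i j k \<bullet> cross3 u v = k * triple u v w"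
  unfolding z_def triple_def by (simp_all add: cross3_simps)

lemma triple_shear: "triple u (e + m *\<^sub>R u) (g + a *\<^sub>R u + b *\<^sub>R e) = g \<bullet> cross3 u e"
  unfolding triple_def by (simp add: cross3_simps)

lemma norm_cross3_le: "norm (cross3 u v) \<le> norm u * norm v"
proof -
  have "(norm (cross3 u v))\<^sup>2 \<le> (norm u * norm v)\<^sup>2"
    using norm_cross_dot[of u v] by (metis le_add_same_cancel1 zero_le_power2)
  then show ?thesis by (rule power2_le_imp_le) simp
qed

lemma triple_le: "\<bar>triple u v w\<bar> \<le> norm u * norm v * norm w"
proof -
  have "\<bar>triple u v w\<bar> \<le> norm u * norm (cross3 v w)" unfolding triple_def by (rule Cauchy_Schwarz_ineq2)
  also have "\<dots> \<le> norm u * (norm v * norm w)" by (intro mult_left_mono norm_cross3_le) simp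
  finally show ?thesis by (simp add: mult.assoc)
qed

text \<open>The covolume is recorded together with the basis. Swaps and shears preserve it, so its
  independence of the basis never has to be proved.\<close>

definition lat_basis :: "(real^3) set \<Rightarrow> real \<Rightarrow> real^3 \<Rightarrow> real^3 \<Rightarrow> real^3 \<Rightarrow> bool" where
  "lat_basis \<Lambda> \<Delta> u v w \<longleftrightarrow> lat u v w = \<Lambda> \<and> \<bar>triple u v w\<bar> = \<Delta>"

lemma lat_swap12: "lat u v w \<subseteq> lat v u w"
proof
  fix z assume "z \<in> lat u v w"
  then obtain i j k where "z = of_int i *\<^sub>R u + of_int j *\<^sub>R v + of_int k *\<^sub>R w" by (auto simp: lat_def)
  then have "z = of_int j *\<^sub>R v + of_int i *\<^sub>R u + of_int k *\<^sub>R w" by simp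
  then show "z \<in> lat v u w" unfolding lat_def by blast
qed

lemma lat_swap23: "lat u v w \<subseteq> lat u w v"
proof
  fix z assume "z \<in> lat u v w"
  then obtain i j k where "z = of_int i *\<^sub>R u + of_int j *\<^sub>R v + of_int k *\<^sub>R w" by (auto simp: lat_def)
  then have "z = of_int i *\<^sub>R u + of_int k *\<^sub>R w + of_int j *\<^sub>R v" by simp
  then show "z \<in> lat u w v" unfolding lat_def by blast
qed

lemma lat_basis_swap12: "lat_basis \<Lambda> \<Delta> u v w \<Longrightarrow> lat_basis \<Lambda> \<Delta> v u w"
proof -
  have "triple v u w = - triple u v w" unfolding triple_def by (simp add: cross3_simps)
  then show "lat_basis \<Lambda> \<Delta> u v w \<Longrightarrow> lat_basis \<Lambda> \<Delta> v u w"
    using lat_swap12[of u v w] lat_swap12[of v u w] by (simp add: lat_basis_def)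
qed

lemma lat_basis_swap23: "lat_basis \<Lambda> \<Delta> u v w \<Longrightarrow> lat_basis \<Lambda> \<Delta> u w v"
proof -
  have "triple u w v = - triple u v w" unfolding triple_def by (simp add: cross3_simps)
  then show "lat_basis \<Lambda> \<Delta> u v w \<Longrightarrow> lat_basis \<Lambda> \<Delta> u w v"
    using lat_swap23[of u v w] lat_swap23[of u w v] by (simp add: lat_basis_def)
qed

lemma lat_basis_shear:
  assumes "lat_basis \<Lambda> \<Delta> u v w"
  shows "lat_basis \<Lambda> \<Delta> u v (w - of_int m *\<^sub>R u - of_int n *\<^sub>R v)"
proof -
  let ?w = "w - of_int m *\<^sub>R u - of_int n *\<^sub>R v"
  have "lat u v ?w = lat u v w"
  proof (intro equalityI subsetI)
    fix z assume "z \<in> lat u v ?w"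
    then obtain i j k where "z = of_int i *\<^sub>R u + of_int j *\<^sub>R v + of_int k *\<^sub>R ?w" by (auto simp: lat_def)
    then have "z = of_int (i - k * m) *\<^sub>R u + of_int (j - k * n) *\<^sub>R v + of_int k *\<^sub>R w"
      by (simp add: algebra_simps)
    then show "z \<in> lat u v w" unfolding lat_def by blast
  next
    fix z assume "z \<in> lat u v w"
    then obtain i j k where "z = of_int i *\<^sub>R u + of_int j *\<^sub>R v + of_int k *\<^sub>R w" by (auto simp: lat_def)
    then have "z = of_int (i + k * m) *\<^sub>R u + of_int (j + k * n) *\<^sub>R v + of_int k *\<^sub>R ?w"
      by (simp add: algebra_simps)
    then show "z \<in> lat u v ?w" unfolding lat_def by blast
  qed
  moreover have "triple u v ?w = triple u v w"
    unfolding triple_def by (simp add: cross3_simps)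
  ultimately show ?thesis using assms by (simp add: lat_basis_def)
qed

lemma lat_basis_mem:
  assumes "lat_basis \<Lambda> \<Delta> u v w" shows "u \<in> \<Lambda>" "v \<in> \<Lambda>" "w \<in> \<Lambda>"
proof -
  have "u = of_int 1 *\<^sub>R u + of_int 0 *\<^sub>R v + of_int 0 *\<^sub>R w"
    "v = of_int 0 *\<^sub>R u + of_int 1 *\<^sub>R v + of_int 0 *\<^sub>R w"
    "w = of_int 0 *\<^sub>R u + of_int 0 *\<^sub>R v + of_int 1 *\<^sub>R w" by simp_all
  then have "u \<in> lat u v w" "v \<in> lat u v w" "w \<in> lat u v w" unfolding lat_def by blast+
  then show "u \<in> \<Lambda>" "v \<in> \<Lambda>" "w \<in> \<Lambda>" using assms by (auto simp: lat_basis_def)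
qed

lemma int_range_card:
  fixes m :: real assumes "0 \<le> m"
  shows "finite {i::int. \<bar>of_int i\<bar> \<le> m}" "real (card {i::int. \<bar>of_int i\<bar> \<le> m}) \<le> 2 * m + 1"
proof -
  have e: "{i::int. \<bar>of_int i\<bar> \<le> m} = {- \<lfloor>m\<rfloor>..\<lfloor>m\<rfloor>}"
    by (auto simp: abs_le_iff le_floor_iff) linarith+
  show "finite {i::int. \<bar>of_int i\<bar> \<le> m}" unfolding e by simp
  have "card {i::int. \<bar>of_int i\<bar> \<le> m} = nat (2 * \<lfloor>m\<rfloor> + 1)" unfolding e using assms by simp
  moreover have "0 \<le> \<lfloor>m\<rfloor>" using assms by simp
  ultimately have "real (card {i::int. \<bar>of_int i\<bar> \<le> m}) = 2 * of_int \<lfloor>m\<rfloor> + 1" by (simp add: of_nat_nat)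
  then show "real (card {i::int. \<bar>of_int i\<bar> \<le> m}) \<le> 2 * m + 1" by linarith
qed

text \<open>Cramer's rule and Cauchy-Schwarz bound each integer coordinate separately.\<close>

lemma lat_ball_card:
  assumes B: "lat_basis \<Lambda> \<Delta> u v w" and \<Delta>: "0 < \<Delta>" and \<rho>: "0 \<le> \<rho>"
  shows "finite {z \<in> \<Lambda>. norm z \<le> \<rho>}"
    "real (card {z \<in> \<Lambda>. norm z \<le> \<rho>}) \<le>
      (2 * (\<rho> * (norm v * norm w) / \<Delta>) + 1) * (2 * (\<rho> * (norm w * norm u) / \<Delta>) + 1) * (2 * (\<rho> * (norm u * norm v) / \<Delta>) + 1)"
proof -
  define m1 m2 m3 where m: "m1 = \<rho> * (norm v * norm w) / \<Delta>" "m2 = \<rho> * (norm w * norm u) / \<Delta>" "m3 = \<rho> * (norm u * norm v) / \<Delta>"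
  have mp: "0 \<le> m1" "0 \<le> m2" "0 \<le> m3" unfolding m using \<Delta> \<rho> by simp_all
  define I where "I m = {i::int. \<bar>of_int i\<bar> \<le> m}" for m :: real
  have \<Lambda>: "\<Lambda> = lat u v w" and T: "\<bar>triple u v w\<bar> = \<Delta>" using B by (auto simp: lat_basis_def)
  have bnd: "\<bar>t\<bar> \<le> \<rho> * (norm a * norm b) / \<Delta>" if "z \<bullet> cross3 a b = t * triple u v w" "norm z \<le> \<rho>" for t z a b
  proof -
    have "\<bar>t\<bar> * \<Delta> = \<bar>z \<bullet> cross3 a b\<bar>" using that(1) T by (simp add: abs_mult)
    also have "\<dots> \<le> norm z * norm (cross3 a b)" by (rule Cauchy_Schwarz_ineq2)
    also have "\<dots> \<le> \<rho> * (norm a * norm b)" using that(2) \<rho> by (intro mult_mono norm_cross3_le) auto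
    finally show ?thesis using \<Delta> by (simp add: field_simps)
  qed
  have sub: "{z \<in> \<Lambda>. norm z \<le> \<rho>} \<subseteq> (\<lambda>(i,j,k). of_int i *\<^sub>R u + of_int j *\<^sub>R v + of_int k *\<^sub>R w) ` (I m1 \<times> I m2 \<times> I m3)"
  proof
    fix z assume z: "z \<in> {z \<in> \<Lambda>. norm z \<le> \<rho>}"
    then obtain i j k where ze: "z = of_int i *\<^sub>R u + of_int j *\<^sub>R v + of_int k *\<^sub>R w" by (auto simp: \<Lambda> lat_def)
    have nz: "norm z \<le> \<rho>" using z by simp
    have "(i,j,k) \<in> I m1 \<times> I m2 \<times> I m3" unfolding I_def m 
      using bnd[OF triple_coords(1)[of "of_int i" u "of_int j" v "of_int k" w, folded ze] nz]
        bnd[OF triple_coords(2)[of "of_int i" u "of_int j" v "of_int k" w, folded ze] nz]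
        bnd[OF triple_coords(3)[of "of_int i" u "of_int j" v "of_int k" w, folded ze] nz] by simp
    then show "z \<in> (\<lambda>(i,j,k). of_int i *\<^sub>R u + of_int j *\<^sub>R v + of_int k *\<^sub>R w) ` (I m1 \<times> I m2 \<times> I m3)"
      unfolding ze by force
  qed
  have fI: "finite (I m1)" "finite (I m2)" "finite (I m3)" unfolding I_def using int_range_card(1) mp by auto
  show "finite {z \<in> \<Lambda>. norm z \<le> \<rho>}" by (rule finite_subset[OF sub]) (use fI in simp)
  have "card {z \<in> \<Lambda>. norm z \<le> \<rho>} \<le> card (I m1 \<times> I m2 \<times> I m3)"
    by (rule surj_card_le[OF _ sub]) (use fI in simp)
  also have "\<dots> = card (I m1) * (card (I m2) * card (I m3))" by (simp add: card_cartesian_product)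
  finally have "real (card {z \<in> \<Lambda>. norm z \<le> \<rho>}) \<le> real (card (I m1)) * (real (card (I m2)) * real (card (I m3)))"
    by (simp flip: of_nat_mult)
  also have "\<dots> \<le> (2 * m1 + 1) * ((2 * m2 + 1) * (2 * m3 + 1))"
    using int_range_card(2) mp unfolding I_def by (intro mult_mono) auto
  finally show "real (card {z \<in> \<Lambda>. norm z \<le> \<rho>}) \<le>
      (2 * (\<rho> * (norm v * norm w) / \<Delta>) + 1) * (2 * (\<rho> * (norm w * norm u) / \<Delta>) + 1) * (2 * (\<rho> * (norm u * norm v) / \<Delta>) + 1)"
    by (simp add: m mult.assoc)
qed

definition sqsum :: "real^3 \<Rightarrow> real^3 \<Rightarrow> real^3 \<Rightarrow> real" where
  "sqsum u v w = u \<bullet> u + v \<bullet> v + w \<bullet> w"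

text \<open>Only finitely many bases compete, because the vectors of a basis with smaller
  \<open>sqsum\<close> are lattice points of a ball.\<close>

lemma minimal_basis_exists:
  assumes B: "lat_basis \<Lambda> \<Delta> u v w" and \<Delta>: "0 < \<Delta>"
  obtains u' v' w' where "lat_basis \<Lambda> \<Delta> u' v' w'"
    "\<And>a b c. lat_basis \<Lambda> \<Delta> a b c \<Longrightarrow> sqsum u' v' w' \<le> sqsum a b c"
proof -
  define s where "s = sqsum u v w"
  have s: "0 \<le> s" by (simp add: s_def sqsum_def)
  define F where "F = (\<lambda>(a,b,c). sqsum a b c)"
  define M where "M = {(a,b,c). lat_basis \<Lambda> \<Delta> a b c \<and> sqsum a b c \<le> s}"
  define N where "N = {z \<in> \<Lambda>. norm z \<le> sqrt s}"
  have fN: "finite N" unfolding N_def using lat_ball_card(1)[OF B \<Delta>] s by simp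
  have "M \<subseteq> N \<times> N \<times> N"
  proof
    fix t assume "t \<in> M"
    then obtain a b c where t: "t = (a,b,c)" "(a,b,c) \<in> M" by (cases t) auto
    then have m: "lat_basis \<Lambda> \<Delta> a b c" "a \<bullet> a + b \<bullet> b + c \<bullet> c \<le> s" by (auto simp: M_def sqsum_def)
    have "0 \<le> a \<bullet> a" "0 \<le> b \<bullet> b" "0 \<le> c \<bullet> c" by simp_all
    then have "a \<bullet> a \<le> s" "b \<bullet> b \<le> s" "c \<bullet> c \<le> s" using m(2) by linarith+
    then show "t \<in> N \<times> N \<times> N" unfolding t
      using lat_basis_mem[OF m(1)] by (auto simp: N_def norm_eq_sqrt_inner)
  qed
  then have fM: "finite M" using fN finite_subset by blast
  have "(u,v,w) \<in> M" using B by (simp add: M_def s_def)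
  then have ne: "M \<noteq> {}" by auto
  obtain a b c where abc: "arg_min_on F M = (a,b,c)" by (cases "arg_min_on F M")
  have 1: "(a,b,c) \<in> M" "\<not> (\<exists>x\<in>M. F x < F (a,b,c))"
    using arg_min_if_finite[OF fM ne, of F] by (simp_all add: abc)
  have "sqsum a b c \<le> sqsum a' b' c'" if "lat_basis \<Lambda> \<Delta> a' b' c'" for a' b' c'
  proof (rule ccontr)
    assume "\<not> sqsum a b c \<le> sqsum a' b' c'"
    then have lt: "sqsum a' b' c' < sqsum a b c" by simp
    moreover have "sqsum a b c \<le> s" using 1(1) by (simp add: M_def)
    ultimately have "(a',b',c') \<in> M" using that by (simp add: M_def)
    then show False using 1(2) lt by (auto simp: F_def)
  qed
  then show ?thesis using that 1(1) by (auto simp: M_def)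
qed

lemma round_near: "\<exists>m::int. \<bar>x - of_int m\<bar> \<le> (1/2::real)"
  using of_int_round_abs_le[of x] by (metis abs_minus_commute)

text \<open>A basis with minimal sum of squares cannot be shortened by subtracting integer multiples
  of its other vectors. Hence the Gram-Schmidt vectors \<open>e\<close> and \<open>g\<close> keep at
  least 3/4 and 1/2 of the squared lengths of \<open>v2\<close> and \<open>v3\<close>. So \<Delta>^2
  is at least 3/8 of the squared product of the norms, and 8/3 \<le> 4 gives the factor 2.\<close>

lemma reduced_basis_exists:
  assumes B: "lat_basis \<Lambda> \<Delta> u v w" and \<Delta>: "0 < \<Delta>"
  obtains v1 v2 v3 where "lat_basis \<Lambda> \<Delta> v1 v2 v3" "norm v1 \<le> norm v2" "norm v2 \<le> norm v3"
    "norm v1 * norm v2 * norm v3 \<le> 2 * \<Delta>"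
proof -
  define P where "P a b c \<longleftrightarrow> lat_basis \<Lambda> \<Delta> a b c \<and>
    (\<forall>a' b' c'. lat_basis \<Lambda> \<Delta> a' b' c' \<longrightarrow> sqsum a b c \<le> sqsum a' b' c')" for a b c
  obtain a b c where "P a b c" using minimal_basis_exists[OF B \<Delta>] unfolding P_def by metis
  have ss: "sqsum y x z = sqsum x y z" "sqsum x z y = sqsum x y z" for x y z
    by (simp_all add: sqsum_def)
  have s12: "P y x z" if "P x y z" for x y z
    using that lat_basis_swap12[of \<Lambda> \<Delta> x y z] ss(1)[of x y z] unfolding P_def by metis
  have s23: "P x z y" if "P x y z" for x y z
    using that lat_basis_swap23[of \<Lambda> \<Delta> x y z] ss(2)[of x y z] unfolding P_def by metis
  have perms: "P a b c" "P b a c" "P a c b" "P c a b" "P b c a" "P c b a"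
    using \<open>P a b c\<close> s12 s23 by blast+
  have "\<exists>a b c. P a b c \<and> norm a \<le> norm b \<and> norm b \<le> norm c"
    using perms linear[of "norm a" "norm b"] linear[of "norm b" "norm c"] linear[of "norm a" "norm c"] by blast
  then obtain v1 v2 v3 where P: "P v1 v2 v3" and n: "norm v1 \<le> norm v2" "norm v2 \<le> norm v3" by blast
  have bas: "lat_basis \<Lambda> \<Delta> v1 v2 v3" using P by (simp add: P_def)
  have m3: "v3 \<bullet> v3 \<le> (v3 - of_int m *\<^sub>R v1 - of_int k *\<^sub>R v2) \<bullet> (v3 - of_int m *\<^sub>R v1 - of_int k *\<^sub>R v2)" for m k
    
  proof -
    have "sqsum v1 v2 v3 \<le> sqsum v1 v2 (v3 - of_int m *\<^sub>R v1 - of_int k *\<^sub>R v2)"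
      using P lat_basis_shear[OF bas, of m k] unfolding P_def by blast
    then show ?thesis unfolding sqsum_def by linarith
  qed
  have m2: "v2 \<bullet> v2 \<le> (v2 - of_int m *\<^sub>R v1) \<bullet> (v2 - of_int m *\<^sub>R v1)" for m

  proof -
    have "sqsum v1 v2 v3 \<le> sqsum v1 (v2 - of_int m *\<^sub>R v1 - of_int 0 *\<^sub>R v3) v3"
      using P lat_basis_swap23[OF lat_basis_shear[OF lat_basis_swap23[OF bas], of m 0]] unfolding P_def by blast
    then have "sqsum v1 v2 v3 \<le> sqsum v1 (v2 - of_int m *\<^sub>R v1) v3" by simp
    then show ?thesis unfolding sqsum_def by linarith
  qed
  have T: "\<bar>triple v1 v2 v3\<bar> = \<Delta>" using bas by (simp add: lat_basis_def)
  define A b d where "A = v1 \<bullet> v1" and "b = v2 \<bullet> v2" and "d = v1 \<bullet> v2"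
  have "v1 \<noteq> 0" using T \<Delta> by (auto simp: triple_def)
  then have A: "0 < A" by (simp add: A_def)
  have Ab: "A \<le> b" using n(1) by (simp add: A_def b_def norm_le)
  have bc: "b \<le> v3 \<bullet> v3" using n(2) by (simp add: b_def norm_le)
  have "\<bar>d\<bar> \<le> A / 2" using m2[of 1] m2[of "-1"]
    by (simp add: inner_diff_left inner_diff_right inner_add_left inner_add_right A_def b_def d_def inner_commute[of v2 v1]) 
  define e where "e = v2 - (d / A) *\<^sub>R v1"
  have e1: "e \<bullet> v1 = 0" using A by (simp add: e_def inner_diff_left d_def A_def inner_commute[of v2 v1])
  have "e \<bullet> e = e \<bullet> (v2 - (d / A) *\<^sub>R v1)" by (simp only: e_def)
  also have "\<dots> = e \<bullet> v2" using e1 by (simp add: inner_diff_right)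
  also have "\<dots> = b - d\<^sup>2 / A" by (simp add: e_def inner_diff_left b_def d_def power2_eq_square)
  finally have ee: "e \<bullet> e = b - d\<^sup>2 / A" .
  have "d\<^sup>2 \<le> (A / 2)\<^sup>2" using \<open>\<bar>d\<bar> \<le> A / 2\<close> by (metis abs_ge_zero power2_abs power_mono)
  then have "d\<^sup>2 / A \<le> A / 4" using A by (simp add: divide_le_eq power2_eq_square)
  then have e34: "3 / 4 * b \<le> e \<bullet> e" "e \<bullet> e \<le> b" using ee Ab A by auto
  have b: "0 < b" using A Ab by simp
  define \<beta> where "\<beta> = v3 \<bullet> e / (e \<bullet> e)"
  define \<alpha> where "\<alpha> = v3 \<bullet> v1 / A"
  define g where "g = v3 - \<alpha> *\<^sub>R v1 - \<beta> *\<^sub>R e"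
  have ep: "0 < e \<bullet> e" using e34 b by linarith
  have g1: "g \<bullet> v1 = 0" using A e1 by (simp add: g_def inner_diff_left \<alpha>_def A_def)
  have ge: "g \<bullet> e = 0" using ep e1 by (simp add: g_def inner_diff_left \<beta>_def inner_commute[of v1 e])
  \<comment> \<open>The coefficient of \<open>e\<close> is rounded before that of \<open>v1\<close>:
    subtracting \<open>k\<close> copies of \<open>v2\<close> shifts the coefficient of
    \<open>v1\<close> by \<open>k * (d / A)\<close>, and \<open>m\<close> rounds what is
    left.\<close>
  obtain k where k: "\<bar>\<beta> - of_int k\<bar> \<le> 1/2" using round_near by blast
  obtain m where m: "\<bar>\<alpha> - of_int k * (d / A) - of_int m\<bar> \<le> 1/2" using round_near by blast
  define x y where "x = \<alpha> - of_int k * (d / A) - of_int m" and "y = \<beta> - of_int k"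
  have "v3 - of_int m *\<^sub>R v1 - of_int k *\<^sub>R v2 = g + x *\<^sub>R v1 + y *\<^sub>R e"
    by (simp add: g_def x_def y_def e_def algebra_simps)
  then have "v3 \<bullet> v3 \<le> (g + x *\<^sub>R v1 + y *\<^sub>R e) \<bullet> (g + x *\<^sub>R v1 + y *\<^sub>R e)" using m3[of m k] by simp
  also have "\<dots> = g \<bullet> g + x\<^sup>2 * A + y\<^sup>2 * (e \<bullet> e)"
    using g1 ge e1 by (simp add: inner_add_left inner_add_right A_def power2_eq_square inner_commute)
  also have "\<dots> \<le> g \<bullet> g + (1/2)\<^sup>2 * A + (1/2)\<^sup>2 * b"
  proof -
    have "x\<^sup>2 \<le> (1/2)\<^sup>2" "y\<^sup>2 \<le> (1/2)\<^sup>2"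
      using m k unfolding x_def y_def by (metis abs_ge_zero power2_abs power_mono)+
    then show ?thesis using A e34 ep by (intro add_mono mult_mono) auto
  qed
  finally have g12: "(v3 \<bullet> v3) / 2 \<le> g \<bullet> g" using Ab bc by (simp add: power2_eq_square)
  have "v2 = e + (d / A) *\<^sub>R v1" "v3 = g + \<alpha> *\<^sub>R v1 + \<beta> *\<^sub>R e" by (simp_all add: e_def g_def)
  then have "triple v1 v2 v3 = g \<bullet> cross3 v1 e" using triple_shear by metis
  moreover have "(norm (cross3 v1 e))\<^sup>2 = A * (e \<bullet> e)"
    using norm_cross_dot[of v1 e] e1 by (simp add: inner_commute power_mult_distrib A_def power2_norm_eq_inner)
  \<comment> \<open>\<open>g\<close> is orthogonal to \<open>v1\<close> and \<open>e\<close>, hence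
    parallel to their cross product, which turns Cauchy-Schwarz into an equality.\<close>
  moreover have "cross3 g (cross3 v1 e) = 0"
    using g1 ge Lagrange[of g v1 e] by (simp add: inner_commute)
  then have "(g \<bullet> cross3 v1 e)\<^sup>2 = (norm g * norm (cross3 v1 e))\<^sup>2"
    using norm_cross_dot[of g "cross3 v1 e"] by simp
  ultimately have "(triple v1 v2 v3)\<^sup>2 = (g \<bullet> g) * (A * (e \<bullet> e))"
    by (simp add: power_mult_distrib power2_norm_eq_inner)
  then have T2: "\<Delta>\<^sup>2 = (g \<bullet> g) * (A * (e \<bullet> e))" unfolding T[symmetric] power2_abs .
  have "((v3 \<bullet> v3) / 2) * (A * (3 / 4 * b)) \<le> (g \<bullet> g) * (A * (e \<bullet> e))"
    using g12 e34 A b by (intro mult_mono) auto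
  then have "(3/8) * (A * b * (v3 \<bullet> v3)) \<le> \<Delta>\<^sup>2" unfolding T2 by (simp add: mult_ac)
  moreover have "A * b * (v3 \<bullet> v3) = (norm v1 * norm v2 * norm v3)\<^sup>2"
    by (simp add: A_def b_def power_mult_distrib power2_norm_eq_inner)
  moreover have "0 \<le> \<Delta>\<^sup>2" "(2 * \<Delta>)\<^sup>2 = 4 * \<Delta>\<^sup>2" by (simp_all add: power_mult_distrib)
  ultimately have "(norm v1 * norm v2 * norm v3)\<^sup>2 \<le> (2 * \<Delta>)\<^sup>2" by linarith
  then have "norm v1 * norm v2 * norm v3 \<le> 2 * \<Delta>" using power2_le_imp_le[of "norm v1 * norm v2 * norm v3" "2 * \<Delta>"] \<Delta> by simp
  then show ?thesis by (rule that[OF bas n])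
qed

section \<open>Counting lattice points in boxes by volume\<close>

lemma measure_cbox3:
  fixes l h :: "real^3"
  assumes "\<And>i. l $ i \<le> h $ i"
  shows "measure lebesgue (cbox l h) = (h $ 1 - l $ 1) * (h $ 2 - l $ 2) * (h $ 3 - l $ 3)"
    "measure lebesgue (box l h) = (h $ 1 - l $ 1) * (h $ 2 - l $ 2) * (h $ 3 - l $ 3)"
proof -
  have ne: "cbox l h \<noteq> {}" using assms by (simp add: interval_ne_empty_cart)
  then have c: "measure lborel (cbox l h) = (h $ 1 - l $ 1) * (h $ 2 - l $ 2) * (h $ 3 - l $ 3)"
    unfolding content_cbox_cart[OF ne] UNIV_3 by (simp add: mult.assoc)
  then show "measure lebesgue (cbox l h) = (h $ 1 - l $ 1) * (h $ 2 - l $ 2) * (h $ 3 - l $ 3)"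
    by simp
  have "measure lborel (box l h) = measure lborel (cbox l h)"
    unfolding measure_def emeasure_lborel_box_eq emeasure_lborel_cbox_eq ..
  then show "measure lebesgue (box l h) = (h $ 1 - l $ 1) * (h $ 2 - l $ 2) * (h $ 3 - l $ 3)"
    using c by simp
qed

definition param :: "real^3 \<Rightarrow> real^3 \<Rightarrow> real^3 \<Rightarrow> real^3 \<Rightarrow> real^3" where
  "param u v w t = t $ 1 *\<^sub>R u + t $ 2 *\<^sub>R v + t $ 3 *\<^sub>R w"

lemma linear_param: "linear (param u v w)"
  by (rule linearI) (simp_all add: param_def algebra_simps)

lemma det_param: "det (matrix (param u v w)) = triple u v w"
proof -
  have "matrix (param u v w) $ i $ 1 = u $ i" "matrix (param u v w) $ i $ 2 = v $ i"
    "matrix (param u v w) $ i $ 3 = w $ i" for i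
    by (simp_all add: matrix_def param_def axis_def)
  then show ?thesis by (simp add: det_3 triple_def cross3_simps)
qed

definition int_vecs :: "(real^3) set" where "int_vecs = {t. \<forall>i. t $ i \<in> \<int>}"

lemma param_int_vecs: "param u v w ` int_vecs = lat u v w"
proof (intro equalityI subsetI)
  fix z assume "z \<in> param u v w ` int_vecs"
  then obtain t where t: "t \<in> int_vecs" "z = param u v w t" by auto
  have "t $ 1 \<in> \<int>" "t $ 2 \<in> \<int>" "t $ 3 \<in> \<int>" using t by (auto simp: int_vecs_def)
  then obtain i j k where "t $ 1 = of_int i" "t $ 2 = of_int j" "t $ 3 = of_int k" by (auto elim!: Ints_cases)
  then show "z \<in> lat u v w" unfolding lat_def t(2) param_def by auto
next
  fix z assume "z \<in> lat u v w"
  then obtain i j k where z: "z = of_int i *\<^sub>R u + of_int j *\<^sub>R v + of_int k *\<^sub>R w" by (auto simp: lat_def)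
  then have "z = param u v w (vector [of_int i, of_int j, of_int k])"
    by (simp add: param_def vector_3)
  moreover have "vector [of_int i, of_int j, of_int k] \<in> int_vecs"
    by (auto simp: int_vecs_def forall_3 vector_3)
  ultimately show "z \<in> param u v w ` int_vecs" by blast
qed

lemma inj_param: assumes "triple u v w \<noteq> 0" shows "inj (param u v w)"
proof (rule injI)
  fix s t assume eq: "param u v w s = param u v w t"
  note a = triple_coords[of "s $ 1" u "s $ 2" v "s $ 3" w] triple_coords[of "t $ 1" u "t $ 2" v "t $ 3" w]
  have "s $ 1 * triple u v w = t $ 1 * triple u v w" "s $ 2 * triple u v w = t $ 2 * triple u v w"
    "s $ 3 * triple u v w = t $ 3 * triple u v w"
    using a eq unfolding param_def by metis+
  then show "s = t" using assms by (simp add: vec_eq_iff forall_3)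
qed

lemma param_unit_le:
  assumes "\<And>i. 0 \<le> t $ i \<and> t $ i \<le> 1" "norm u + norm v + norm w \<le> s"
  shows "\<bar>param u v w t $ i\<bar> \<le> s"
proof -
  have "\<bar>param u v w t $ i\<bar> \<le> norm (param u v w t)" by (rule component_le_norm_cart)
  also have "\<dots> \<le> norm (t $ 1 *\<^sub>R u) + norm (t $ 2 *\<^sub>R v) + norm (t $ 3 *\<^sub>R w)"
    unfolding param_def using norm_triangle_ineq[of "t $ 1 *\<^sub>R u + t $ 2 *\<^sub>R v" "t $ 3 *\<^sub>R w"]
      norm_triangle_ineq[of "t $ 1 *\<^sub>R u" "t $ 2 *\<^sub>R v"] by linarith
  also have "\<dots> \<le> 1 * norm u + 1 * norm v + 1 * norm w"
    using assms(1) by (simp only: norm_scaleR) (intro add_mono mult_right_mono; simp)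
  finally show ?thesis using assms(2) by simp
qed

lemma int_vecs_box_disjoint:
  assumes "m \<in> int_vecs" "n \<in> int_vecs" "m \<noteq> n"
  shows "box m (m + 1) \<inter> box n (n + 1) = {}"
proof (rule ccontr)
  assume "box m (m + 1) \<inter> box n (n + 1) \<noteq> {}"
  then obtain t where t: "t \<in> box m (m + 1)" "t \<in> box n (n + 1)" by auto
  obtain i where i: "m $ i \<noteq> n $ i" using assms(3) by (auto simp: vec_eq_iff)
  have "m $ i \<in> \<int>" "n $ i \<in> \<int>" using assms(1,2) by (auto simp: int_vecs_def)
  then obtain a b where ab: "m $ i = of_int a" "n $ i = of_int b" by (auto elim!: Ints_cases)
  have "m $ i < t $ i" "t $ i < m $ i + 1" "n $ i < t $ i" "t $ i < n $ i + 1"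
    using t by (auto simp: mem_box_cart)
  then have "real_of_int a < of_int b + 1" "real_of_int b < of_int a + 1" unfolding ab by linarith+
  then have "a = b" by linarith
  then show False using i ab by simp
qed

text \<open>Each lattice point carries a cell of volume \<Delta>, whose extent in every coordinate
  is at most \<open>s\<close>. The cells of the points in a box stay inside the box enlarged by
  \<open>s\<close> on all sides and cover the box shrunk by \<open>s\<close>.\<close>

lemma lat_box_count:
  assumes B: "lat_basis \<Lambda> \<Delta> u v w" and \<Delta>: "0 < \<Delta>" and s: "norm u + norm v + norm w \<le> s"
  shows "finite {z \<in> \<Lambda>. z \<in> cbox l h}"
    and "(\<And>i. l $ i \<le> h $ i) \<Longrightarrow> real (card {z \<in> \<Lambda>. z \<in> cbox l h}) * \<Delta>
       \<le> (h $ 1 - l $ 1 + 2 * s) * (h $ 2 - l $ 2 + 2 * s) * (h $ 3 - l $ 3 + 2 * s)"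
    and "(\<And>i. l $ i + 2 * s \<le> h $ i) \<Longrightarrow>
       (h $ 1 - l $ 1 - 2 * s) * (h $ 2 - l $ 2 - 2 * s) * (h $ 3 - l $ 3 - 2 * s)
       \<le> real (card {z \<in> \<Lambda>. z \<in> box l h}) * \<Delta>"
proof -
  define T where "T = param u v w"
  have \<Lambda>: "\<Lambda> = T ` int_vecs" and tr: "\<bar>triple u v w\<bar> = \<Delta>"
    using B param_int_vecs by (auto simp: lat_basis_def T_def)
  have inj: "inj T" unfolding T_def using tr \<Delta> by (intro inj_param) auto
  have lin: "linear T" unfolding T_def by (rule linear_param)
  have surj: "surj T" using lin inj by (intro linear_injective_imp_surjective) auto
  have mes: "T ` S \<in> lmeasurable" "measure lebesgue (T ` S) = \<Delta> * measure lebesgue S" if "S \<in> lmeasurable" for S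
    using measurable_linear_image[OF lin that] measure_linear_image[OF lin that] tr
    by (auto simp: T_def det_param)
  have s0: "0 \<le> s" using s by (smt (verit) norm_ge_zero)
  define S where "S = (\<chi> i::3. s)"
  have Si: "S $ i = s" for i by (simp add: S_def)
  have unit: "\<bar>T t $ i - T n $ i\<bar> \<le> s" if "\<And>i. n $ i \<le> t $ i \<and> t $ i \<le> n $ i + 1" for t n i
  proof -
    have "T t - T n = T (t - n)" using lin by (simp add: linear_diff)
    moreover have "\<bar>T (t - n) $ i\<bar> \<le> s" unfolding T_def
      by (rule param_unit_le[OF _ s]) (use that in \<open>auto simp: algebra_simps\<close>)
    ultimately show ?thesis by (metis vector_minus_component)
  qed
  have fin: "finite {z \<in> \<Lambda>. z \<in> cbox l h}" for l h
  proof -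
    obtain \<rho> where \<rho>: "\<And>z. z \<in> cbox l h \<Longrightarrow> norm z \<le> \<rho>" using bounded_cbox[of l h] by (auto simp: bounded_iff)
    have "norm z \<le> max 0 \<rho>" if "z \<in> cbox l h" for z using \<rho>[OF that] by simp
    then have "{z \<in> \<Lambda>. z \<in> cbox l h} \<subseteq> {z \<in> \<Lambda>. norm z \<le> max 0 \<rho>}" by blast
    then show ?thesis by (rule finite_subset) (rule lat_ball_card(1)[OF B \<Delta>], simp)
  qed
  then show "finite {z \<in> \<Lambda>. z \<in> cbox l h}" .
  define F where "F A = {n \<in> int_vecs. T n \<in> A}" for A
  have FA: "{z \<in> \<Lambda>. z \<in> A} = T ` F A" for A unfolding \<Lambda> F_def by auto
  have cF: "card {z \<in> \<Lambda>. z \<in> A} = card (F A)" for A unfolding FA by (rule card_image[OF inj_on_subset[OF inj subset_UNIV]])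
  have fF: "finite (F A)" if "finite {z \<in> \<Lambda>. z \<in> A}" for A
    using finite_imageD[OF that[unfolded FA] inj_on_subset[OF inj subset_UNIV]] .
  have unitbox: "measure lebesgue (box n (n + 1)) = 1" "measure lebesgue (cbox n (n + 1)) = 1" for n :: "real^3"
    using measure_cbox3[of n "n + 1"] by simp_all
  show "real (card {z \<in> \<Lambda>. z \<in> cbox l h}) * \<Delta>
       \<le> (h $ 1 - l $ 1 + 2 * s) * (h $ 2 - l $ 2 + 2 * s) * (h $ 3 - l $ 3 + 2 * s)"
    if le: "\<And>i. l $ i \<le> h $ i"
  proof -
    \<comment> \<open>Open cells, since they are disjoint and their measures add up. The covering
      argument for the lower bound uses closed cells and subadditivity.\<close>
    define U where "U = (\<Union>n\<in>F (cbox l h). box n (n + 1))"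
    have fU: "finite (F (cbox l h))" by (rule fF[OF fin])
    have mU: "U \<in> lmeasurable" unfolding U_def using fU by (intro fmeasurable.finite_UN) auto
    have "measure lebesgue U = (\<Sum>n\<in>F (cbox l h). measure lebesgue (box n (n + 1)))"
      unfolding U_def using fU int_vecs_box_disjoint
      by (intro measure_UNION') (auto simp: pairwise_def disjnt_def F_def)
    then have "real (card {z \<in> \<Lambda>. z \<in> cbox l h}) * \<Delta> = measure lebesgue (T ` U)"
      using mes[OF mU] by (simp add: cF unitbox)
    also have "\<dots> \<le> measure lebesgue (cbox (l - S) (h + S))"
    proof (rule measure_mono_fmeasurable)
      show "T ` U \<subseteq> cbox (l - S) (h + S)"
      proof
        fix z assume "z \<in> T ` U"
        then obtain n t where n: "T n \<in> cbox l h" "t \<in> box n (n + 1)" "z = T t" by (auto simp: U_def F_def)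
        have "\<bar>T t $ i - T n $ i\<bar> \<le> s" for i by (rule unit) (use n(2) in \<open>auto simp: mem_box_cart less_imp_le\<close>)
        note a = this
        have b: "l $ i \<le> T n $ i" "T n $ i \<le> h $ i" for i using n(1) by (simp_all add: mem_box_cart)
        have "(l - S) $ i \<le> T t $ i \<and> T t $ i \<le> (h + S) $ i" for i
          unfolding vector_minus_component vector_add_component Si using a[of i] b[of i] by linarith
        then show "z \<in> cbox (l - S) (h + S)" unfolding n(3) mem_box_cart by blast
      qed
    qed (use mes[OF mU] in auto)
    also have "\<dots> = (h $ 1 - l $ 1 + 2 * s) * (h $ 2 - l $ 2 + 2 * s) * (h $ 3 - l $ 3 + 2 * s)"
    proof -
      have "(l - S) $ i \<le> (h + S) $ i" for i using le[of i] s0 by (simp add: S_def)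
      from measure_cbox3(1)[OF this] show ?thesis by (simp add: S_def algebra_simps)
    qed
    finally show ?thesis .
  qed
  show "(h $ 1 - l $ 1 - 2 * s) * (h $ 2 - l $ 2 - 2 * s) * (h $ 3 - l $ 3 - 2 * s)
       \<le> real (card {z \<in> \<Lambda>. z \<in> box l h}) * \<Delta>"
    if le: "\<And>i. l $ i + 2 * s \<le> h $ i"
  proof -
    have "{z \<in> \<Lambda>. z \<in> box l h} \<subseteq> {z \<in> \<Lambda>. z \<in> cbox l h}" using box_subset_cbox by auto
    then have fU: "finite (F (box l h))" using fin finite_subset by (intro fF) blast
    define U where "U = (\<Union>n\<in>F (box l h). cbox n (n + 1))"
    have mU: "U \<in> lmeasurable" unfolding U_def using fU by (intro fmeasurable.finite_UN) auto
    have "(h $ 1 - l $ 1 - 2 * s) * (h $ 2 - l $ 2 - 2 * s) * (h $ 3 - l $ 3 - 2 * s)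
      = measure lebesgue (box (l + S) (h - S))"
    proof -
      have "(l + S) $ i \<le> (h - S) $ i" for i using le[of i] s0 by (simp add: S_def)
      from measure_cbox3(2)[OF this] show ?thesis by (simp add: S_def algebra_simps)
    qed
    also have "\<dots> \<le> measure lebesgue (T ` U)"
    proof (rule measure_mono_fmeasurable)
      show "box (l + S) (h - S) \<subseteq> T ` U"
      proof
        fix z assume z: "z \<in> box (l + S) (h - S)"
        obtain t where t: "z = T t" using surj by (metis surjD)
        define n :: "real^3" where "n = (\<chi> i. of_int \<lfloor>t $ i\<rfloor>)"
        have nt: "n $ i \<le> t $ i \<and> t $ i \<le> n $ i + 1" for i
          unfolding n_def by simp
        have "\<bar>T t $ i - T n $ i\<bar> \<le> s" for i by (rule unit) (use nt in auto)
        note a = this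
        have b: "l $ i + s < T t $ i" "T t $ i < h $ i - s" for i using z unfolding t mem_box_cart by (simp_all add: Si)
        have "l $ i < T n $ i \<and> T n $ i < h $ i" for i using a[of i] b[of i] by linarith
        then have "T n \<in> box l h" unfolding mem_box_cart by blast
        moreover have "n \<in> int_vecs" by (simp add: int_vecs_def n_def)
        ultimately have "n \<in> F (box l h)" by (simp add: F_def)
        moreover have "t \<in> cbox n (n + 1)" using nt by (simp add: mem_box_cart)
        ultimately show "z \<in> T ` U" unfolding t U_def by blast
      qed
    qed (use mes[OF mU] in auto)
    also have "\<dots> = \<Delta> * measure lebesgue U" by (rule mes(2)[OF mU])
    also have "\<dots> \<le> \<Delta> * (\<Sum>n\<in>F (box l h). measure lebesgue (cbox n (n + 1)))"
      unfolding U_def using fU \<Delta> by (intro mult_left_mono measure_UNION_le) auto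
    also have "\<dots> = real (card {z \<in> \<Lambda>. z \<in> box l h}) * \<Delta>" by (simp add: unitbox cF)
    finally show ?thesis .
  qed
qed

text \<open>For a reduced basis the factor \<open>norm v * norm w / \<Delta>\<close> from Cramer's
  rule is at most \<open>2 / norm u\<close>, so every coordinate is governed by its own basis
  vector.\<close>

lemma reduced_ball_card:
  assumes B: "lat_basis \<Lambda> \<Delta> u v w" and \<Delta>: "0 < \<Delta>" and \<rho>: "0 \<le> \<rho>"
    and red: "norm u * norm v * norm w \<le> 2 * \<Delta>"
  shows "real (card {z \<in> \<Lambda>. norm z \<le> \<rho>}) \<le> (4 * \<rho> / norm u + 1) * (4 * \<rho> / norm v + 1) * (4 * \<rho> / norm w + 1)"
proof -
  have "0 < \<bar>triple u v w\<bar>" using B \<Delta> by (simp add: lat_basis_def)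
  then have "u \<noteq> 0" "v \<noteq> 0" "w \<noteq> 0" by (auto simp: triple_def)
  then have p: "0 < norm u" "0 < norm v" "0 < norm w" by auto
  have h: "2 * (\<rho> * (x * y) / \<Delta>) + 1 \<le> 4 * \<rho> / z + 1" if "x * y * z \<le> 2 * \<Delta>" "0 < z" for x y z
  proof -
    have "\<rho> * (x * y * z) \<le> \<rho> * (2 * \<Delta>)" using that \<rho> by (intro mult_left_mono) auto
    then have "\<rho> * (x * y) * z \<le> 2 * \<rho> * \<Delta>" by (simp add: mult_ac)
    then have "\<rho> * (x * y) / \<Delta> \<le> 2 * \<rho> / z" using that(2) \<Delta>
      by (simp add: pos_le_divide_eq pos_divide_le_eq)
    then show ?thesis by simp
  qed
  have red': "norm v * norm w * norm u \<le> 2 * \<Delta>" "norm w * norm u * norm v \<le> 2 * \<Delta>"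
    using red by (simp_all add: mult_ac)
  have "(2 * (\<rho> * (norm v * norm w) / \<Delta>) + 1) * (2 * (\<rho> * (norm w * norm u) / \<Delta>) + 1) * (2 * (\<rho> * (norm u * norm v) / \<Delta>) + 1)
      \<le> (4 * \<rho> / norm u + 1) * (4 * \<rho> / norm v + 1) * (4 * \<rho> / norm w + 1)"
  proof -
    have "0 \<le> 2 * (\<rho> * (x * y) / \<Delta>) + 1" if "0 \<le> x" "0 \<le> y" for x y using that \<Delta> \<rho> by simp
    moreover have "0 \<le> 4 * \<rho> / x + 1" if "0 < x" for x using that \<rho> by simp
    ultimately show ?thesis
      using p by (intro mult_mono h[OF red'(1) p(1)] h[OF red'(2) p(2)] h[OF red p(3)] mult_nonneg_nonneg) simp_all
  qed
  then show ?thesis using lat_ball_card(2)[OF B \<Delta> \<rho>] by linarith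
qed

text \<open>\<open>n\<close> is the dual basis vector that reads off the coordinate along
  \<open>w\<close>, namely the cross product of \<open>u\<close> and \<open>v\<close> over the
  determinant. Reducedness makes it short when \<open>w\<close> is long.\<close>

lemma dual_vector:
  assumes B: "lat_basis \<Lambda> \<Delta> u v w" and \<Delta>: "0 < \<Delta>" and red: "norm u * norm v * norm w \<le> 2 * \<Delta>"
  obtains n where "norm n \<le> 2 / norm w" "\<And>z. z \<in> \<Lambda> \<Longrightarrow> n \<bullet> z \<in> \<int>" "n \<bullet> w = 1"
proof
  define n where "n = (1 / triple u v w) *\<^sub>R cross3 u v"
  have t: "\<bar>triple u v w\<bar> = \<Delta>" "triple u v w \<noteq> 0" using B \<Delta> by (auto simp: lat_basis_def)
  then have "w \<noteq> 0" by (auto simp: triple_def)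
  then have w: "0 < norm w" by simp
  have "norm n = norm (cross3 u v) / \<Delta>" using t by (simp add: n_def)
  also have "\<dots> \<le> norm u * norm v / \<Delta>" using \<Delta> norm_cross3_le by (intro divide_right_mono) auto
  also have "\<dots> \<le> 2 / norm w" using red w \<Delta> by (simp add: pos_le_divide_eq pos_divide_le_eq)
  finally show "norm n \<le> 2 / norm w" .
  have k: "n \<bullet> (i *\<^sub>R u + j *\<^sub>R v + k *\<^sub>R w) = k" for i j k
    using triple_coords(3)[of i u j v k w] t by (simp add: n_def inner_commute)
  show "n \<bullet> w = 1" using k[of 0 0 1] by simp
  fix z assume "z \<in> \<Lambda>"
  then obtain i j m where "z = of_int i *\<^sub>R u + of_int j *\<^sub>R v + of_int m *\<^sub>R w"
    using B by (auto simp: lat_basis_def lat_def)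
  then show "n \<bullet> z \<in> \<int>" using k by simp
qed

subsection \<open>Short arcs of the curve\<close>

lemma harmonic_le: "(\<Sum>k=1..n. 1 / real k) \<le> 1 + ln (real n)" if "1 \<le> n"
  using that
proof (induction n rule: nat_induct_at_least)
  case (Suc n)
  have n: "0 < real n" using Suc.hyps by simp
  have "ln (real n / real (Suc n)) \<le> real n / real (Suc n) - 1" using n by (intro ln_le_minus_one) simp
  also have "\<dots> = - 1 / real (Suc n)" by (simp add: field_simps)
  finally have "1 / real (Suc n) \<le> ln (real (Suc n)) - ln (real n)" using n by (simp add: ln_div)
  then show ?case using Suc.IH by simp
qed simp

lemma harmonic_inj_le:
  assumes "finite A" "inj_on h A" "h ` A \<subseteq> {1..n}" "1 \<le> n"
  shows "(\<Sum>j\<in>A. 1 / real (h j)) \<le> 1 + ln (real n)"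
proof -
  have "(\<Sum>j\<in>A. 1 / real (h j)) = (\<Sum>k\<in>h ` A. 1 / real k)" by (simp add: sum.reindex[OF assms(2)])
  also have "\<dots> \<le> (\<Sum>k=1..n. 1 / real k)" using assms by (intro sum_mono2) auto
  finally show ?thesis using harmonic_le[OF assms(4)] by simp
qed

text \<open>
  If \<open>t\<^sub>j\<close> is the nearest sample to the abscissa of \<open>v\<close>, then the \<open>k\<close>-th neighbours of
  \<open>t\<^sub>j\<close> are at distance at least \<open>g k / 2\<close>, so the samples attached to \<open>v\<close> contribute a
  harmonic sum.
\<close>

lemma sum_over_samples:
  fixes t w :: "nat \<Rightarrow> real" and n :: "nat \<Rightarrow> int \<times> int \<times> int"
  assumes g: "0 < g" "0 \<le> g'" and B: "B \<subseteq> {..<J}"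
    and sep: "\<And>i j. i < J \<Longrightarrow> j < J \<Longrightarrow> g * \<bar>real i - real j\<bar> \<le> \<bar>t i - t j\<bar>"
    and N: "finite N" "\<And>j. j \<in> B \<Longrightarrow> n j \<in> N" "\<And>v. v \<in> N \<Longrightarrow> 1 \<le> den v"
    and w: "\<And>j. j \<in> B \<Longrightarrow> 0 \<le> w j" "\<And>j. j \<in> B \<Longrightarrow> w j \<le> 1 / den (n j)"
      "\<And>j. j \<in> B \<Longrightarrow> w j * (\<bar>abscissa (n j) - t j\<bar> * den (n j)) \<le> g'"
    and J: "1 \<le> J"
  shows "(\<Sum>j\<in>B. w j) \<le> (\<Sum>v\<in>N. 1 / den v) * (1 + 4 * (g' / g) * (1 + ln (real J)))"
proof -
  have fB: "finite B" using B finite_subset by blast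
  define H where "H = 1 + ln (real J)"
  have H: "0 \<le> H" using J by (simp add: H_def)
  have fiber: "(\<Sum>j\<in>{j\<in>B. n j = v}. w j) \<le> (1 / den v) * (1 + 4 * (g' / g) * H)" if v: "v \<in> N" for v
  proof (cases "{j\<in>B. n j = v} = {}")
    case True show ?thesis unfolding True using N(3)[OF v] g H by simp
  next
    case False
    define Bv where "Bv = {j\<in>B. n j = v}"
    have fBv: "finite Bv" using fB by (simp add: Bv_def)
    define d where "d j = \<bar>abscissa v - t j\<bar>" for j
    have "arg_min_on d Bv \<in> Bv" "\<And>i. i \<in> Bv \<Longrightarrow> d (arg_min_on d Bv) \<le> d i"
      using arg_min_if_finite[OF fBv, of d] False arg_min_least[OF fBv] by (auto simp: Bv_def)
    then obtain m where m: "m \<in> Bv" "\<And>i. i \<in> Bv \<Longrightarrow> d m \<le> d i" by blast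
    have dv: "1 \<le> den v" by (rule N(3)[OF v])
    have far: "w j \<le> (1 / den v) * (2 * (g' / g)) * (1 / \<bar>real j - real m\<bar>)" if j: "j \<in> Bv" "j \<noteq> m" for j
    proof -
      have jm: "j < J" "m < J" "0 < \<bar>real j - real m\<bar>" using j m(1) B by (auto simp: Bv_def)
      have "g * \<bar>real j - real m\<bar> \<le> d j + d m" using sep[OF jm(1,2)] unfolding d_def by linarith
      then have dj: "g * \<bar>real j - real m\<bar> / 2 \<le> d j" using m(2)[OF j(1)] by linarith
      have wj: "0 \<le> w j" using w(1) j by (simp add: Bv_def)
      have "w j * (g * \<bar>real j - real m\<bar> / 2 * den v) \<le> w j * (d j * den v)"
        using dj dv wj by (intro mult_left_mono mult_right_mono) auto
      also have "\<dots> \<le> g'" using w(3)[of j] j by (auto simp: d_def Bv_def)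
      finally have "w j \<le> g' / (g * \<bar>real j - real m\<bar> / 2 * den v)"
        using g jm dv by (simp add: pos_le_divide_eq)
      also have "\<dots> = (1 / den v) * (2 * (g' / g)) * (1 / \<bar>real j - real m\<bar>)" by (simp add: mult_ac)
      finally show ?thesis .
    qed
    define K where "K = (1 / den v) * (2 * (g' / g))"
    have K: "0 \<le> K" using dv g by (simp add: K_def)
    have lt: "j < J" if "j \<in> Bv" for j using that B by (auto simp: Bv_def)
    \<comment> \<open>On either side of \<open>m\<close> the distances to \<open>m\<close> are
      distinct integers between 1 and \<open>J\<close>, so each side contributes a harmonic
      sum.\<close>
    define Bl Bu where "Bl = {j\<in>Bv. j < m}" and "Bu = {j\<in>Bv. m < j}"
    have "(\<Sum>j\<in>Bl. w j) \<le> (\<Sum>j\<in>Bl. K * (1 / real (m - j)))"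
    proof (intro sum_mono)
      fix j assume "j \<in> Bl"
      then have j: "j \<in> Bv" "j < m" by (auto simp: Bl_def)
      then have "\<bar>real j - real m\<bar> = real (m - j)" by (simp add: of_nat_diff)
      then show "w j \<le> K * (1 / real (m - j))" using far[of j] j by (simp add: K_def)
    qed
    also have "\<dots> = K * (\<Sum>j\<in>Bl. 1 / real (m - j))" by (simp add: sum_distrib_left)
    also have "\<dots> \<le> K * H" unfolding H_def
    proof (intro mult_left_mono harmonic_inj_le)
      show "(\<lambda>j. m - j) ` Bl \<subseteq> {1..J}" using lt m(1) by (fastforce simp: Bl_def)
    qed (use K fBv J in \<open>auto simp: Bl_def intro!: inj_onI\<close>)
    finally have l: "(\<Sum>j\<in>Bl. w j) \<le> K * H" .
    have "(\<Sum>j\<in>Bu. w j) \<le> (\<Sum>j\<in>Bu. K * (1 / real (j - m)))"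
    proof (intro sum_mono)
      fix j assume "j \<in> Bu"
      then have j: "j \<in> Bv" "m < j" by (auto simp: Bu_def)
      then have "\<bar>real j - real m\<bar> = real (j - m)" by (simp add: of_nat_diff)
      then show "w j \<le> K * (1 / real (j - m))" using far[of j] j by (simp add: K_def)
    qed
    also have "\<dots> = K * (\<Sum>j\<in>Bu. 1 / real (j - m))" by (simp add: sum_distrib_left)
    also have "\<dots> \<le> K * H" unfolding H_def
    proof (intro mult_left_mono harmonic_inj_le)
      show "(\<lambda>j. j - m) ` Bu \<subseteq> {1..J}" using lt by (fastforce simp: Bu_def)
    qed (use K fBv J in \<open>auto simp: Bu_def intro!: inj_onI\<close>)
    finally have u: "(\<Sum>j\<in>Bu. w j) \<le> K * H" .
    have "w m \<le> 1 / den v" using w(2)[of m] m(1) by (auto simp: Bv_def)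
    moreover have "(\<Sum>j\<in>Bv. w j) = w m + ((\<Sum>j\<in>Bl. w j) + (\<Sum>j\<in>Bu. w j))"
    proof -
      have f: "finite Bl" "finite Bu" using fBv by (auto simp: Bl_def Bu_def)
      have "Bv = insert m (Bl \<union> Bu)" using m(1) by (auto simp: Bl_def Bu_def)
      moreover have "m \<notin> Bl \<union> Bu" "Bl \<inter> Bu = {}" by (auto simp: Bl_def Bu_def)
      ultimately show ?thesis using f by (simp add: sum.union_disjoint)
    qed
    ultimately have "(\<Sum>j\<in>Bv. w j) \<le> 1 / den v + (K * H + K * H)" using l u by linarith
    also have "\<dots> = (1 / den v) * (1 + 4 * (g' / g) * H)" by (simp add: K_def algebra_simps)
    finally show ?thesis by (simp add: Bv_def)
  qed
  have "(\<Sum>j\<in>B. w j) = (\<Sum>v\<in>N. \<Sum>j\<in>{j\<in>B. n j = v}. w j)"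
  proof -
    have "n ` B \<subseteq> N" using N(2) by blast
    from sum.group[OF fB N(1) this, of w] show ?thesis by simp
  qed
  also have "\<dots> \<le> (\<Sum>v\<in>N. (1 / den v) * (1 + 4 * (g' / g) * H))" by (intro sum_mono fiber)
  also have "\<dots> = (\<Sum>v\<in>N. 1 / den v) * (1 + 4 * (g' / g) * H)" by (simp add: sum_distrib_right)
  finally show ?thesis by (simp add: H_def)
qed

text \<open>The scaling turns the conditions that q is at most Q, \<open>a / q\<close> within r of x
  and \<open>b / q\<close> within \<delta> / Q of the tangent into a pyramid in which the second and
  third coordinate are bounded by the first and the first by 1. Its volume 4 / 3 is the same for
  every arc.\<close>

definition arc_map :: "real \<Rightarrow> real \<Rightarrow> real \<Rightarrow> real \<times> real \<times> real \<Rightarrow> int \<times> int \<times> int \<Rightarrow> real^3" where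
  "arc_map Q r \<delta> s v = (case s of (x,y,p) \<Rightarrow> case v of (a,b,q) \<Rightarrow>
     vector [of_int q / Q, (of_int a - x * of_int q) / (r * Q),
       (of_int b - y * of_int q - p * (of_int a - x * of_int q)) / \<delta>])"

lemma gcd_eq_1I: "i * a + j * b + k * q = 1 \<Longrightarrow> gcd a (gcd b q) = (1::int)"
proof -
  assume "i * a + j * b + k * q = 1"
  moreover have "gcd a (gcd b q) dvd i * a + j * b + k * q"
    by (meson dvd_add dvd_mult gcd_dvd1 gcd_dvd2 dvd_trans)
  ultimately show ?thesis by simp
qed

section \<open>The lattice of a single arc\<close>

locale arc =
  fixes Q r \<delta> x y p :: real
  assumes Q: "0 < Q" and r: "0 < r" and \<delta>: "0 < \<delta>"
begin

text \<open>The inverse covolume: a region should contain about \<open>V\<close> times its volume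
  many triples.\<close>

definition V where "V = r * \<delta> * Q\<^sup>2"

lemma V_pos: "0 < V" using Q r \<delta> by (simp add: V_def)

abbreviation \<Phi> where "\<Phi> \<equiv> arc_map Q r \<delta> (x,y,p)"

definition eq :: "real^3" where "eq = vector [1 / Q, - x / (r * Q), (p * x - y) / \<delta>]"
definition ea :: "real^3" where "ea = vector [0, 1 / (r * Q), - p / \<delta>]"
definition eb :: "real^3" where "eb = vector [0, 0, 1 / \<delta>]"

lemma \<Phi>_eq: "\<Phi> (a,b,q) = of_int q *\<^sub>R eq + of_int a *\<^sub>R ea + of_int b *\<^sub>R eb"
  using Q r \<delta> by (simp add: arc_map_def eq_def ea_def eb_def vec_eq_iff forall_3 field_simps)

lemma range_\<Phi>: "range \<Phi> = lat eq ea eb"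
proof (intro equalityI subsetI)
  fix z assume "z \<in> range \<Phi>"
  then obtain a b q where "z = \<Phi> (a,b,q)" by auto
  then show "z \<in> lat eq ea eb" unfolding \<Phi>_eq lat_def by blast
next
  fix z assume "z \<in> lat eq ea eb"
  then obtain q a b where "z = of_int q *\<^sub>R eq + of_int a *\<^sub>R ea + of_int b *\<^sub>R eb" by (auto simp: lat_def)
  then have "z = \<Phi> (a,b,q)" by (simp add: \<Phi>_eq)
  then show "z \<in> range \<Phi>" by blast
qed

lemma triple_e: "triple eq ea eb = 1 / V"
  using Q r \<delta> by (simp add: triple_def eq_def ea_def eb_def cross3_def inner_vec_def sum_3 V_def field_simps power2_eq_square)

lemma basis_e: "lat_basis (range \<Phi>) (1 / V) eq ea eb"
  using V_pos by (simp add: lat_basis_def range_\<Phi> triple_e)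

lemma inj_\<Phi>: "inj \<Phi>"
proof (rule injI)
  fix v w assume eq: "\<Phi> v = \<Phi> w"
  obtain a b q where v: "v = (a,b,q)" by (cases v)
  obtain a' b' q' where w: "w = (a',b',q')" by (cases w)
  have h: "\<Phi> v $ 1 = \<Phi> w $ 1" "\<Phi> v $ 2 = \<Phi> w $ 2" "\<Phi> v $ 3 = \<Phi> w $ 3" using eq by auto
  have 1: "q = q'" using h(1) Q by (simp add: arc_map_def v w)
  have 2: "a = a'" using h(2) Q r by (simp add: arc_map_def v w 1)
  have 3: "b = b'" using h(3) \<delta> by (simp add: arc_map_def v w 1 2)
  show "v = w" by (simp add: v w 1 2 3)
qed

lemma card_vimage: "card {v. \<Phi> v \<in> A} = card {z \<in> range \<Phi>. z \<in> A}"
proof -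
  have "{z \<in> range \<Phi>. z \<in> A} = \<Phi> ` {v. \<Phi> v \<in> A}" by auto
  then show ?thesis using card_image[OF inj_on_subset[OF inj_\<Phi> subset_UNIV]] by metis
qed

lemma finite_vimage: "finite {z \<in> range \<Phi>. z \<in> A} \<Longrightarrow> finite {v. \<Phi> v \<in> A}"
proof -
  assume f: "finite {z \<in> range \<Phi>. z \<in> A}"
  have "{z \<in> range \<Phi>. z \<in> A} = \<Phi> ` {v. \<Phi> v \<in> A}" by auto
  then show ?thesis using f finite_imageD[OF _ inj_on_subset[OF inj_\<Phi> subset_UNIV]] by metis
qed

text \<open>A basis vector is primitive because the corresponding dual vector takes the value 1 on
  it. Its shortness excludes \<open>q = 0\<close>, and \<open>\<delta> * Q \<le> V\<^sup>2\<close>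
  turns \<open>norm v1 < 1 / V\<close> into the second condition of \<open>near\<close>.\<close>

lemma primal_triple:
  assumes B: "lat_basis (range \<Phi>) (1 / V) v1 v2 v3" and red: "norm v1 * norm v2 * norm v3 \<le> 2 * (1 / V)"
    and small: "norm v1 < 1 / V" and V: "1 \<le> V" "1 \<le> \<delta> * Q" "\<delta> \<le> 1" "\<delta> * Q \<le> V\<^sup>2"
  obtains a b q where "1 \<le> q" "gcd a (gcd b q) = 1" "near (x,y,p) (a,b,q)"
    "of_int q \<le> norm v1 * Q" "\<bar>of_int a - x * of_int q\<bar> \<le> norm v1 * (r * Q)"
proof -
  have "v1 \<in> range \<Phi>" using lat_basis_mem[OF B] by blast
  then obtain a b q where v1: "v1 = \<Phi> (a,b,q)" by auto
  \<comment> \<open>A cyclic shift brings \<open>v1\<close> into the last place, where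
    \<open>dual_vector\<close> expects the vector that it is dual to.\<close>
  have B': "lat_basis (range \<Phi>) (1 / V) v2 v3 v1"
    by (rule lat_basis_swap23[OF lat_basis_swap12[OF B]])
  have red': "norm v2 * norm v3 * norm v1 \<le> 2 * (1 / V)" using red by (simp add: mult_ac)
  have "0 < 1 / V" using V_pos by simp
  obtain n where n: "norm n \<le> 2 / norm v1" "\<And>z. z \<in> range \<Phi> \<Longrightarrow> n \<bullet> z \<in> \<int>" "n \<bullet> v1 = 1"
    by (rule dual_vector[OF B' \<open>0 < 1 / V\<close> red']) blast
  have "n \<bullet> eq \<in> \<int>" "n \<bullet> ea \<in> \<int>" "n \<bullet> eb \<in> \<int>" by (intro n(2) lat_basis_mem[OF basis_e])+
  then obtain k i j where ki: "n \<bullet> eq = of_int k" "n \<bullet> ea = of_int i" "n \<bullet> eb = of_int j" by (auto elim!: Ints_cases)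
  have "real_of_int (i * a + j * b + k * q) = 1"
    using n(3) unfolding v1 \<Phi>_eq by (simp add: inner_add_right ki mult.commute)
  then have "i * a + j * b + k * q = 1" by linarith
  then have g: "gcd a (gcd b q) = 1" by (rule gcd_eq_1I)
  have c: "\<bar>v1 $ i\<bar> \<le> norm v1" for i by (rule component_le_norm_cart)
  have ab: "\<bar>v1 $ 1\<bar> = \<bar>of_int q\<bar> / Q" "\<bar>v1 $ 2\<bar> = \<bar>of_int a - x * of_int q\<bar> / (r * Q)"
    "\<bar>v1 $ 3\<bar> = \<bar>of_int b - y * of_int q - p * (of_int a - x * of_int q)\<bar> / \<delta>"
    unfolding v1 arc_map_def using Q r \<delta> by (simp_all add: abs_divide abs_mult)
  have c1: "\<bar>real_of_int q\<bar> \<le> norm v1 * Q" using c[of 1] Q unfolding ab by (simp add: pos_divide_le_eq)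
  have c2: "\<bar>of_int a - x * of_int q\<bar> \<le> norm v1 * (r * Q)"
    using c[of 2] Q r unfolding ab by (simp add: pos_divide_le_eq)
  have c3: "\<bar>of_int b - y * of_int q - p * (of_int a - x * of_int q)\<bar> \<le> norm v1 * \<delta>"
    using c[of 3] \<delta> unfolding ab by (simp add: pos_divide_le_eq)
  have rQ: "norm v1 * (r * Q) < 1 / (\<delta> * Q)"
  proof -
    have "norm v1 * (r * Q) < 1 / V * (r * Q)" using small r Q by (intro mult_strict_right_mono) auto
    also have "\<dots> = 1 / (\<delta> * Q)" using r Q by (simp add: V_def power2_eq_square)
    finally show ?thesis .
  qed
  have "1 / (\<delta> * Q) \<le> 1" using V by simp
  then have rQ1: "norm v1 * (r * Q) < 1" using rQ by linarith
  have d1: "norm v1 * \<delta> < 1"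
  proof -
    have "1 / V \<le> 1" using V by simp
    then have "norm v1 < 1" using small by linarith
    moreover have "norm v1 * \<delta> \<le> norm v1 * 1" using V(3) by (intro mult_left_mono) auto
    ultimately show ?thesis by linarith
  qed
  have q0: "q \<noteq> 0"
  proof
    assume "q = 0"
    then have "\<bar>real_of_int a\<bar> < 1" using c2 rQ1 by simp
    then have "a = 0" by linarith
    then have "\<bar>real_of_int b\<bar> < 1" using c3 d1 \<open>q = 0\<close> by simp
    then have "b = 0" by linarith
    then show False using g \<open>q = 0\<close> \<open>a = 0\<close> by simp
  qed
  define \<sigma> where "\<sigma> = sgn q"
  have \<sigma>: "\<sigma> = 1 \<or> \<sigma> = -1" using q0 by (auto simp: \<sigma>_def sgn_if)
  have sq: "\<sigma> * q = \<bar>q\<bar>" by (simp add: \<sigma>_def sgn_if)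
  have 1: "1 \<le> \<sigma> * q" using q0 sq by linarith
  have 2: "gcd (\<sigma> * a) (gcd (\<sigma> * b) (\<sigma> * q)) = 1" unfolding gcd3_mult g using \<sigma> by auto
  have 4: "of_int (\<sigma> * q) \<le> norm v1 * Q" using c1 sq by simp
  have 5: "\<bar>of_int (\<sigma> * a) - x * of_int (\<sigma> * q)\<bar> \<le> norm v1 * (r * Q)"
    using \<sigma> c2 by (auto simp: abs_minus_commute)
  have 6: "\<bar>of_int (\<sigma> * b) - y * of_int (\<sigma> * q) - p * (of_int (\<sigma> * a) - x * of_int (\<sigma> * q))\<bar> \<le> norm v1 * \<delta>"
  proof -
    have "of_int (\<sigma> * b) - y * of_int (\<sigma> * q) - p * (of_int (\<sigma> * a) - x * of_int (\<sigma> * q)) =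
      of_int \<sigma> * (of_int b - y * of_int q - p * (of_int a - x * of_int q))" by (simp add: algebra_simps)
    then show ?thesis using \<sigma> c3 by (auto simp: abs_mult)
  qed
  have "of_int (\<sigma> * q) * \<bar>of_int (\<sigma> * b) - y * of_int (\<sigma> * q) - p * (of_int (\<sigma> * a) - x * of_int (\<sigma> * q))\<bar>
     \<le> (norm v1 * Q) * (norm v1 * \<delta>)"
    using 4 6 Q by (intro mult_mono) auto
  also have "\<dots> = (norm v1)\<^sup>2 * (\<delta> * Q)" by (simp add: power2_eq_square)
  also have "\<dots> \<le> (1 / V)\<^sup>2 * V\<^sup>2" using small V \<delta> Q by (intro mult_mono power_mono) auto
  also have "\<dots> = 1" using V_pos by (simp add: power_divide)
  finally have 3: "near (x,y,p) (\<sigma> * a, \<sigma> * b, \<sigma> * q)"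
    using 5 rQ1 unfolding near_def by simp
  show ?thesis by (rule that[OF 1 2 3 4 5])
qed

text \<open>The short dual vector takes integer values \<open>k\<close>, \<open>\<nu>\<close>,
  \<open>h\<close> on the images of the unit vectors, and its three coordinates are, up to scaling,
  the forms that express nearness of \<open>(-\<nu>, k, h)\<close> to the dual element. The
  hypotheses on \<open>\<rho>\<close> exclude \<open>h = 0\<close> and make the product in
  \<open>near\<close> at most \<rho>^2 / (\<delta> Q) \<le> 1.\<close>

lemma dual_triple:
  assumes B: "lat_basis (range \<Phi>) (1 / V) v1 v2 v3" and red: "norm v1 * norm v2 * norm v3 \<le> 2 * (1 / V)"
    and \<rho>: "2 / norm v3 < \<rho>" "\<rho> \<le> r * Q" "\<rho> \<le> Q" "\<rho>\<^sup>2 \<le> \<delta> * Q"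
  obtains \<nu> k h where "1 \<le> h" "gcd \<nu> (gcd k h) = 1" "near (p, x * p - y, x) (\<nu>,k,h)"
    "of_int h \<le> 2 / norm v3 / \<delta>" "\<bar>of_int \<nu> - p * of_int h\<bar> \<le> 2 / norm v3 / (r * Q)"
proof -
  define m where "m = 2 / norm v3"
  have "0 < 1 / V" using V_pos by simp
  obtain n where n: "norm n \<le> m" "\<And>z. z \<in> range \<Phi> \<Longrightarrow> n \<bullet> z \<in> \<int>" "n \<bullet> v3 = 1"
    unfolding m_def by (rule dual_vector[OF B \<open>0 < 1 / V\<close> red]) blast
  have m: "0 \<le> m" "m < \<rho>" using \<rho> by (auto simp: m_def)
  have "n \<bullet> eq \<in> \<int>" "n \<bullet> ea \<in> \<int>" "n \<bullet> eb \<in> \<int>" by (intro n(2) lat_basis_mem[OF basis_e])+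
  then obtain k \<nu> h where ki: "n \<bullet> eq = of_int k" "n \<bullet> ea = of_int \<nu>" "n \<bullet> eb = of_int h" by (auto elim!: Ints_cases)
  obtain a b q where v3: "v3 = \<Phi> (a,b,q)" using lat_basis_mem[OF B] by auto
  have "real_of_int (a * \<nu> + q * k + b * h) = 1"
    using n(3) unfolding v3 \<Phi>_eq by (simp add: inner_add_right ki)
  then have "a * \<nu> + q * k + b * h = 1" by linarith
  then have g: "gcd \<nu> (gcd k h) = 1" by (rule gcd_eq_1I)
  have i: "n \<bullet> eq = n $ 1 / Q - n $ 2 * x / (r * Q) + n $ 3 * (p * x - y) / \<delta>"
    "n \<bullet> ea = n $ 2 / (r * Q) - n $ 3 * p / \<delta>" "n \<bullet> eb = n $ 3 / \<delta>"
    by (simp_all add: eq_def ea_def eb_def inner_vec_def sum_3)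
  have n3: "n $ 3 = \<delta> * of_int h" using i(3) ki(3) \<delta> by (simp add: field_simps)
  have n2: "n $ 2 = r * Q * (of_int \<nu> + p * of_int h)" using i(2) ki(2) r Q \<delta> by (simp add: n3 field_simps)
  have n1: "n $ 1 = Q * (of_int k + x * of_int \<nu> + y * of_int h)"
  proof -
    have "n $ 2 * x / (r * Q) = x * (of_int \<nu> + p * of_int h)" using r Q by (simp add: n2)
    moreover have "n $ 3 * (p * x - y) / \<delta> = of_int h * (p * x - y)" using \<delta> by (simp add: n3)
    ultimately have "n $ 1 / Q = of_int k + x * of_int \<nu> + y * of_int h"
      using i(1) ki(1) by (simp add: algebra_simps)
    then show ?thesis using Q by (simp add: field_simps)
  qed
  have c: "\<bar>n $ i\<bar> \<le> m" for i using component_le_norm_cart[of n i] n(1) by linarith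
  have ab: "\<bar>n $ 3\<bar> = \<delta> * \<bar>of_int h\<bar>" "\<bar>n $ 2\<bar> = r * Q * \<bar>of_int \<nu> + p * of_int h\<bar>"
    "\<bar>n $ 1\<bar> = Q * \<bar>of_int k + x * of_int \<nu> + y * of_int h\<bar>"
    unfolding n1 n2 n3 abs_mult using Q r \<delta> by simp_all
  have c3: "\<bar>of_int h\<bar> \<le> m / \<delta>"
    using c[of 3] \<delta> unfolding ab by (simp add: pos_le_divide_eq mult.commute)
  have c2: "\<bar>of_int \<nu> + p * of_int h\<bar> \<le> m / (r * Q)"
    using c[of 2] r Q unfolding ab by (simp add: pos_le_divide_eq mult.commute)
  have c1: "\<bar>of_int k + x * of_int \<nu> + y * of_int h\<bar> \<le> m / Q"
    using c[of 1] Q unfolding ab by (simp add: pos_le_divide_eq mult.commute)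
  have m2: "m / (r * Q) < 1" using m \<rho> r Q by (simp add: divide_less_eq)
  have m1: "m / Q < 1" using m \<rho> Q by (simp add: divide_less_eq)
  have h0: "h \<noteq> 0"
  proof
    assume "h = 0"
    then have "\<bar>real_of_int \<nu>\<bar> < 1" using c2 m2 by simp
    then have "\<nu> = 0" by linarith
    then have "\<bar>real_of_int k\<bar> < 1" using c1 m1 \<open>h = 0\<close> by simp
    then have "k = 0" by linarith
    then show False using g \<open>\<nu> = 0\<close> \<open>h = 0\<close> by simp
  qed
  define \<sigma> where "\<sigma> = sgn h"
  have \<sigma>: "\<sigma> = 1 \<or> \<sigma> = -1" using h0 by (auto simp: \<sigma>_def sgn_if)
  have sq: "\<sigma> * h = \<bar>h\<bar>" by (simp add: \<sigma>_def sgn_if)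
  have 1: "1 \<le> \<sigma> * h" using h0 sq by linarith
  have "gcd (- \<nu>) (gcd k h) = 1" using g by simp
  then have 2: "gcd (\<sigma> * (- \<nu>)) (gcd (\<sigma> * k) (\<sigma> * h)) = 1" unfolding gcd3_mult using \<sigma> by auto
  have 4: "of_int (\<sigma> * h) \<le> m / \<delta>" using c3 sq by simp
  have 5: "\<bar>of_int (\<sigma> * (- \<nu>)) - p * of_int (\<sigma> * h)\<bar> \<le> m / (r * Q)"
    using \<sigma> c2 by auto
  have 6: "\<bar>of_int (\<sigma> * k) - (x * p - y) * of_int (\<sigma> * h) - x * (of_int (\<sigma> * (- \<nu>)) - p * of_int (\<sigma> * h))\<bar> \<le> m / Q"
  proof -
    have "of_int (\<sigma> * k) - (x * p - y) * of_int (\<sigma> * h) - x * (of_int (\<sigma> * (- \<nu>)) - p * of_int (\<sigma> * h)) =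
      of_int \<sigma> * (of_int k + x * of_int \<nu> + y * of_int h)" by (simp add: algebra_simps)
    then show ?thesis using \<sigma> c1 by (auto simp: abs_mult)
  qed
  have "of_int (\<sigma> * h) * \<bar>of_int (\<sigma> * k) - (x * p - y) * of_int (\<sigma> * h) - x * (of_int (\<sigma> * (- \<nu>)) - p * of_int (\<sigma> * h))\<bar>
     \<le> (m / \<delta>) * (m / Q)"
    using 4 6 m \<delta> by (intro mult_mono) auto
  also have "\<dots> = m\<^sup>2 / (\<delta> * Q)" by (simp add: power2_eq_square)
  also have "\<dots> \<le> \<rho>\<^sup>2 / (\<delta> * Q)" using m \<delta> Q by (intro divide_right_mono power_mono) auto
  also have "\<dots> \<le> 1" using \<rho> \<delta> Q by simp
  finally have 3: "near (p, x * p - y, x) (\<sigma> * (- \<nu>), \<sigma> * k, \<sigma> * h)"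
    using 5 m2 unfolding near_def by simp
  show ?thesis by (rule that[OF 1 2 3]) (use 4 5 in \<open>auto simp: m_def\<close>)
qed


text \<open>
  An arc is bad when the longest vector of a reduced basis has length \<open>m > s / 3\<close>; \<open>n\<close> is the resulting
  short vector of the dual lattice. The number \<open>e\<close> is the inverse length of the shortest vector \<open>v\<close>,
  or \<open>0\<close> if that inverse is dominated by \<open>V m\<close>.
\<close>

definition good :: "real \<Rightarrow> bool" where
  "good s \<longleftrightarrow> (\<forall>l h. (\<forall>i. l $ i \<le> h $ i) \<longrightarrow> finite {v. \<Phi> v \<in> cbox l h} \<and>
      real (card {v. \<Phi> v \<in> cbox l h}) \<le> V * ((h $ 1 - l $ 1 + 2 * s) * (h $ 2 - l $ 2 + 2 * s) * (h $ 3 - l $ 3 + 2 * s))) \<and>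
    (\<forall>l h. (\<forall>i. l $ i + 2 * s \<le> h $ i) \<longrightarrow>
      V * ((h $ 1 - l $ 1 - 2 * s) * (h $ 2 - l $ 2 - 2 * s) * (h $ 3 - l $ 3 - 2 * s)) \<le> real (card {v. \<Phi> v \<in> box l h}))"

definition bad :: "real \<Rightarrow> real \<Rightarrow> real \<Rightarrow> int \<times> int \<times> int \<Rightarrow> int \<times> int \<times> int \<Rightarrow> bool" where
  "bad s m e n v \<longleftrightarrow> s / 3 < m \<and> 0 \<le> e \<and> finite {v. norm (\<Phi> v) \<le> 4} \<and>
     real (card {v. norm (\<Phi> v) \<le> 4}) \<le> 20000 / s\<^sup>2 * (V * m + e) \<and>
     n \<in> Near {(p, x * p - y, x)} \<and> den n * m * \<delta> \<le> 2 \<and> \<bar>abscissa n - p\<bar> * den n * m * (r * Q) \<le> 2 \<and>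
     (e \<noteq> 0 \<longrightarrow> 1 \<le> e \<and> v \<in> Near {(x,y,p)} \<and> den v * e \<le> Q \<and> \<bar>abscissa v - x\<bar> * den v * e \<le> r * Q)"

lemma abscissa_den: "1 \<le> q \<Longrightarrow> \<bar>abscissa (a,b,q) - t\<bar> * den (a,b,q) = \<bar>of_int a - t * of_int q\<bar>"
proof -
  assume "1 \<le> q"
  then have q: "0 < real_of_int q" by simp
  have "(abscissa (a,b,q) - t) * den (a,b,q) = of_int a - t * of_int q"
    using q by (simp add: abscissa_def den_def left_diff_distrib)
  then show ?thesis using q by (metis abs_mult abs_of_pos den_def snd_conv)
qed

text \<open>The case distinction is whether the longest vector exceeds \<open>s / 3\<close>. If so,
  the ball contains at most the product of the factors \<open>16 / norm vi + 1\<close> many points.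
  Hadamard's inequality gives \<open>1 / (norm v1 * norm v2) \<le> V * m\<close>, and
  \<open>1 / norm v1\<close> is also a multiple of \<open>V * m\<close> at most, unless
  \<open>norm v1 < 1 / V\<close>, the case that \<open>e\<close> records.\<close>

lemma good_or_bad:
  assumes s: "0 < s" "s \<le> 1" and V: "1 \<le> V" "1 \<le> \<delta> * Q" "\<delta> \<le> 1" "\<delta> * Q \<le> V\<^sup>2"
    and \<rho>: "6 / s \<le> r * Q" "6 / s \<le> Q" "(6 / s)\<^sup>2 \<le> \<delta> * Q"
  shows "good s \<or> (\<exists>m e n v. bad s m e n v)"
proof -
  have V0: "0 < 1 / V" using V_pos by simp
  obtain v1 v2 v3 where B: "lat_basis (range \<Phi>) (1 / V) v1 v2 v3" and le: "norm v1 \<le> norm v2" "norm v2 \<le> norm v3"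
    and red: "norm v1 * norm v2 * norm v3 \<le> 2 * (1 / V)"
    by (rule reduced_basis_exists[OF basis_e V0]) blast
  have trip: "\<bar>triple v1 v2 v3\<bar> = 1 / V" using B by (simp add: lat_basis_def)
  then have "v1 \<noteq> 0" using V0 by (auto simp: triple_def)
  then have p1: "0 < norm v1" by simp
  then have p: "0 < norm v1" "0 < norm v2" "0 < norm v3" using le by linarith+
  have had: "1 / V \<le> norm v1 * norm v2 * norm v3" using triple_le[of v1 v2 v3] trip by simp
  show ?thesis
  proof (cases "norm v3 \<le> s / 3")
    case True
    then have sm: "norm v1 + norm v2 + norm v3 \<le> s" using le by linarith
    note bc = lat_box_count[OF B V0 sm]
    have "good s" unfolding good_def
    proof (intro conjI allI impI)
      fix l h :: "real^3" assume lh: "\<forall>i. l $ i \<le> h $ i"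
      show "finite {v. \<Phi> v \<in> cbox l h}" by (rule finite_vimage[OF bc(1)])
      show "real (card {v. \<Phi> v \<in> cbox l h}) \<le> V * ((h $ 1 - l $ 1 + 2 * s) * (h $ 2 - l $ 2 + 2 * s) * (h $ 3 - l $ 3 + 2 * s))"
        using bc(2)[of l h] lh V_pos unfolding card_vimage by (simp add: pos_divide_le_eq mult.commute)
    next
      fix l h :: "real^3" assume lh: "\<forall>i. l $ i + 2 * s \<le> h $ i"
      show "V * ((h $ 1 - l $ 1 - 2 * s) * (h $ 2 - l $ 2 - 2 * s) * (h $ 3 - l $ 3 - 2 * s)) \<le> real (card {v. \<Phi> v \<in> box l h})"
        using bc(3)[of l h] lh V_pos unfolding card_vimage by (simp add: pos_le_divide_eq mult.commute)
    qed
    then show ?thesis ..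
  next
    case False
    define m where "m = norm v3"
    define e where "e = (if norm v1 < 1 / V then 1 / norm v1 else 0)"
    have m: "s / 3 < m" using False by (simp add: m_def)
    then have "2 / m < 2 / (s / 3)" using s by (intro divide_strict_left_mono) auto
    then have "2 / norm v3 < 6 / s" by (simp add: m_def)
    from dual_triple[OF B red this \<rho>] obtain \<nu> k h where n: "1 \<le> h" "gcd \<nu> (gcd k h) = 1" "near (p, x * p - y, x) (\<nu>,k,h)"
      "of_int h \<le> 2 / norm v3 / \<delta>" "\<bar>of_int \<nu> - p * of_int h\<bar> \<le> 2 / norm v3 / (r * Q)" by metis
    have n1: "(\<nu>,k,h) \<in> Near {(p, x * p - y, x)}" using n by (simp add: Near_def)
    have n2: "den (\<nu>,k,h) * m * \<delta> \<le> 2" using n(4) p \<delta> by (simp add: den_def m_def pos_le_divide_eq)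
    have n3: "\<bar>abscissa (\<nu>,k,h) - p\<bar> * den (\<nu>,k,h) * m * (r * Q) \<le> 2"
      unfolding abscissa_den[OF n(1)] using n(5) p r Q by (simp add: m_def pos_le_divide_eq mult_ac)
    have vex: "\<exists>v. e \<noteq> 0 \<longrightarrow> 1 \<le> e \<and> v \<in> Near {(x,y,p)} \<and> den v * e \<le> Q \<and> \<bar>abscissa v - x\<bar> * den v * e \<le> r * Q"
    proof (cases "norm v1 < 1 / V")
      case small: True
      from primal_triple[OF B red small V] obtain a b q where v: "1 \<le> q" "gcd a (gcd b q) = 1" "near (x,y,p) (a,b,q)"
        "of_int q \<le> norm v1 * Q" "\<bar>of_int a - x * of_int q\<bar> \<le> norm v1 * (r * Q)" by metis
      have "(a,b,q) \<in> Near {(x,y,p)}" using v by (simp add: Near_def)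
      moreover have "1 \<le> e"
      proof -
        have "norm v1 < 1" using small V by (smt (verit) divide_le_eq_1)
        then show ?thesis using p small by (simp add: e_def)
      qed
      moreover have "den (a,b,q) * e \<le> Q" using v(4) p small by (simp add: den_def e_def pos_divide_le_eq mult.commute)
      moreover have "\<bar>abscissa (a,b,q) - x\<bar> * den (a,b,q) * e \<le> r * Q"
        unfolding abscissa_den[OF v(1)] using v(5) p small by (simp add: e_def pos_divide_le_eq mult_ac)
      ultimately show ?thesis by blast
    qed (simp add: e_def)
    then obtain v where v: "e \<noteq> 0 \<longrightarrow> 1 \<le> e \<and> v \<in> Near {(x,y,p)} \<and> den v * e \<le> Q \<and> \<bar>abscissa v - x\<bar> * den v * e \<le> r * Q" by blast
    have e0: "0 \<le> e" by (simp add: e_def)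
    have ce: "card {v. norm (\<Phi> v) \<le> 4} = card {z \<in> range \<Phi>. norm z \<le> 4}"
      using card_vimage[of "{z. norm z \<le> 4}"] by simp
    have fe: "finite {v. norm (\<Phi> v) \<le> 4}"
      using finite_vimage[of "{z. norm z \<le> 4}"] lat_ball_card(1)[OF B V0, of 4] by simp
    have Vm: "1 \<le> 3 / s * (V * m)"
    proof -
      have "1 \<le> 3 / s * m" using m s by (simp add: field_simps)
      also have "\<dots> \<le> 3 / s * (V * m)" using V m s by (intro mult_left_mono) auto
      finally show ?thesis .
    qed
    have i1: "1 / norm v1 \<le> 3 / s * (V * m) + e"
    proof (cases "norm v1 < 1 / V")
      case True then show ?thesis using Vm by (simp add: e_def)
    next
      case False
      then have "1 / norm v1 \<le> V" using p V_pos by (simp add: field_simps)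
      also have "V * 1 \<le> V * (3 / s * m)" using m s V by (intro mult_left_mono) (auto simp: field_simps)
      finally show ?thesis using e0 by (simp add: mult_ac)
    qed
    have i12: "1 / (norm v1 * norm v2) \<le> V * m"
      using had p V_pos by (simp add: m_def field_simps)
    have i2: "1 / norm v2 \<le> 1 / norm v1" using p le by (intro divide_left_mono) auto
    have "real (card {v. norm (\<Phi> v) \<le> 4}) \<le> (4 * 4 / norm v1 + 1) * (4 * 4 / norm v2 + 1) * (4 * 4 / norm v3 + 1)"
      unfolding ce by (rule reduced_ball_card[OF B V0 _ red]) simp
    also have "(4 * 4 / norm v1 + 1) * (4 * 4 / norm v2 + 1) = 1 + 16 * (1 / norm v1) + 16 * (1 / norm v2) + 256 * (1 / (norm v1 * norm v2))"
      using p by (simp add: field_simps)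
    also have "\<dots> \<le> 3 / s * (V * m) + 32 * (3 / s * (V * m) + e) + 256 * (V * m)"
    proof -
      have "1 + 16 * x + 16 * y + 256 * z \<le> A + 32 * (A + e) + 256 * W"
        if "1 \<le> A" "x \<le> A + e" "y \<le> x" "z \<le> W" for A W x y z :: real
        using that by (simp add: algebra_simps)
      from this[OF Vm i1 i2 i12] show ?thesis .
    qed
    also have "\<dots> \<le> 3 / s * (V * m) + 32 * (3 / s * (V * m) + 1 / s * e) + 256 * (1 / s * (V * m))"
    proof -
      have "1 \<le> 1 / s" using s by simp
      then have "1 * e \<le> 1 / s * e" "1 * (V * m) \<le> 1 / s * (V * m)"
        using e0 V m s by (intro mult_right_mono; simp)+
      then show ?thesis unfolding distrib_left by linarith
    qed
    \<comment> \<open>355 = 3 + 32 * 3 + 256.\<close>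
    also have "\<dots> \<le> 355 / s * (V * m + e)"
      using s e0 by (simp add: field_simps)
    finally have c1: "real (card {v. norm (\<Phi> v) \<le> 4}) \<le> 355 / s * (V * m + e) * (4 * 4 / norm v3 + 1)"
      by (auto simp: mult_right_mono)
    also have "\<dots> \<le> 355 / s * (V * m + e) * (49 / s)"
    proof (rule mult_left_mono)
      have "16 / norm v3 \<le> 16 / (s / 3)" using m s p by (intro divide_left_mono) (auto simp: m_def)
      moreover have "16 / (s / 3) = 48 * (1 / s)" "49 / s = 49 * (1 / s)" "1 \<le> 1 / s" using s by simp_all
      ultimately show "4 * 4 / norm v3 + 1 \<le> 49 / s" by simp
      show "0 \<le> 355 / s * (V * m + e)" using s V m e0 by (intro mult_nonneg_nonneg add_nonneg_nonneg) auto
    qed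
    also have "\<dots> = 17395 / s\<^sup>2 * (V * m + e)" by (simp add: power2_eq_square)
    also have "\<dots> \<le> 20000 / s\<^sup>2 * (V * m + e)"
      using s V m e0 by (intro mult_right_mono divide_right_mono add_nonneg_nonneg) auto
    finally have "bad s m e (\<nu>,k,h) v" unfolding bad_def using m e0 fe n1 n2 n3 v by blast
    then show ?thesis by blast
  qed
qed

end

text \<open>Triples with a common factor are included, because the lattice count sees all of them;
  the factors are removed only at the end.\<close>

definition near_triples :: "(real \<Rightarrow> real) \<Rightarrow> real \<Rightarrow> real \<Rightarrow> real \<Rightarrow> real \<Rightarrow> (int \<times> int \<times> int) set" where
  "near_triples f \<eta> \<xi> Q \<delta> = {v. 1 \<le> den v \<and> den v \<le> Q \<and> \<eta> \<le> abscissa v \<and> abscissa v \<le> \<xi> \<and>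
     \<bar>f (abscissa v) - ordinate v\<bar> < \<delta> / Q}"

definition graph :: "real \<Rightarrow> real \<Rightarrow> (real \<Rightarrow> real) \<Rightarrow> (real \<Rightarrow> real) \<Rightarrow> (real \<times> real \<times> real) set" where
  "graph \<eta> \<xi> f F = (\<lambda>x. (x, f x, F x)) ` {\<eta>..\<xi>}"

lemma arc_map_alt:
  assumes "0 < den v"
  shows "arc_map Q r \<delta> s v = vector [den v / Q, (abscissa v - fst s) / r * (den v / Q),
    (ordinate v - tang s (abscissa v)) / \<delta> * den v]"
proof -
  obtain x y p where s: "s = (x,y,p)" by (cases s)
  obtain a b q where v: "v = (a,b,q)" by (cases v)
  have q: "0 < real_of_int q" using assms by (simp add: v den_def)
  have 1: "of_int a - x * of_int q = (abscissa v - x) * den v"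
    using q by (simp add: v abscissa_def den_def field_simps)
  have 2: "of_int b - y * of_int q - p * (of_int a - x * of_int q) = (ordinate v - tang s (abscissa v)) * den v"
    using q by (simp add: v abscissa_def ordinate_def den_def tang_def s field_simps)
  have 3: "of_int q = den v" by (simp add: v den_def)
  have "arc_map Q r \<delta> s v = vector [of_int q / Q, (of_int a - x * of_int q) / (r * Q),
     (of_int b - y * of_int q - p * (of_int a - x * of_int q)) / \<delta>]"
    by (simp add: arc_map_def s v)
  also have "\<dots> = vector [den v / Q, (abscissa v - x) * den v / (r * Q),
     (ordinate v - tang s (abscissa v)) * den v / \<delta>]"
    unfolding 2 unfolding 1 unfolding 3 ..
  finally show ?thesis by (simp add: s)
qed

lemma sum_squares: "(\<Sum>i=1..n. (real i)\<^sup>2) = real n * (real n + 1) * (2 * real n + 1) / 6"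
  by (induction n) (simp_all add: power2_eq_square field_simps)

section \<open>The subdivision of the curve into arcs\<close>

locale arcs =
  fixes c C \<eta> \<xi> Q \<delta> r :: real and f F :: "real \<Rightarrow> real" and J :: nat
  assumes S: "contact c C (\<xi> - \<eta>) (graph \<eta> \<xi> f F)" and c: "0 < c" "c \<le> 1" "1 \<le> C"
    and I: "\<eta> < \<xi>" and J: "1 \<le> J" and r_def: "r = (\<xi> - \<eta>) / (2 * real J)"
    and \<delta>: "0 < \<delta>" "\<delta> \<le> 1" and Cr: "C * r\<^sup>2 \<le> \<delta> / (200 * Q)"
    and Q: "48000 \<le> r * Q" "48000 \<le> Q" "48000\<^sup>2 \<le> \<delta> * Q"
    and V: "1 \<le> r * \<delta> * Q\<^sup>2" "\<delta> * Q \<le> (r * \<delta> * Q\<^sup>2)\<^sup>2"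
begin

definition xj where "xj j = \<eta> + (2 * real j + 1) * r"
text \<open>The fineness required of a good lattice: \<open>2 * s0\<close> is one percent of the
  slice width 1 / 40 used below. The number 48000 in the locale assumptions is
  \<open>6 / s0\<close>.\<close>

definition s0 :: real where "s0 = 1 / 8000"

lemma r: "0 < r" using I J by (simp add: r_def)

lemma xj_bounds: assumes "j < J" shows "\<eta> + r \<le> xj j" "xj j + r \<le> \<xi>"
proof -
  show "\<eta> + r \<le> xj j" using r by (simp add: xj_def distrib_right)
  have "xj j + r = \<eta> + 2 * (real j + 1) * r" by (simp add: xj_def algebra_simps)
  also have "\<dots> \<le> \<eta> + 2 * real J * r" using assms r by simp
  also have "\<dots> = \<xi>" using J by (simp add: r_def)
  finally show "xj j + r \<le> \<xi>" .
qed

definition sj where "sj j = (xj j, f (xj j), F (xj j))"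

lemma sj_mem: "j < J \<Longrightarrow> sj j \<in> graph \<eta> \<xi> f F"
  using xj_bounds[of j] r by (auto simp: sj_def graph_def)

lemma arc_axioms': "arc Q r \<delta>"
  using Q \<delta> r by unfold_locales auto

text \<open>By \<open>Cr\<close> the arc is so short that replacing the curve by its tangent changes
  the tolerance \<delta> / Q by one part in 200 at most; this is the origin of the factors 201 / 200
  and 199 / 200.\<close>

lemma arc_near_tangent:
  assumes j: "j < J" and z: "\<bar>z - xj j\<bar> \<le> r"
  shows "z \<in> {\<eta>..\<xi>}" "\<bar>f z - tang (sj j) z\<bar> \<le> \<delta> / (200 * Q)"
proof -
  show z1: "z \<in> {\<eta>..\<xi>}" using xj_bounds[OF j] z by auto
  have m: "(xj j, f (xj j), F (xj j)) \<in> graph \<eta> \<xi> f F" "(z, f z, F z) \<in> graph \<eta> \<xi> f F"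
    using sj_mem[OF j] z1 by (auto simp: sj_def graph_def)
  note h = contactD(4,5)[OF S m]
  have e: "f z - tang (sj j) z = f z - f (xj j) - F (xj j) * (z - xj j)" by (simp add: tang_def sj_def)
  have "C * (z - xj j)\<^sup>2 \<le> C * r\<^sup>2"
    using c z abs_le_square_iff[of "z - xj j" r] r by (intro mult_left_mono) auto
  moreover have "0 \<le> c * (z - xj j)\<^sup>2" using c by simp
  ultimately show "\<bar>f z - tang (sj j) z\<bar> \<le> \<delta> / (200 * Q)" using h Cr unfolding e by linarith
qed

lemma ex_arc: assumes "z \<in> {\<eta>..\<xi>}" shows "\<exists>j<J. \<bar>z - xj j\<bar> \<le> r"
proof (cases "z = \<xi>")
  \<comment> \<open>The floor used in the other case would assign the index \<open>J\<close> to the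
    right endpoint; it belongs to the last arc.\<close>
  case True
  have "xj (J - 1) = \<eta> + (2 * real J - 1) * r" using J by (simp add: xj_def of_nat_diff)
  also have "\<dots> = \<eta> + 2 * real J * r - r" by (simp add: left_diff_distrib)
  also have "2 * real J * r = \<xi> - \<eta>" using J by (simp add: r_def)
  finally have "xj (J - 1) = \<xi> - r" by simp
  then show ?thesis using J r True by (intro exI[of _ "J - 1"]) auto
next
  case False
  define t where "t = (z - \<eta>) / (2 * r)"
  have t: "0 \<le> t" "t < real J" using assms False r J I by (auto simp: t_def r_def field_simps)
  define j where "j = nat \<lfloor>t\<rfloor>"
  have j: "real j \<le> t" "t < real j + 1" using t by (simp_all add: j_def)
  then have jJ: "j < J" using t by linarith
  have "2 * t * r = z - \<eta>" using r by (simp add: t_def)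
  then have z: "z = \<eta> + 2 * t * r" by simp
  have "z - xj j = (2 * (t - real j) - 1) * r" by (simp add: z xj_def algebra_simps)
  then have "\<bar>z - xj j\<bar> = \<bar>2 * (t - real j) - 1\<bar> * r" using r by (simp add: abs_mult)
  also have "\<dots> \<le> 1 * r" using j r by (intro mult_right_mono) auto
  finally show ?thesis using jJ by auto
qed

abbreviation NT where "NT \<equiv> near_triples f \<eta> \<xi> Q \<delta>"
abbreviation \<Phi> where "\<Phi> j \<equiv> arc_map Q r \<delta> (sj j)"

text \<open>Closed arcs, which cover the interval, serve the upper bound; the open arcs of
  \<open>A'\<close>, which are disjoint, serve the lower bound.\<close>

definition A where "A j = {v \<in> NT. \<bar>abscissa v - xj j\<bar> \<le> r}"
definition A' where "A' j = {v \<in> NT. \<bar>abscissa v - xj j\<bar> < r}"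

lemma NT_UN: "NT = (\<Union>j<J. A j)"
  using ex_arc by (auto simp: A_def near_triples_def)

lemma A_coords:
  assumes j: "j < J" and v: "v \<in> A j"
  shows "0 < \<Phi> j v $ 1" "\<Phi> j v $ 1 \<le> 1" "\<bar>\<Phi> j v $ 2\<bar> \<le> \<Phi> j v $ 1" "\<bar>\<Phi> j v $ 3\<bar> \<le> (201/200) * \<Phi> j v $ 1"
proof -
  have dv: "1 \<le> den v" "den v \<le> Q" "\<bar>f (abscissa v) - ordinate v\<bar> < \<delta> / Q" "\<bar>abscissa v - xj j\<bar> \<le> r"
    using v by (auto simp: A_def near_triples_def)
  have Q0: "0 < Q" using Q by simp
  have e: "\<Phi> j v $ 1 = den v / Q" "\<Phi> j v $ 2 = (abscissa v - xj j) / r * (den v / Q)"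
    "\<Phi> j v $ 3 = (ordinate v - tang (sj j) (abscissa v)) / \<delta> * den v"
    using dv by (simp_all add: arc_map_alt) (simp add: sj_def)
  show 1: "0 < \<Phi> j v $ 1" "\<Phi> j v $ 1 \<le> 1" using dv Q0 by (auto simp: e)
  have "\<bar>(abscissa v - xj j) / r\<bar> \<le> 1" using dv r by (simp add: abs_divide)
  then show "\<bar>\<Phi> j v $ 2\<bar> \<le> \<Phi> j v $ 1" unfolding e abs_mult using dv Q0
      mult_right_mono[of "\<bar>(abscissa v - xj j) / r\<bar>" 1 "den v / Q"] by simp
  have "\<bar>ordinate v - tang (sj j) (abscissa v)\<bar> \<le> \<delta> / Q + \<delta> / (200 * Q)"
    using dv(3) arc_near_tangent(2)[OF j dv(4)] by linarith
  also have "\<dots> = (201/200) * (\<delta> / Q)" by simp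
  finally have "\<bar>ordinate v - tang (sj j) (abscissa v)\<bar> / \<delta> * den v \<le> (201/200) * (\<delta> / Q) / \<delta> * den v"
    using \<delta> dv by (intro mult_right_mono divide_right_mono) auto
  then show "\<bar>\<Phi> j v $ 3\<bar> \<le> (201/200) * \<Phi> j v $ 1" unfolding e using \<delta> dv by (simp add: abs_mult)
qed

text \<open>The pyramid is sliced along its first axis. The circumscribed boxes take the cross
  section at the wider end of a slice, the inscribed boxes \<open>inner_lo\<close>,
  \<open>inner_hi\<close> that at the narrower end; the scaling of the third coordinate allows for
  the distance between curve and tangent.\<close>

definition slice_lo :: "real \<Rightarrow> nat \<Rightarrow> real^3" where
  "slice_lo \<kappa> i = vector [(real i - 1) / 40, - (real i / 40), - (\<kappa> * (real i / 40))]"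
definition slice_hi :: "real \<Rightarrow> nat \<Rightarrow> real^3" where
  "slice_hi \<kappa> i = vector [real i / 40, real i / 40, \<kappa> * (real i / 40)]"
definition inner_lo :: "nat \<Rightarrow> real^3" where
  "inner_lo i = vector [real i / 40, - (real i / 40), - ((199/200) * (real i / 40))]"
definition inner_hi :: "nat \<Rightarrow> real^3" where
  "inner_hi i = vector [(real i + 1) / 40, real i / 40, (199/200) * (real i / 40)]"

lemma A_in_slices:
  assumes j: "j < J" and v: "v \<in> A j"
  shows "\<exists>i\<in>{1..40}. \<Phi> j v \<in> cbox (slice_lo (201/200) i) (slice_hi (201/200) i)"
proof -
  note h = A_coords[OF j v]
  define Z where "Z = \<Phi> j v $ 1"
  define i where "i = nat \<lceil>40 * Z\<rceil>"
  have Z: "0 < Z" "Z \<le> 1" using h by (auto simp: Z_def)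
  have i: "real i - 1 < 40 * Z" "40 * Z \<le> real i" using Z unfolding i_def by (simp_all add: of_nat_nat) linarith+
  have "real i < 41" using i(1) Z(2) by linarith
  then have i1: "i \<in> {1..40}" using i(2) Z(1) by (cases i) auto
  have b: "\<bar>\<Phi> j v $ 2\<bar> \<le> real i / 40" "\<bar>\<Phi> j v $ 3\<bar> \<le> (201/200) * (real i / 40)"
    using h(3,4) i(2) unfolding Z_def[symmetric] by linarith+
  have "- (real i / 40) \<le> \<Phi> j v $ 2" "\<Phi> j v $ 2 \<le> real i / 40"
    "- ((201/200) * (real i / 40)) \<le> \<Phi> j v $ 3" "\<Phi> j v $ 3 \<le> (201/200) * (real i / 40)"
    using b by linarith+
  moreover have "(real i - 1) / 40 \<le> Z" "Z \<le> real i / 40" using i by simp_all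
  ultimately have "\<Phi> j v \<in> cbox (slice_lo (201/200) i) (slice_hi (201/200) i)"
    unfolding mem_box_cart forall_3 slice_lo_def slice_hi_def vector_3 Z_def[symmetric] by blast
  then show ?thesis using i1 by blast
qed

lemma A_subset_ball: assumes j: "j < J" and v: "v \<in> A j" shows "norm (\<Phi> j v) \<le> 4"
proof -
  have "norm (\<Phi> j v) \<le> (\<Sum>i\<in>UNIV. \<bar>\<Phi> j v $ i\<bar>)" by (rule norm_le_l1_cart)
  also have "\<dots> = \<bar>\<Phi> j v $ 1\<bar> + \<bar>\<Phi> j v $ 2\<bar> + \<bar>\<Phi> j v $ 3\<bar>" by (simp add: sum_3)
  also have "\<dots> \<le> 4" using A_coords[OF j v] by linarith
  finally show ?thesis .
qed

definition good where "good j \<longleftrightarrow> arc.good Q r \<delta> (xj j) (f (xj j)) (F (xj j)) s0"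
definition bad where "bad j = arc.bad Q r \<delta> (xj j) (f (xj j)) (F (xj j)) s0"
definition VV where "VV = r * \<delta> * Q\<^sup>2"

lemma VV: "arc.V Q r \<delta> = VV"
  by (simp add: arc.V_def[OF arc_axioms'] VV_def)

lemma VV_pos: "0 < VV" using V by (simp add: VV_def)

lemma good_or_bad: "good j \<or> (\<exists>m e n v. bad j m e n v)"
  unfolding good_def bad_def
  by (rule arc.good_or_bad[OF arc_axioms'])
    (use V Q \<delta> in \<open>auto simp: s0_def VV VV_def field_simps intro: order_trans[OF _ Q(3)]\<close>)

text \<open>Forty circumscribed boxes, enlarged by \<open>s0\<close> on all sides, have total volume
  below 1.4187, compared with 4 / 3 for the pyramid.\<close>

lemma good_upper:
  assumes j: "j < J" and g: "good j"
  shows "finite (A j)" "real (card (A j)) \<le> VV * 1.4187"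
proof -
  define B where "B i = {v. \<Phi> j v \<in> cbox (slice_lo (201/200) i) (slice_hi (201/200) i)}" for i
  have gd: "finite {v. \<Phi> j v \<in> cbox l h}"
      "real (card {v. \<Phi> j v \<in> cbox l h}) \<le> VV * ((h $ 1 - l $ 1 + 2 * s0) * (h $ 2 - l $ 2 + 2 * s0) * (h $ 3 - l $ 3 + 2 * s0))"
    if "\<forall>i. l $ i \<le> h $ i" for l h
    using g that unfolding good_def arc.good_def[OF arc_axioms'] VV sj_def by blast+
  have le: "\<forall>k. slice_lo (201/200) i $ k \<le> slice_hi (201/200) i $ k" for i
    by (simp add: forall_3 slice_lo_def slice_hi_def vector_3)
  have fB: "finite (B i)" for i unfolding B_def by (rule gd(1)[OF le])
  have cB: "real (card (B i)) \<le> VV * ((real i)\<^sup>2 * (4 * 1.0252005 / 64000))" if i: "i \<in> {1..40}" for i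
  proof -
    define t where "t = real i / 40"
    have t: "1/40 \<le> t" using i by (simp add: t_def)
    have "real (card (B i)) \<le> VV * ((1/40 + 2 * s0) * (2 * t + 2 * s0) * (2 * ((201/200) * t) + 2 * s0))"
      using gd(2)[OF le, of i] unfolding B_def by (simp add: slice_lo_def slice_hi_def vector_3 t_def diff_divide_distrib)
    \<comment> \<open>Since \<open>t\<close> is at least 1 / 40, adding
      \<open>2 * s0 = 0.01 / 40\<close> enlarges a width \<open>2 * t\<close> by half a percent at
      most.\<close>
    also have "\<dots> \<le> VV * ((1.01/40) * (2 * t * 1.005) * (2 * t * 1.01))"
      using VV_pos t unfolding s0_def by (intro mult_left_mono mult_mono) auto
    also have "\<dots> = VV * ((real i)\<^sup>2 * (4 * (1.01 * 1.005 * 1.01) / 64000))" by (simp add: t_def power2_eq_square)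
    also have "\<dots> \<le> VV * ((real i)\<^sup>2 * (4 * 1.0252005 / 64000))"
      using VV_pos by (intro mult_left_mono) auto
    finally show ?thesis .
  qed
  have sub: "A j \<subseteq> (\<Union>i\<in>{1..40}. B i)" using A_in_slices[OF j] by (auto simp: B_def)
  show fA: "finite (A j)" by (rule finite_subset[OF sub]) (use fB in auto)
  have "card (A j) \<le> card (\<Union>i\<in>{1..40}. B i)" using sub fB by (intro card_mono) auto
  also have "\<dots> \<le> (\<Sum>i\<in>{1..40}. card (B i))" by (rule card_UN_le) simp
  finally have "real (card (A j)) \<le> (\<Sum>i\<in>{1..40}. real (card (B i)))" by (simp flip: of_nat_sum)
  also have "\<dots> \<le> (\<Sum>i\<in>{1..40}. VV * ((real i)\<^sup>2 * (4 * 1.0252005 / 64000)))" by (rule sum_mono[OF cB])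
  also have "\<dots> = VV * ((\<Sum>i\<in>{1..40}. (real i)\<^sup>2) * (4 * 1.0252005 / 64000))"
    by (simp only: sum_distrib_left sum_distrib_right)
  also have "\<dots> \<le> VV * 1.4187" unfolding sum_squares using VV_pos by (intro mult_left_mono) auto
  finally show "real (card (A j)) \<le> VV * 1.4187" .
qed

text \<open>Thirty-nine inscribed boxes, shrunk by \<open>s0\<close>, still have total volume above
  1.2519; the slice at the apex has no inscribed box of positive volume.\<close>

lemma good_lower:
  assumes j: "j < J" and g: "good j"
  shows "VV * 1.2519 \<le> real (card (A' j))"
proof -
  define B where "B i = {v. \<Phi> j v \<in> box (inner_lo i) (inner_hi i)}" for i
  have gd: "VV * ((h $ 1 - l $ 1 - 2 * s0) * (h $ 2 - l $ 2 - 2 * s0) * (h $ 3 - l $ 3 - 2 * s0)) \<le> real (card {v. \<Phi> j v \<in> box l h})"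
    if "\<forall>i. l $ i + 2 * s0 \<le> h $ i" for l h
    using g that unfolding good_def arc.good_def[OF arc_axioms'] VV sj_def by blast
  have cB: "VV * ((real i)\<^sup>2 * (4 * 0.97519 / 64000)) \<le> real (card (B i))" if i: "i \<in> {1..39}" for i
  proof -
    define t where "t = real i / 40"
    have t: "1/40 \<le> t" using i by (simp add: t_def)
    have "\<forall>k. inner_lo i $ k + 2 * s0 \<le> inner_hi i $ k"
      using i by (simp add: forall_3 inner_lo_def inner_hi_def vector_3 s0_def field_simps)
    from gd[OF this] have "VV * ((1/40 - 2 * s0) * (2 * t - 2 * s0) * (2 * ((199/200) * t) - 2 * s0)) \<le> real (card (B i))"
      unfolding B_def by (simp add: inner_lo_def inner_hi_def vector_3 t_def add_divide_distrib)
    moreover have "VV * ((0.99/40) * (2 * t * 0.995) * (2 * t * 0.99)) \<le> VV * ((1/40 - 2 * s0) * (2 * t - 2 * s0) * (2 * ((199/200) * t) - 2 * s0))"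
      using VV_pos t unfolding s0_def by (intro mult_left_mono mult_mono) auto
    moreover have "VV * ((real i)\<^sup>2 * (4 * 0.97519 / 64000)) \<le> VV * ((real i)\<^sup>2 * (4 * (0.99 * 0.995 * 0.99) / 64000))"
      using VV_pos by (intro mult_left_mono) auto
    moreover have "VV * ((real i)\<^sup>2 * (4 * (0.99 * 0.995 * 0.99) / 64000)) = VV * ((0.99/40) * (2 * t * 0.995) * (2 * t * 0.99))"
      by (simp add: t_def power2_eq_square)
    ultimately show ?thesis by linarith
  qed
  have Q0: "0 < Q" using Q by simp
  have sub: "B i \<subseteq> A' j" if i: "i \<in> {1..39}" for i
  proof
    fix v assume "v \<in> B i"
    then have b: "real i / 40 < \<Phi> j v $ 1" "\<Phi> j v $ 1 < (real i + 1) / 40" "\<bar>\<Phi> j v $ 2\<bar> < real i / 40"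
       "\<bar>\<Phi> j v $ 3\<bar> < (199/200) * (real i / 40)"
      unfolding B_def mem_Collect_eq mem_box_cart forall_3 inner_lo_def inner_hi_def vector_3 by (auto simp: abs_less_iff)
    have "\<Phi> j v $ 1 = den v / Q" by (cases v) (simp add: arc_map_def sj_def den_def)
    moreover have "0 \<le> real i / 40" by simp
    ultimately have "0 < den v / Q" using b(1) by linarith
    then have "0 < den v" using Q0 by (simp add: zero_less_divide_iff)
    then have d1: "1 \<le> den v" by (simp add: den_def)
    have e: "\<Phi> j v $ 1 = den v / Q" "\<Phi> j v $ 2 = (abscissa v - xj j) / r * (den v / Q)"
      "\<Phi> j v $ 3 = (ordinate v - tang (sj j) (abscissa v)) / \<delta> * den v"
      using d1 by (simp_all add: arc_map_alt) (simp add: sj_def)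
    have i40: "(real i + 1) / 40 \<le> 1" using i by simp
    then have "den v / Q < 1" using b(2) e(1) by linarith
    then have d2: "den v \<le> Q" using Q0 by (simp add: divide_less_eq)
    have dQ: "0 < den v / Q" using d1 Q0 by simp
    have "\<bar>(abscissa v - xj j) / r\<bar> * (den v / Q) < 1 * (den v / Q)"
      using b(1,3) dQ unfolding e abs_mult by linarith
    then have "\<bar>(abscissa v - xj j) / r\<bar> < 1" using dQ by (simp only: mult_less_cancel_right_pos)
    then have z: "\<bar>abscissa v - xj j\<bar> < r" using r by (simp add: abs_divide)
    have "\<bar>ordinate v - tang (sj j) (abscissa v)\<bar> / \<delta> * den v < (199/200) * (den v / Q)"
    proof -
      have "\<bar>\<Phi> j v $ 3\<bar> = \<bar>ordinate v - tang (sj j) (abscissa v)\<bar> / \<delta> * den v"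
        unfolding e using \<delta> d1 by (simp add: abs_mult)
      then show ?thesis using b(1,4) unfolding e(1) by linarith
    qed
    then have "\<bar>ordinate v - tang (sj j) (abscissa v)\<bar> < (199/200) * (\<delta> / Q)"
      using \<delta> d1 Q0 by (simp add: field_simps)
    moreover have "\<bar>f (abscissa v) - tang (sj j) (abscissa v)\<bar> \<le> \<delta> / (200 * Q)" "abscissa v \<in> {\<eta>..\<xi>}"
      using arc_near_tangent[OF j, of "abscissa v"] z by auto
    moreover have "(199/200) * (\<delta> / Q) + \<delta> / (200 * Q) = \<delta> / Q" by simp
    ultimately have "\<bar>f (abscissa v) - ordinate v\<bar> < \<delta> / Q" by linarith
    then show "v \<in> A' j" using d1 d2 z \<open>abscissa v \<in> {\<eta>..\<xi>}\<close> by (auto simp: A'_def near_triples_def)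
  qed
  have fA: "finite (A' j)" by (rule finite_subset[OF _ good_upper(1)[OF j g]]) (auto simp: A_def A'_def)
  have disj: "B i \<inter> B k = {}" if "i \<noteq> k" for i k
  proof (rule ccontr)
    assume "B i \<inter> B k \<noteq> {}"
    then obtain v where v: "v \<in> B i" "v \<in> B k" by auto
    have ik: "real i / 40 < \<Phi> j v $ 1" "\<Phi> j v $ 1 < (real i + 1) / 40" "real k / 40 < \<Phi> j v $ 1" "\<Phi> j v $ 1 < (real k + 1) / 40"
      using v unfolding B_def mem_Collect_eq mem_box_cart forall_3 inner_lo_def inner_hi_def vector_3 by auto
    have "real i / 40 < (real k + 1) / 40" "real k / 40 < (real i + 1) / 40" 
      using less_trans[OF ik(1,4)] less_trans[OF ik(3,2)] by blast+
    then have "real i < real k + 1" "real k < real i + 1" by simp_all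
    then show False using that by linarith
  qed
  have fB: "finite (B i)" if "i \<in> {1..39}" for i using sub[OF that] fA finite_subset by blast
  have "VV * 1.2519 \<le> VV * ((\<Sum>i\<in>{1..39}. (real i)\<^sup>2) * (4 * 0.97519 / 64000))"
    unfolding sum_squares using VV_pos by (intro mult_left_mono) auto
  also have "\<dots> = (\<Sum>i\<in>{1..39}. VV * ((real i)\<^sup>2 * (4 * 0.97519 / 64000)))"
    by (simp only: sum_distrib_left sum_distrib_right)
  also have "\<dots> \<le> (\<Sum>i\<in>{1..39}. real (card (B i)))" by (rule sum_mono[OF cB])
  also have "\<dots> = real (card (\<Union>i\<in>{1..39}. B i))"
    using card_UN_disjoint[of "{1..39}" B] fB disj by simp
  also have "\<dots> \<le> real (card (A' j))" using sub fA by (intro of_nat_mono card_mono) blast+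
  finally show ?thesis .
qed

end

section \<open>Summation over good and bad arcs\<close>

lemma Near_mono: "S \<subseteq> S' \<Longrightarrow> Near S \<subseteq> Near S'"
  by (auto simp: Near_def)

context arcs
begin

lemma JVV: "real J * VV = (\<xi> - \<eta>) * \<delta> * Q\<^sup>2 / 2"
proof -
  have h: "\<xi> - \<eta> = 2 * real J * r" using J by (simp add: r_def)
  show ?thesis unfolding VV_def h by simp
qed

text \<open>\<open>\<sigma>1\<close> and \<open>\<sigma>2\<close> are the sums of \<open>m\<close>
  and \<open>e\<close> over the bad arcs. As \<open>m\<close> exceeds
  \<open>s0 / 3 = 1 / 24000\<close>, the first also bounds the number of bad arcs. Both come from
  \<open>sum_over_samples\<close>: once with the slopes at the midpoints and the dual curve, once
  with the midpoints and the curve itself.\<close>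

lemma card_bounds:
  assumes lam: "0 < lam" "lam * \<delta> / Q \<le> r\<^sup>2"
  shows "\<exists>\<sigma>1 \<sigma>2. 0 \<le> \<sigma>1 \<and> 0 \<le> \<sigma>2 \<and> finite NT \<and>
    real (card NT) \<le> 0.70935 * ((\<xi> - \<eta>) * \<delta> * Q\<^sup>2) + 20000 / s0\<^sup>2 * (VV * \<sigma>1 + \<sigma>2) \<and>
    VV * 1.2519 * (real J - 24000 * \<sigma>1) \<le> real (card NT) \<and>
    \<sigma>1 \<le> 2 / \<delta> * (weight (dual (graph \<eta> \<xi> f F)) (48000 / \<delta>) * (1 + 2 / (c * lam) * (1 + ln (real J)))) \<and>
    \<sigma>2 \<le> Q * (weight (graph \<eta> \<xi> f F) Q * (1 + 2 * (1 + ln (real J))))"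
proof -
  define S' where "S' = graph \<eta> \<xi> f F"
  have S': "contact c C (\<xi> - \<eta>) S'" using S by (simp add: S'_def)
  define Gd where "Gd = {j\<in>{..<J}. good j}"
  define Bd where "Bd = {j\<in>{..<J}. \<not> good j}"
  have fGB: "finite Gd" "finite Bd" "Gd \<union> Bd = {..<J}" "Gd \<inter> Bd = {}" by (auto simp: Gd_def Bd_def)
  have "\<forall>j\<in>Bd. \<exists>m e n v. bad j m e n v" using good_or_bad unfolding Bd_def by blast
  then obtain m e n v where b: "\<And>j. j \<in> Bd \<Longrightarrow> bad j (m j) (e j) (n j) (v j)" by metis
  have Q0: "0 < Q" using Q by simp
  have m: "s0 / 3 < m j" and e0: "0 \<le> e j" and fb: "finite {v. norm (\<Phi> j v) \<le> 4}"
    and cb: "real (card {v. norm (\<Phi> j v) \<le> 4}) \<le> 20000 / s0\<^sup>2 * (VV * m j + e j)"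
    and n: "n j \<in> Near {(F (xj j), xj j * F (xj j) - f (xj j), xj j)}" "den (n j) * m j * \<delta> \<le> 2"
      "\<bar>abscissa (n j) - F (xj j)\<bar> * den (n j) * m j * (r * Q) \<le> 2"
    and v: "e j \<noteq> 0 \<Longrightarrow> 1 \<le> e j \<and> v j \<in> Near {sj j} \<and> den (v j) * e j \<le> Q \<and> \<bar>abscissa (v j) - xj j\<bar> * den (v j) * e j \<le> r * Q"
    if "j \<in> Bd" for j
    using b[OF that] unfolding bad_def arc.bad_def[OF arc_axioms'] VV sj_def by blast+
  define \<sigma>1 where "\<sigma>1 = (\<Sum>j\<in>Bd. m j)"
  define \<sigma>2 where "\<sigma>2 = (\<Sum>j\<in>Bd. e j)"
  have mp: "0 < m j" if "j \<in> Bd" for j using m[OF that] by (simp add: s0_def)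
  have p1: "0 \<le> \<sigma>1" unfolding \<sigma>1_def using mp by (intro sum_nonneg) (auto intro: less_imp_le)
  have p2: "0 \<le> \<sigma>2" unfolding \<sigma>2_def using e0 by (intro sum_nonneg) auto
  have Abad: "finite (A j) \<and> real (card (A j)) \<le> 20000 / s0\<^sup>2 * (VV * m j + e j)" if j: "j \<in> Bd" for j
  proof -
    have jJ: "j < J" using j by (simp add: Bd_def)
    have sub: "A j \<subseteq> {v. norm (\<Phi> j v) \<le> 4}" using A_subset_ball[OF jJ] by auto
    show ?thesis using finite_subset[OF sub fb[OF j]] card_mono[OF fb[OF j] sub] cb[OF j] by linarith
  qed
  have Agood: "finite (A j) \<and> real (card (A j)) \<le> VV * 1.4187" if "j \<in> Gd" for j
    using good_upper[of j] that by (auto simp: Gd_def)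
  have fA: "finite (A j)" if "j < J" for j using Abad Agood that fGB by blast
  have fNT: "finite NT" unfolding NT_UN using fA by auto
  have upper: "real (card NT) \<le> 0.70935 * ((\<xi> - \<eta>) * \<delta> * Q\<^sup>2) + 20000 / s0\<^sup>2 * (VV * \<sigma>1 + \<sigma>2)"
  proof -
    have "card NT \<le> (\<Sum>j<J. card (A j))" unfolding NT_UN by (rule card_UN_le) simp
    then have "real (card NT) \<le> (\<Sum>j<J. real (card (A j)))" by (simp flip: of_nat_sum)
    also have "\<dots> = (\<Sum>j\<in>Gd. real (card (A j))) + (\<Sum>j\<in>Bd. real (card (A j)))"
      using fGB by (metis sum.union_disjoint)
    also have "\<dots> \<le> (\<Sum>j\<in>Gd. VV * 1.4187) + (\<Sum>j\<in>Bd. 20000 / s0\<^sup>2 * (VV * m j + e j))"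
      using Abad Agood by (intro add_mono sum_mono) auto
    also have "(\<Sum>j\<in>Bd. 20000 / s0\<^sup>2 * (VV * m j + e j)) = 20000 / s0\<^sup>2 * (VV * \<sigma>1 + \<sigma>2)"
      by (simp only: \<sigma>1_def \<sigma>2_def sum_distrib_left sum.distrib[symmetric])
    also have "(\<Sum>j\<in>Gd. VV * 1.4187) \<le> real J * (VV * 1.4187)"
    proof -
      have "card Gd \<le> card {..<J}" by (intro card_mono) (auto simp: Gd_def)
      then show ?thesis using VV_pos by (simp add: mult_right_mono)
    qed
    also have "real J * (VV * 1.4187) = (real J * VV) * 1.4187" by simp
    also have "\<dots> = 0.70935 * ((\<xi> - \<eta>) * \<delta> * Q\<^sup>2)" unfolding JVV by simp
    finally show ?thesis by simp
  qed
  have cBd: "real (card Bd) \<le> 24000 * \<sigma>1"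
  proof -
    have "real (card Bd) = (\<Sum>j\<in>Bd. 1)" by simp
    also have "\<dots> \<le> (\<Sum>j\<in>Bd. 24000 * m j)" 
    proof (intro sum_mono)
      fix j assume "j \<in> Bd"
      from m[OF this] show "1 \<le> 24000 * m j" by (simp add: s0_def)
    qed
    also have "\<dots> = 24000 * \<sigma>1" by (simp add: \<sigma>1_def sum_distrib_left)
    finally show ?thesis .
  qed
  have lower: "VV * 1.2519 * (real J - 24000 * \<sigma>1) \<le> real (card NT)"
  proof -
    have "card Gd + card Bd = J" using card_Un_disjoint[OF fGB(1,2,4)] fGB(3) by simp
    then have "real J - 24000 * \<sigma>1 \<le> real (card Gd)" using cBd by linarith
    then have "VV * 1.2519 * (real J - 24000 * \<sigma>1) \<le> VV * 1.2519 * real (card Gd)"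
      using VV_pos by (intro mult_left_mono) auto
    also have "\<dots> = (\<Sum>j\<in>Gd. VV * 1.2519)" by simp
    also have "\<dots> \<le> (\<Sum>j\<in>Gd. real (card (A' j)))"
      using good_lower by (intro sum_mono) (auto simp: Gd_def)
    also have "\<dots> = real (card (\<Union>j\<in>Gd. A' j))"
    proof -
      have fA': "finite (A' j)" if "j \<in> Gd" for j
        by (rule finite_subset[of _ "A j"]) (use Agood[OF that] in \<open>auto simp: A_def A'_def\<close>)
      have disj: "A' i \<inter> A' j = {}" if "i \<noteq> j" for i j
      proof (rule ccontr)
        assume "A' i \<inter> A' j \<noteq> {}"
        then obtain w where "\<bar>abscissa w - xj i\<bar> < r" "\<bar>abscissa w - xj j\<bar> < r" by (auto simp: A'_def)
        then have "\<bar>xj i - xj j\<bar> < 2 * r" by linarith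
        moreover have "xj i - xj j = (real i - real j) * (2 * r)" by (simp add: xj_def algebra_simps)
        ultimately have "\<bar>real i - real j\<bar> * (2 * r) < 1 * (2 * r)" using r by (simp add: abs_mult)
        then have "\<bar>real i - real j\<bar> < 1" using r by (simp only: mult_less_cancel_right_pos)
        then show False using that by linarith
      qed
      show ?thesis using card_UN_disjoint[OF fGB(1), of A'] fA' disj by simp
    qed
    also have "\<dots> \<le> real (card NT)"
      using fNT by (intro of_nat_mono card_mono) (auto simp: A'_def)
    finally show ?thesis .
  qed
  have sepx: "\<bar>xj i - xj j\<bar> = 2 * r * \<bar>real i - real j\<bar>" for i j
  proof -
    have "xj i - xj j = 2 * r * (real i - real j)" by (simp add: xj_def algebra_simps)
    then show ?thesis using r by (simp add: abs_mult)
  qed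
  have cd: "contact (c / C\<^sup>2) (C / c\<^sup>2) (C * (\<xi> - \<eta>)) (dual S')" by (rule contact_dual[OF S' c])
  have c2: "c\<^sup>2 \<le> C" using c by (smt (verit) power_le_one)
  have fdual: "finite (Near_upto (dual S') (48000 / \<delta>))"
    by (rule Near_upto_finite[OF cd]) (use c c2 I in \<open>auto simp: le_divide_eq\<close>)
  have fprim: "finite (Near_upto S' Q)"
    by (rule Near_upto_finite[OF S']) (use c I in auto)
  have H: "0 \<le> 1 + ln (real J)" using J by simp
  have s1: "\<sigma>1 \<le> 2 / \<delta> * (weight (dual S') (48000 / \<delta>) * (1 + 2 / (c * lam) * (1 + ln (real J))))"
  proof -
    have mem: "n j \<in> Near_upto (dual S') (48000 / \<delta>)" if j: "j \<in> Bd" for j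
    proof -
      have "(F (xj j), xj j * F (xj j) - f (xj j), xj j) \<in> dual S'"
        using sj_mem[of j] j unfolding dual_def S'_def sj_def Bd_def by force
      then have "n j \<in> Near (dual S')" using n(1)[OF j] Near_mono[of "{(F (xj j), xj j * F (xj j) - f (xj j), xj j)}" "dual S'"] by blast
      moreover have "den (n j) \<le> 48000 / \<delta>"
      proof -
        have d: "1 \<le> den (n j)" by (rule den_ge_1[OF n(1)[OF j]])
        have "den (n j) * (s0 / 3) * \<delta> \<le> den (n j) * m j * \<delta>"
          using m[OF j] d \<delta> by (intro mult_right_mono mult_left_mono) auto
        then have "den (n j) * (s0 / 3) * \<delta> \<le> 2" using n(2)[OF j] by linarith
        then show ?thesis using \<delta> by (simp add: s0_def field_simps)
      qed
      ultimately show ?thesis by (simp add: Near_upto_def)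
    qed
    \<comment> \<open>The weights \<open>m j * \<delta> / 2\<close> are at most
      \<open>1 / den (n j)\<close> by the definition of \<open>bad\<close>. The samples are slopes,
      which the curvature keeps \<open>2 * c * r\<close> apart.\<close>
    have "(\<Sum>j\<in>Bd. m j * \<delta> / 2) \<le> (\<Sum>v\<in>Near_upto (dual S') (48000 / \<delta>). 1 / den v) *
        (1 + 4 * ((\<delta> / (r * Q)) / (2 * c * r)) * (1 + ln (real J)))"
    proof (rule sum_over_samples[where t = "\<lambda>j. F (xj j)" and n = n])
      show "0 < 2 * c * r" "0 \<le> \<delta> / (r * Q)" using c r \<delta> Q0 by simp_all
      show "Bd \<subseteq> {..<J}" by (auto simp: Bd_def)
      show "2 * c * r * \<bar>real i - real j\<bar> \<le> \<bar>F (xj i) - F (xj j)\<bar>" if "i < J" "j < J" for i j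
      proof -
        have "c * \<bar>xj i - xj j\<bar> \<le> \<bar>F (xj i) - F (xj j)\<bar>"
          using contactD(2)[OF S sj_mem[OF that(2), unfolded sj_def] sj_mem[OF that(1), unfolded sj_def]] .
        then show ?thesis unfolding sepx by (simp add: mult_ac)
      qed
      show "finite (Near_upto (dual S') (48000 / \<delta>))" by (rule fdual)
      show "n j \<in> Near_upto (dual S') (48000 / \<delta>)" if "j \<in> Bd" for j by (rule mem[OF that])
      show "1 \<le> den v" if "v \<in> Near_upto (dual S') (48000 / \<delta>)" for v
        using that den_ge_1[of v] unfolding Near_upto_def by blast
      fix j assume j: "j \<in> Bd"
      have d: "1 \<le> den (n j)" by (rule den_ge_1[OF n(1)[OF j]])
      show "0 \<le> m j * \<delta> / 2" using mp[OF j] \<delta> by simp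
      show "m j * \<delta> / 2 \<le> 1 / den (n j)" using n(2)[OF j] d by (simp add: field_simps)
      show "m j * \<delta> / 2 * (\<bar>abscissa (n j) - F (xj j)\<bar> * den (n j)) \<le> \<delta> / (r * Q)"
      proof -
        have "\<bar>abscissa (n j) - F (xj j)\<bar> * den (n j) * m j \<le> 2 / (r * Q)"
          using n(3)[OF j] r Q0 by (simp add: pos_le_divide_eq)
        then have "\<delta> / 2 * (\<bar>abscissa (n j) - F (xj j)\<bar> * den (n j) * m j) \<le> \<delta> / 2 * (2 / (r * Q))"
          using \<delta> by (intro mult_left_mono) auto
        then show ?thesis by (simp add: mult_ac)
      qed
    next
      show "1 \<le> J" by (rule J)
    qed
    also have "\<dots> \<le> weight (dual S') (48000 / \<delta>) * (1 + 2 / (c * lam) * (1 + ln (real J)))"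
      unfolding weight_def
    proof (intro mult_left_mono add_left_mono mult_right_mono)
      have "lam * \<delta> \<le> r\<^sup>2 * Q" using lam(2) Q0 by (simp add: pos_divide_le_eq)
      then have "\<delta> / (r\<^sup>2 * Q) \<le> 1 / lam" using lam(1) r Q0 by (simp add: field_simps)
      then have "2 / c * (\<delta> / (r\<^sup>2 * Q)) \<le> 2 / c * (1 / lam)" using c by (intro mult_left_mono) auto
      then show "4 * ((\<delta> / (r * Q)) / (2 * c * r)) \<le> 2 / (c * lam)"
        by (simp add: power2_eq_square mult_ac)
      show "0 \<le> (\<Sum>v\<in>Near_upto (dual S') (48000 / \<delta>). 1 / den v)"
        by (intro sum_nonneg) (auto simp: Near_upto_def den_def Near_def)
    qed (rule H)
    also have "(\<Sum>j\<in>Bd. m j * \<delta> / 2) = \<sigma>1 * (\<delta> / 2)"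
      by (simp add: \<sigma>1_def sum_distrib_right sum_divide_distrib)
    finally have "2 / \<delta> * (\<sigma>1 * (\<delta> / 2)) \<le>
       2 / \<delta> * (weight (dual S') (48000 / \<delta>) * (1 + 2 / (c * lam) * (1 + ln (real J))))"
      using \<delta> by (intro mult_left_mono) auto
    then show ?thesis using \<delta> by simp
  qed
  have s2: "\<sigma>2 \<le> Q * (weight S' Q * (1 + 2 * (1 + ln (real J))))"
  proof -
    \<comment> \<open>For \<open>e j = 0\<close> there is no triple \<open>v j\<close> to attach the
      arc to, and the arc contributes nothing to the sum.\<close>
    define B2 where "B2 = {j\<in>Bd. e j \<noteq> 0}"
    have fB2: "finite B2" "B2 \<subseteq> Bd" using fGB by (auto simp: B2_def)
    have "(\<Sum>j\<in>B2. e j / Q) \<le> (\<Sum>v\<in>Near_upto S' Q. 1 / den v) * (1 + 4 * (r / (2 * r)) * (1 + ln (real J)))"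
    proof (rule sum_over_samples[where t = xj and n = v])
      show "0 < 2 * r" "0 \<le> r" using r by simp_all
      show "B2 \<subseteq> {..<J}" by (auto simp: Bd_def B2_def)
      show "2 * r * \<bar>real i - real j\<bar> \<le> \<bar>xj i - xj j\<bar>" for i j unfolding sepx by simp
      show "finite (Near_upto S' Q)" by (rule fprim)
      show "1 \<le> den v" if "v \<in> Near_upto S' Q" for v
        using that den_ge_1[of v] unfolding Near_upto_def by blast
      fix j assume j: "j \<in> B2"
      then have jB: "j \<in> Bd" "e j \<noteq> 0" by (auto simp: B2_def)
      note vj = v[OF jB]
      have vN: "v j \<in> Near {sj j}" using vj by blast
      have d: "1 \<le> den (v j)" by (rule den_ge_1[OF vN])
      have "den (v j) * 1 \<le> den (v j) * e j" using vj d by (intro mult_left_mono) auto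
      then have "den (v j) \<le> Q" using vj by linarith
      moreover have "sj j \<in> S'" using sj_mem[of j] jB by (simp add: S'_def Bd_def)
      ultimately show "v j \<in> Near_upto S' Q" using vN Near_mono[of "{sj j}" S'] by (auto simp: Near_upto_def)
      show "0 \<le> e j / Q" using e0[OF jB(1)] Q0 by simp
      show "e j / Q \<le> 1 / den (v j)" using vj d Q0 by (simp add: field_simps)
      have "\<bar>abscissa (v j) - xj j\<bar> * den (v j) * e j / Q \<le> r" using vj Q0 by (simp add: pos_divide_le_eq)
      then show "e j / Q * (\<bar>abscissa (v j) - xj j\<bar> * den (v j)) \<le> r" by (simp add: mult_ac)
    next
      show "1 \<le> J" by (rule J)
    qed
    also have "\<dots> = weight S' Q * (1 + 2 * (1 + ln (real J)))" using r by (simp add: weight_def)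
    finally have "(\<Sum>j\<in>B2. e j) / Q \<le> weight S' Q * (1 + 2 * (1 + ln (real J)))"
      by (simp add: sum_divide_distrib)
    moreover have "(\<Sum>j\<in>B2. e j) = \<sigma>2" unfolding \<sigma>2_def
      using fGB by (intro sum.mono_neutral_left) (auto simp: B2_def)
    ultimately show ?thesis using Q0 by (simp add: pos_divide_le_eq mult.commute)
  qed
  show ?thesis
    using p1 p2 fNT upper lower s1 s2 unfolding S'_def by blast
qed

end

subsection \<open>The number of near triples\<close>

text \<open>
  The main contributions \<open>0.70935\<close> and \<open>0.62595\<close> come from approximating the pyramid by \<open>40\<close> boxes;
  the choice \<open>C \<kappa>\<^sup>2 = 1 / 200\<close> makes the distance between curve and tangent negligible on an arc.
\<close>

lemma near_triples_card_explicit: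
  fixes c C \<eta> \<xi> \<epsilon> \<theta> A1 A2 Q \<delta> :: real and f F :: "real \<Rightarrow> real"
  defines "X \<equiv> \<xi> - \<eta>" and "\<kappa> \<equiv> sqrt (1 / (200 * C))"
  defines "L0 \<equiv> 1 + (X / \<kappa>) powr \<theta> / \<theta>"
  defines "K1 \<equiv> 2 * A1 * 48000 powr \<theta> * (1 + 1600 * C / c) * L0" and "K2 \<equiv> 3 * A2 * L0"
  assumes c: "0 < c" "c \<le> 1" "1 \<le> C" and X: "\<eta> < \<xi>" and \<epsilon>: "0 < \<epsilon>" "\<epsilon> < 1" and \<theta>: "0 < \<theta>" "\<theta> \<le> \<epsilon> / 8"
    and A: "0 \<le> A1" "0 \<le> A2"
    and S: "contact c C (\<xi> - \<eta>) (graph \<eta> \<xi> f F)"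
    and w1: "\<And>Y. 1 \<le> Y \<Longrightarrow> weight (dual (graph \<eta> \<xi> f F)) Y \<le> A1 * Y powr \<theta>"
    and w2: "\<And>Y. 1 \<le> Y \<Longrightarrow> weight (graph \<eta> \<xi> f F) Y \<le> A2 * Y powr \<theta>"
    and \<delta>: "Q powr (- 1 + \<epsilon>) \<le> \<delta>" "\<delta> \<le> 1 / 2" and Qge: "1 \<le> Q" "(2 * \<kappa> / X)\<^sup>2 \<le> Q"
    and u: "1 \<le> Q powr (\<epsilon> / 4)" "(96000 / \<kappa>)\<^sup>2 \<le> Q powr (\<epsilon> / 4)"
      "1280000000000 * \<kappa> * K1 \<le> 0.02 * X * Q powr (\<epsilon> / 4)" "1280000000000 * K2 \<le> 0.02 * X * Q powr (\<epsilon> / 4)"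
  shows "finite (near_triples f \<eta> \<xi> Q \<delta>)" "0.6 * (X * \<delta> * Q\<^sup>2) \<le> real (card (near_triples f \<eta> \<xi> Q \<delta>))"
    "real (card (near_triples f \<eta> \<xi> Q \<delta>)) \<le> 0.75 * (X * \<delta> * Q\<^sup>2)"
proof -
  \<comment> \<open>\<open>U\<close> measures losses: a weight and a logarithm cost a factor
    \<open>Q powr \<theta>\<close> each, together at most \<open>U\<close>, and a second factor
    \<open>U\<close> absorbs the constants. The gain that has to pay for this is
    \<open>m = sqrt (\<delta> * Q)\<close>, which is at least \<open>U\<^sup>2\<close>.\<close>
  define U where "U = Q powr (\<epsilon> / 4)"
  have U: "1 \<le> U" "(96000 / \<kappa>)\<^sup>2 \<le> U" "1280000000000 * \<kappa> * K1 \<le> 0.02 * X * U" "1280000000000 * K2 \<le> 0.02 * X * U"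
    using u by (auto simp: U_def)
  have X0: "0 < X" using X by (simp add: X_def)
  have \<kappa>: "0 < \<kappa>" "\<kappa> \<le> 1" "C * \<kappa>\<^sup>2 = 1 / 200" "\<kappa>\<^sup>2 / 4 = 1 / (800 * C)"
    using c by (auto simp: \<kappa>_def)
  have Q0: "0 < Q" using Qge by simp
  have "0 < Q powr (- 1 + \<epsilon>)" using Q0 by simp
  then have \<delta>0: "0 < \<delta>" using \<delta> by linarith
  define M where "M = \<delta> * Q"
  have M4: "U ^ 4 \<le> M"
  proof -
    have "U ^ 4 = Q powr \<epsilon>" using Q0 by (simp add: U_def powr_power)
    also have "\<dots> = Q powr (- 1 + \<epsilon>) * Q" using Q0 powr_mult_base[of Q "- 1 + \<epsilon>"] by (simp add: mult.commute)
    also have "\<dots> \<le> M" using \<delta> Q0 by (simp add: M_def mult_right_mono)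
    finally show ?thesis .
  qed
  have M0: "0 < M" using \<delta>0 Q0 by (simp add: M_def)
  define m where "m = sqrt M"
  have m2: "m\<^sup>2 = M" and m0: "0 < m" using M0 by (auto simp: m_def)
  have Um: "U\<^sup>2 \<le> m"
  proof -
    have "(U\<^sup>2)\<^sup>2 \<le> m\<^sup>2" using M4 m2 by (simp add: power_mult[symmetric])
    then show ?thesis using m0 by (rule power2_le_imp_le[OF _ less_imp_le])
  qed
  have U2: "U \<le> U\<^sup>2" using U(1) by (simp add: power2_eq_square)
  have Um1: "U \<le> m" using U2 Um by linarith
  have m1: "1 \<le> m" using Um1 U(1) by linarith
  have mM: "m \<le> M" using m1 m0 by (simp add: m2[symmetric] power2_eq_square)
  have "96000 \<le> 96000 / \<kappa>" using \<kappa> by (simp add: field_simps)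
  then have "96000 / \<kappa> \<le> (96000 / \<kappa>)\<^sup>2" using self_le_power[of "96000 / \<kappa>" 2] by linarith
  then have mk: "96000 / \<kappa> \<le> m" using U(2) Um1 by linarith
  then have m96: "96000 \<le> m" using \<open>96000 \<le> 96000 / \<kappa>\<close> by linarith
  have QM: "M \<le> Q" using \<delta> Q0 by (simp add: M_def)
  define W where "W = m / Q"
  have "W\<^sup>2 = M / Q\<^sup>2" by (simp add: W_def power_divide m2)
  also have "\<dots> = \<delta> / Q" using Q0 by (simp add: M_def power2_eq_square)
  finally have W: "0 < W" "W\<^sup>2 = \<delta> / Q" using m0 Q0 by (simp_all add: W_def)
  \<comment> \<open>Rounding to a whole number of arcs costs at most a factor 2, so that the
    half-length \<open>r\<close> lies between \<open>\<kappa> * W / 2\<close> and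
    \<open>\<kappa> * W\<close>.\<close>
  define J where "J = nat \<lceil>X / (2 * \<kappa> * W)\<rceil>"
  have x1: "1 \<le> X / (2 * \<kappa> * W)"
  proof -
    have "W\<^sup>2 \<le> 1 / Q" unfolding W(2) using \<delta> Q0 by (intro divide_right_mono) auto
    also have "\<dots> \<le> (X / (2 * \<kappa>))\<^sup>2"
    proof -
      have "(2 * \<kappa> / X)\<^sup>2 > 0" using \<kappa> X0 by simp
      then have "1 / Q \<le> 1 / (2 * \<kappa> / X)\<^sup>2" using Qge(2) by (intro divide_left_mono) (auto simp: Q0)
      then show ?thesis by (simp add: power_divide)
    qed
    finally have "W \<le> X / (2 * \<kappa>)" using X0 \<kappa> by (intro power2_le_imp_le[of W]) auto
    then show ?thesis using W \<kappa> X0 by (simp add: field_simps)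
  qed
  have Jb: "X / (2 * \<kappa> * W) \<le> real J" "real J \<le> X / (2 * \<kappa> * W) + 1"
  proof -
    show "X / (2 * \<kappa> * W) \<le> real J" unfolding J_def by (rule real_nat_ceiling_ge)
    show "real J \<le> X / (2 * \<kappa> * W) + 1" using x1 unfolding J_def by simp
  qed
  have J1: "1 \<le> J" using Jb(1) x1 by linarith
  have Jup: "real J \<le> X / (\<kappa> * W)"
  proof -
    have "X / (\<kappa> * W) = X / (2 * \<kappa> * W) + X / (2 * \<kappa> * W)" by (simp add: field_simps)
    then show ?thesis using order_trans[OF Jb(2) add_left_mono[OF x1]] by (simp add: mult.commute)
  qed
  define r where "r = X / (2 * real J)"
  have Jp: "0 < real J" using J1 by simp
  have r0: "0 < r" using X0 Jp by (simp add: r_def)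
  have r1: "r \<le> \<kappa> * W" using Jb(1) Jp \<kappa> W by (simp add: r_def field_simps)
  have r2: "\<kappa> * W / 2 \<le> r" using Jup Jp \<kappa> W by (simp add: r_def field_simps)
  have rsq: "r\<^sup>2 \<le> \<kappa>\<^sup>2 * (\<delta> / Q)"
    using power_mono[OF r1, of 2] r0 by (simp add: power_mult_distrib W(2))
  have rsq2: "1 / (800 * C) * \<delta> / Q \<le> r\<^sup>2"
  proof -
    have "(\<kappa> * W / 2)\<^sup>2 \<le> r\<^sup>2" using r2 \<kappa> W by (intro power_mono) auto
    moreover have "(\<kappa> * W / 2)\<^sup>2 = \<kappa>\<^sup>2 / 4 * (\<delta> / Q)" by (simp add: power_divide power_mult_distrib W(2))
    ultimately show ?thesis unfolding \<kappa>(4) by simp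
  qed
  have rQ1: "r * Q \<le> \<kappa> * m" using mult_right_mono[OF r1, of Q] Q0 by (simp add: W_def)
  have rQ2: "48000 \<le> r * Q"
  proof -
    have "48000 \<le> \<kappa> * m / 2" using mk \<kappa> by (simp add: field_simps)
    also have "\<dots> = \<kappa> * W / 2 * Q" using Q0 by (simp add: W_def)
    also have "\<dots> \<le> r * Q" using r2 Q0 by (intro mult_right_mono) auto
    finally show ?thesis .
  qed
  have Veq: "r * \<delta> * Q\<^sup>2 = (r * Q) * M" by (simp add: M_def power2_eq_square)
  have MV: "M \<le> r * \<delta> * Q\<^sup>2" unfolding Veq using rQ2 M0 by simp
  have M1: "1 \<le> M" using m1 mM by linarith
  interpret arcs c C \<eta> \<xi> Q \<delta> r f F J
  proof
    show "contact c C (\<xi> - \<eta>) (graph \<eta> \<xi> f F)" by (rule S)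
    show "C * r\<^sup>2 \<le> \<delta> / (200 * Q)"
    proof -
      have "C * r\<^sup>2 \<le> C * (\<kappa>\<^sup>2 * (\<delta> / Q))" using rsq c by (intro mult_left_mono) auto
      also have "\<dots> = C * \<kappa>\<^sup>2 * (\<delta> / Q)" by simp
      also have "\<dots> = \<delta> / (200 * Q)" unfolding \<kappa>(3) by simp
      finally show ?thesis .
    qed
    show "r = (\<xi> - \<eta>) / (2 * real J)" by (simp add: r_def X_def)
    show "48000 \<le> Q" using m96 mM QM by linarith
    have "48000\<^sup>2 \<le> m\<^sup>2" using m96 by (intro power_mono) auto
    then show "48000\<^sup>2 \<le> \<delta> * Q" by (simp add: m2 M_def)
    show "1 \<le> r * \<delta> * Q\<^sup>2" using MV M1 by linarith
    then have "r * \<delta> * Q\<^sup>2 \<le> (r * \<delta> * Q\<^sup>2)\<^sup>2" by (intro self_le_power) auto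
    then show "\<delta> * Q \<le> (r * \<delta> * Q\<^sup>2)\<^sup>2" using MV by (simp add: M_def)
  qed (use c X J1 \<delta>0 \<delta> rQ2 in auto)
  have lam: "0 < 1 / (800 * C)" using c by simp
  obtain \<sigma>1 \<sigma>2 where \<sigma>: "0 \<le> \<sigma>1" "0 \<le> \<sigma>2" and fin: "finite NT"
    and up: "real (card NT) \<le> 0.70935 * ((\<xi> - \<eta>) * \<delta> * Q\<^sup>2) + 20000 / s0\<^sup>2 * (VV * \<sigma>1 + \<sigma>2)"
    and lo: "VV * 1.2519 * (real J - 24000 * \<sigma>1) \<le> real (card NT)"
    and s1: "\<sigma>1 \<le> 2 / \<delta> * (weight (dual (graph \<eta> \<xi> f F)) (48000 / \<delta>) * (1 + 2 / (c * (1 / (800 * C))) * (1 + ln (real J))))"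
    and s2: "\<sigma>2 \<le> Q * (weight (graph \<eta> \<xi> f F) Q * (1 + 2 * (1 + ln (real J))))"
    using card_bounds[OF lam rsq2] by blast
  define E where "E = Q powr \<theta>"
  have E1: "1 \<le> E" using Qge \<theta> by (simp add: E_def ge_one_powr_ge_zero)
  have EU: "E * E \<le> U" unfolding E_def U_def powr_add[symmetric] using Qge \<theta> by (intro powr_mono) auto
  have L: "1 + ln (real J) \<le> L0 * E"
  proof -
    have "real J \<le> X / \<kappa> * Q"
    proof -
      have "1 / Q \<le> W" using m1 Q0 by (simp add: W_def divide_right_mono)
      then have "X / (\<kappa> * W) \<le> X / (\<kappa> * (1 / Q))" using X0 \<kappa> Q0 W by (intro divide_left_mono mult_left_mono) auto
      then show ?thesis using Jup by simp
    qed
    then have "real J powr \<theta> \<le> (X / \<kappa> * Q) powr \<theta>" using \<theta> Jp by (intro powr_mono2) auto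
    also have "\<dots> = (X / \<kappa>) powr \<theta> * E" using powr_mult[of "X / \<kappa>" Q \<theta>] X0 \<kappa>(1) Q0 by (simp add: E_def)
    finally have "real J powr \<theta> / \<theta> \<le> (X / \<kappa>) powr \<theta> * E / \<theta>" using \<theta> by (intro divide_right_mono) auto
    moreover have "ln (real J) \<le> real J powr \<theta> / \<theta>" using J1 \<theta> by (intro ln_powr_bound) auto
    ultimately show ?thesis using E1 by (simp add: L0_def distrib_right)
  qed
  have H: "1 \<le> 1 + ln (real J)" using J1 by simp
  have L0: "0 \<le> L0" using \<theta> by (simp add: L0_def)
  have K: "0 \<le> K1" "0 \<le> K2" using A c L0 by (auto simp: K1_def K2_def)
  have S1: "\<sigma>1 \<le> K1 * U / \<delta>"
  proof -
    define a where "a = 1600 * C / c"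
    have a: "0 \<le> a" "2 / (c * (1 / (800 * C))) = a" using c by (auto simp: a_def)
    have "1 / \<delta> \<le> Q" using M1 \<delta>0 by (simp add: M_def field_simps)
    then have "48000 / \<delta> \<le> 48000 * Q" by (simp add: field_simps)
    then have "(48000 / \<delta>) powr \<theta> \<le> (48000 * Q) powr \<theta>" using \<theta> \<delta>0 by (intro powr_mono2) auto
    also have "\<dots> = 48000 powr \<theta> * E" using Q0 by (simp add: powr_mult E_def)
    finally have p: "(48000 / \<delta>) powr \<theta> \<le> 48000 powr \<theta> * E" .
    have d1: "1 \<le> 48000 / \<delta>" using \<delta>0 \<delta> by (simp add: field_simps)
    have "weight (dual (graph \<eta> \<xi> f F)) (48000 / \<delta>) \<le> A1 * (48000 powr \<theta> * E)"
      using w1[OF d1] mult_left_mono[OF p A(1)] by linarith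
    moreover have "1 + a * (1 + ln (real J)) \<le> (1 + a) * (L0 * E)"
    proof -
      have "1 + a * (1 + ln (real J)) \<le> (1 + a) * (1 + ln (real J))" using H by (simp add: algebra_simps)
      also have "\<dots> \<le> (1 + a) * (L0 * E)" using L a by (intro mult_left_mono) auto
      finally show ?thesis .
    qed
    ultimately have "weight (dual (graph \<eta> \<xi> f F)) (48000 / \<delta>) * (1 + a * (1 + ln (real J)))
       \<le> A1 * (48000 powr \<theta> * E) * ((1 + a) * (L0 * E))"
      using a A H E1 by (intro mult_mono) auto
    then have "2 / \<delta> * (weight (dual (graph \<eta> \<xi> f F)) (48000 / \<delta>) * (1 + a * (1 + ln (real J))))
       \<le> 2 / \<delta> * (A1 * (48000 powr \<theta> * E) * ((1 + a) * (L0 * E)))"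
      using \<delta>0 by (intro mult_left_mono) auto
    also have "\<dots> = K1 * (E * E) / \<delta>" by (simp add: K1_def a_def)
    also have "\<dots> \<le> K1 * U / \<delta>" using EU K \<delta>0 by (intro divide_right_mono mult_left_mono) auto
    finally show ?thesis using s1 unfolding a(2) by linarith
  qed
  have S2: "\<sigma>2 \<le> K2 * U * Q"
  proof -
    have "weight (graph \<eta> \<xi> f F) Q * (1 + 2 * (1 + ln (real J))) \<le> A2 * E * (3 * (L0 * E))"
      using w2[OF Qge(1)] L H A E1 unfolding E_def[symmetric] by (intro mult_mono) auto
    then have "Q * (weight (graph \<eta> \<xi> f F) Q * (1 + 2 * (1 + ln (real J)))) \<le> Q * (A2 * E * (3 * (L0 * E)))"
      using Q0 by (intro mult_left_mono) auto
    also have "\<dots> = K2 * (E * E) * Q" by (simp add: K2_def)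
    also have "\<dots> \<le> K2 * U * Q" using EU K Q0 by (intro mult_right_mono mult_left_mono) auto
    finally show ?thesis using s2 by linarith
  qed
  have main: "(\<xi> - \<eta>) * \<delta> * Q\<^sup>2 = X * (m\<^sup>2 * Q)" unfolding m2 M_def by (simp add: X_def power2_eq_square)
  have s0: "20000 / s0\<^sup>2 = 1280000000000" by (simp add: s0_def power2_eq_square)
  \<comment> \<open>Up to constants \<open>VV * \<sigma>1\<close> is at most
    \<open>m * Q * U\<close>, while the main term is \<open>m\<^sup>2 * Q\<close>.\<close>
  have e1: "1280000000000 * (VV * \<sigma>1) \<le> 0.02 * (X * (m\<^sup>2 * Q))"
  proof -
    have "VV * \<sigma>1 \<le> (r * Q * M) * (K1 * U / \<delta>)"
      unfolding VV_def Veq using S1 r0 Q0 M0 by (intro mult_left_mono) auto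
    also have "\<dots> = (r * Q) * Q * (K1 * U)" using \<delta>0 by (simp add: M_def)
    also have "\<dots> \<le> (\<kappa> * m) * Q * (K1 * U)" using rQ1 Q0 K U by (intro mult_right_mono) auto
    finally have "1280000000000 * (VV * \<sigma>1) \<le> (1280000000000 * \<kappa> * K1) * (m * Q * U)" by (simp add: mult_ac)
    also have "\<dots> \<le> (0.02 * X * U) * (m * Q * U)" using U(3) m0 Q0 U(1) by (intro mult_right_mono) auto
    also have "\<dots> = 0.02 * X * (m * Q) * U\<^sup>2" by (simp add: power2_eq_square)
    also have "\<dots> \<le> 0.02 * X * (m * Q) * m" using Um X0 m0 Q0 by (intro mult_left_mono) auto
    finally show ?thesis by (simp add: power2_eq_square mult_ac)
  qed
  have e2: "1280000000000 * \<sigma>2 \<le> 0.02 * (X * (m\<^sup>2 * Q))"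
  proof -
    have "1280000000000 * \<sigma>2 \<le> (1280000000000 * K2) * (U * Q)" using S2 by simp
    also have "\<dots> \<le> (0.02 * X * U) * (U * Q)" using U(4) U(1) Q0 by (intro mult_right_mono) auto
    also have "\<dots> = 0.02 * X * Q * U\<^sup>2" by (simp add: power2_eq_square)
    also have "\<dots> \<le> 0.02 * X * Q * m\<^sup>2" using Um mM X0 Q0 m2 by (intro mult_left_mono) auto
    finally show ?thesis by (simp add: mult_ac)
  qed
  show "finite (near_triples f \<eta> \<xi> Q \<delta>)" by (rule fin)
  have "20000 / s0\<^sup>2 * (VV * \<sigma>1 + \<sigma>2) = 1280000000000 * (VV * \<sigma>1) + 1280000000000 * \<sigma>2"
    unfolding s0 by (simp add: distrib_left)
  then show "real (card (near_triples f \<eta> \<xi> Q \<delta>)) \<le> 0.75 * (X * \<delta> * Q\<^sup>2)"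
  proof -
    assume err: "20000 / s0\<^sup>2 * (VV * \<sigma>1 + \<sigma>2) = 1280000000000 * (VV * \<sigma>1) + 1280000000000 * \<sigma>2"
    have z: "0 \<le> X * (m\<^sup>2 * Q)" using X0 Q0 by simp
    have "n \<le> 0.75 * Z" if "n \<le> 0.70935 * Z + (a + b)" "a \<le> 0.02 * Z" "b \<le> 0.02 * Z" "0 \<le> Z" for n Z a b :: real
      using that by simp
    from this[OF up[unfolded err main] e1 e2 z] show ?thesis unfolding main[folded X_def] .
  qed
  \<comment> \<open>At most four percent of the arcs are bad, and 1.2519 * 0.96 / 2 is still above
    0.6.\<close>
  have e3: "24000 * \<sigma>1 \<le> 0.04 * real J"
  proof -
    have "24000 * \<sigma>1 \<le> 24000 * (K1 * U / \<delta>)" using S1 by simp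
    also have "\<dots> = 24000 * K1 * U * Q / (m * m)" using Q0 \<delta>0 unfolding power2_eq_square[symmetric] m2 by (simp add: M_def)
    also have "\<dots> \<le> 0.02 * X / \<kappa> * Q / m"
    proof -
      have "24000 * \<kappa> * K1 * U \<le> 1280000000000 * \<kappa> * K1 * U" using K \<kappa> U by (intro mult_right_mono) auto
      also have "\<dots> \<le> 0.02 * X * U * U" using U(3) U(1) by (intro mult_right_mono) auto
      also have "\<dots> = 0.02 * X * U\<^sup>2" by (simp add: power2_eq_square)
      also have "\<dots> \<le> 0.02 * X * m" using Um X0 by (intro mult_left_mono) auto
      finally have "24000 * K1 * U \<le> 0.02 * X / \<kappa> * m" using \<kappa> by (simp add: field_simps)
      then have "24000 * K1 * U * (Q / (m * m)) \<le> 0.02 * X / \<kappa> * m * (Q / (m * m))"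
        using Q0 m0 by (intro mult_right_mono) auto
      then show ?thesis using m0 by simp
    qed
    also have "\<dots> = 0.04 * (X / (2 * \<kappa> * W))" using Q0 by (simp add: W_def)
    also have "\<dots> \<le> 0.04 * real J" using Jb(1) by (intro mult_left_mono) auto
    finally show ?thesis .
  qed
  have "0.6 * (X * \<delta> * Q\<^sup>2) \<le> 1.2519 * 0.96 * (real J * VV)"
    unfolding JVV using X0 \<delta>0 Q0 by (simp add: X_def[symmetric])
  also have "\<dots> = VV * 1.2519 * (0.96 * real J)" by simp
  also have "\<dots> \<le> VV * 1.2519 * (real J - 24000 * \<sigma>1)" using e3 VV_pos by (intro mult_left_mono) auto
  finally show "0.6 * (X * \<delta> * Q\<^sup>2) \<le> real (card (near_triples f \<eta> \<xi> Q \<delta>))" using lo by linarith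
qed

text \<open>\<open>Q0\<close> can be fixed before \<open>f\<close> because the weights are bounded
  uniformly over all sets of elements with the same constants.\<close>

theorem near_triples_card:
  fixes c C \<eta> \<xi> \<epsilon> :: real
  assumes c: "0 < c" "c \<le> 1" "1 \<le> C" and X: "\<eta> < \<xi>" and \<epsilon>: "0 < \<epsilon>" "\<epsilon> < 1"
  shows "\<exists>Q0\<ge>1. \<forall>f F Q \<delta>. contact c C (\<xi> - \<eta>) (graph \<eta> \<xi> f F) \<longrightarrow> Q0 \<le> Q \<longrightarrow> Q powr (- 1 + \<epsilon>) \<le> \<delta> \<longrightarrow> \<delta> \<le> 1 / 2 \<longrightarrow>
    finite (near_triples f \<eta> \<xi> Q \<delta>) \<and> 0.6 * ((\<xi> - \<eta>) * \<delta> * Q\<^sup>2) \<le> real (card (near_triples f \<eta> \<xi> Q \<delta>)) \<and>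
    real (card (near_triples f \<eta> \<xi> Q \<delta>)) \<le> 0.75 * ((\<xi> - \<eta>) * \<delta> * Q\<^sup>2)"
proof -
  \<comment> \<open>Enough improvement steps to reach \<theta> \<le> \<epsilon> / 8, so that two
    factors \<open>Q powr \<theta>\<close> fit into \<open>Q powr (\<epsilon> / 4)\<close>.\<close>
  define k where "k = nat \<lceil>8 / \<epsilon>\<rceil>"
  define \<theta> where "\<theta> = 1 / real (Suc k)"
  have \<theta>: "0 < \<theta>" "\<theta> \<le> \<epsilon> / 8"
  proof -
    show "0 < \<theta>" by (simp add: \<theta>_def)
    have "8 / \<epsilon> \<le> real (Suc k)" using real_nat_ceiling_ge[of "8 / \<epsilon>"] by (simp add: k_def)
    then show "\<theta> \<le> \<epsilon> / 8" using \<epsilon> by (simp add: \<theta>_def field_simps)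
  qed
  have c2: "c\<^sup>2 \<le> 1" "1 \<le> C\<^sup>2" using c by (auto simp: power_le_one)
  have c3: "c \<le> C\<^sup>2" "c\<^sup>2 \<le> C" using c c2 by linarith+
  have dc: "0 < c / C\<^sup>2" "c / C\<^sup>2 \<le> 1" "1 \<le> C / c\<^sup>2" "0 \<le> C * (\<xi> - \<eta>)"
    using c c3 X by (auto simp: divide_le_eq le_divide_eq)
  obtain A1 where A1: "0 \<le> A1" "\<And>S Y. contact (c / C\<^sup>2) (C / c\<^sup>2) (C * (\<xi> - \<eta>)) S \<Longrightarrow> 1 \<le> Y \<Longrightarrow> weight S Y \<le> A1 * Y powr \<theta>"
    using weight_bound[OF dc, of k] unfolding \<theta>_def by blast
  have X0: "0 \<le> \<xi> - \<eta>" using X by simp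
  obtain A2 where A2: "0 \<le> A2" "\<And>S Y. contact c C (\<xi> - \<eta>) S \<Longrightarrow> 1 \<le> Y \<Longrightarrow> weight S Y \<le> A2 * Y powr \<theta>"
    using weight_bound[OF c X0, of k] unfolding \<theta>_def by blast
  define \<kappa> where "\<kappa> = sqrt (1 / (200 * C))"
  define L0 where "L0 = 1 + ((\<xi> - \<eta>) / \<kappa>) powr \<theta> / \<theta>"
  define K1 where "K1 = 2 * A1 * 48000 powr \<theta> * (1 + 1600 * C / c) * L0"
  define K2 where "K2 = 3 * A2 * L0"
  define T where "T = max 1 (max ((96000 / \<kappa>)\<^sup>2) (max (1280000000000 * \<kappa> * K1 / (0.02 * (\<xi> - \<eta>))) (1280000000000 * K2 / (0.02 * (\<xi> - \<eta>)))))"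
  have T: "1 \<le> T" "(96000 / \<kappa>)\<^sup>2 \<le> T" "1280000000000 * \<kappa> * K1 / (0.02 * (\<xi> - \<eta>)) \<le> T" "1280000000000 * K2 / (0.02 * (\<xi> - \<eta>)) \<le> T"
    by (auto simp: T_def)
  define Q0 where "Q0 = max 1 (max ((2 * \<kappa> / (\<xi> - \<eta>))\<^sup>2) (T powr (4 / \<epsilon>)))"
  have Q0: "1 \<le> Q0" "(2 * \<kappa> / (\<xi> - \<eta>))\<^sup>2 \<le> Q0" "T powr (4 / \<epsilon>) \<le> Q0" by (auto simp: Q0_def)
  show ?thesis
  proof (intro exI[of _ Q0] conjI[OF Q0(1)] allI impI)
    fix f F Q \<delta> assume h: "contact c C (\<xi> - \<eta>) (graph \<eta> \<xi> f F)" "Q0 \<le> Q" "Q powr (- 1 + \<epsilon>) \<le> \<delta>" "\<delta> \<le> 1 / 2"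
    have "T = (T powr (4 / \<epsilon>)) powr (\<epsilon> / 4)" using T(1) \<epsilon> by (simp add: powr_powr)
    also have "\<dots> \<le> Q powr (\<epsilon> / 4)" using h(2) Q0(3) \<epsilon> by (intro powr_mono2) auto
    finally have TQ: "T \<le> Q powr (\<epsilon> / 4)" .
    have u3: "1280000000000 * \<kappa> * K1 \<le> 0.02 * (\<xi> - \<eta>) * Q powr (\<epsilon> / 4)"
      using order_trans[OF T(3) TQ] X by (simp add: divide_le_eq mult_ac)
    have u4: "1280000000000 * K2 \<le> 0.02 * (\<xi> - \<eta>) * Q powr (\<epsilon> / 4)"
      using order_trans[OF T(4) TQ] X by (simp add: divide_le_eq mult_ac)
    have q: "1 \<le> Q" "(2 * \<kappa> / (\<xi> - \<eta>))\<^sup>2 \<le> Q" using Q0 h(2) by linarith+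
    note res = near_triples_card_explicit[OF c X \<epsilon> \<theta> A1(1) A2(1) h(1) A1(2)[OF contact_dual[OF h(1) c]] A2(2)[OF h(1)] h(3,4) q(1)
        q(2)[unfolded \<kappa>_def] order_trans[OF T(1) TQ] order_trans[OF T(2) TQ, unfolded \<kappa>_def]
        u3[unfolded K1_def L0_def \<kappa>_def] u4[unfolded K2_def L0_def \<kappa>_def]]
    show "finite (near_triples f \<eta> \<xi> Q \<delta>) \<and> 0.6 * ((\<xi> - \<eta>) * \<delta> * Q\<^sup>2) \<le> real (card (near_triples f \<eta> \<xi> Q \<delta>)) \<and>
      real (card (near_triples f \<eta> \<xi> Q \<delta>)) \<le> 0.75 * ((\<xi> - \<eta>) * \<delta> * Q\<^sup>2)"
      using res by blast
  qed
qed

section \<open>Elements of the graph of a function with bounded curvature\<close>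

lemma within_interval_DERIV:
  fixes f :: "real \<Rightarrow> real"
  assumes "f differentiable_on {\<eta>..\<xi>}" "x \<in> {\<eta>..\<xi>}" 
  shows "(f has_real_derivative deriv_on {\<eta>..\<xi>} f x) (at x within {\<eta>..\<xi>})"
  using assms unfolding differentiable_on_def deriv_on_def
  by (metis has_real_derivative_iff_has_vector_derivative vector_derivative_works)

text \<open>Convexity from a nonnegative second derivative. The derivatives are relative to the
  interval, so the mean value theorem is applied at interior points, where they are ordinary
  derivatives.\<close>

lemma taylor_bounds:
  fixes g G H :: "real \<Rightarrow> real"
  assumes g: "\<And>x. x \<in> {\<eta>..\<xi>} \<Longrightarrow> (g has_real_derivative G x) (at x within {\<eta>..\<xi>})"
    and G: "\<And>x. x \<in> {\<eta>..\<xi>} \<Longrightarrow> (G has_real_derivative H x) (at x within {\<eta>..\<xi>})"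
    and H: "\<And>x. x \<in> {\<eta>..\<xi>} \<Longrightarrow> 0 \<le> H x"
    and x: "x \<in> {\<eta>..\<xi>}" "y \<in> {\<eta>..\<xi>}"
  shows "x \<le> y \<Longrightarrow> G x \<le> G y" "0 \<le> g y - g x - G x * (y - x)"
proof -
  have mono: "G a \<le> G b" if "a \<in> {\<eta>..\<xi>}" "b \<in> {\<eta>..\<xi>}" "a \<le> b" for a b
  proof (rule DERIV_nonneg_imp_increasing_open[of a b G])
    show "a \<le> b" by (rule that)
    show "continuous_on {a..b} G"
      by (rule continuous_on_subset[OF DERIV_continuous_on[OF G]]) (use that in auto)
    fix t assume t: "a < t" "t < b"
    then have "t \<in> {\<eta><..<\<xi>}" using that by auto
    then have "at t within {\<eta>..\<xi>} = at t" by (intro at_within_interior) (simp add: interior_atLeastAtMost_real)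
    then show "\<exists>y. (G has_real_derivative y) (at t) \<and> 0 \<le> y"
      using G[of t] H[of t] \<open>t \<in> {\<eta><..<\<xi>}\<close> by auto
  qed
  show "x \<le> y \<Longrightarrow> G x \<le> G y" using mono x by blast
  show "0 \<le> g y - g x - G x * (y - x)"
  proof (cases "x = y")
    case False
    define a b where "a = min x y" and "b = max x y"
    have ab: "a < b" "a \<in> {\<eta>..\<xi>}" "b \<in> {\<eta>..\<xi>}" using False x by (auto simp: a_def b_def)
    have "\<exists>l z. a < z \<and> z < b \<and> DERIV g z :> l \<and> g b - g a = (b - a) * l"
    proof (rule MVT)
      show "continuous_on {a..b} g"
        by (rule continuous_on_subset[OF DERIV_continuous_on[OF g]]) (use ab in auto)
      show "g differentiable (at t)" if "a < t" "t < b" for t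
      proof -
        have "t \<in> {\<eta><..<\<xi>}" using that ab by auto
        then have "at t within {\<eta>..\<xi>} = at t" by (intro at_within_interior) (simp add: interior_atLeastAtMost_real)
        then show ?thesis using g[of t] \<open>t \<in> {\<eta><..<\<xi>}\<close> by (auto simp: real_differentiable_def)
      qed
    qed (use ab in auto)
    then obtain l z where z: "a < z" "z < b" "DERIV g z :> l" "g b - g a = (b - a) * l" by blast
    have zI: "z \<in> {\<eta><..<\<xi>}" using z ab by auto
    then have "at z within {\<eta>..\<xi>} = at z" by (intro at_within_interior) (simp add: interior_atLeastAtMost_real)
    then have "l = G z" using g[of z] zI z(3) by (auto intro: DERIV_unique)
    have "g y - g x - G x * (y - x) = (y - x) * (G z - G x)"
      using z(4) \<open>l = G z\<close> by (auto simp: a_def b_def algebra_simps max_def min_def split: if_splits)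
    also have "0 \<le> (y - x) * (G z - G x)"
    proof (cases "x \<le> y")
      case True
      then have "G x \<le> G z" using z zI x by (intro mono) (auto simp: a_def b_def)
      then show ?thesis using True by simp
    next
      case False
      then have "G z \<le> G x" using z zI x by (intro mono) (auto simp: a_def b_def)
      then show ?thesis using False by (simp add: mult_nonpos_nonpos)
    qed
    finally show ?thesis .
  qed simp
qed

text \<open>Lower and upper bounds are convexity of \<open>f t - c1 / 2 * t\<^sup>2\<close> and of
  \<open>c2 / 2 * t\<^sup>2 - f t\<close>. Gaps have the natural constants \<open>c1 / 2\<close> and
  \<open>c2 / 2\<close>, slopes \<open>c1\<close> and \<open>c2\<close>; the weaker one of each pair
  serves both.\<close>

lemma contact_graph:
  fixes f F H :: "real \<Rightarrow> real"
  assumes f: "\<And>x. x \<in> {\<eta>..\<xi>} \<Longrightarrow> (f has_real_derivative F x) (at x within {\<eta>..\<xi>})"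
    and F: "\<And>x. x \<in> {\<eta>..\<xi>} \<Longrightarrow> (F has_real_derivative H x) (at x within {\<eta>..\<xi>})"
    and H: "\<And>x. x \<in> {\<eta>..\<xi>} \<Longrightarrow> c1 \<le> H x \<and> H x \<le> c2" and c1: "0 \<le> c1"
  shows "contact (c1 / 2) c2 (\<xi> - \<eta>) (graph \<eta> \<xi> f F)"
proof -
  have "\<bar>y - x\<bar> \<le> \<xi> - \<eta> \<and> c1 / 2 * \<bar>y - x\<bar> \<le> \<bar>F y - F x\<bar> \<and> \<bar>F y - F x\<bar> \<le> c2 * \<bar>y - x\<bar> \<and>
     c1 / 2 * (y - x)\<^sup>2 \<le> f y - f x - F x * (y - x) \<and> f y - f x - F x * (y - x) \<le> c2 * (y - x)\<^sup>2"
    if xy: "x \<in> {\<eta>..\<xi>}" "y \<in> {\<eta>..\<xi>}" for x y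
  proof -
    have c2: "0 \<le> c2" using H[OF xy(1)] c1 by linarith
    define g1 G1 where "g1 t = f t - c1 / 2 * t\<^sup>2" and "G1 t = F t - c1 * t" for t
    define g2 G2 where "g2 t = c2 / 2 * t\<^sup>2 - f t" and "G2 t = c2 * t - F t" for t
    have d1: "(g1 has_real_derivative G1 t) (at t within {\<eta>..\<xi>})" if "t \<in> {\<eta>..\<xi>}" for t
      unfolding g1_def G1_def using f[OF that] by (auto intro!: derivative_eq_intros)
    have e1: "(G1 has_real_derivative H t - c1) (at t within {\<eta>..\<xi>})" if "t \<in> {\<eta>..\<xi>}" for t
      unfolding G1_def using F[OF that] by (auto intro!: derivative_eq_intros)
    have d2: "(g2 has_real_derivative G2 t) (at t within {\<eta>..\<xi>})" if "t \<in> {\<eta>..\<xi>}" for t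
      unfolding g2_def G2_def using f[OF that] by (auto intro!: derivative_eq_intros)
    have e2: "(G2 has_real_derivative c2 - H t) (at t within {\<eta>..\<xi>})" if "t \<in> {\<eta>..\<xi>}" for t
      unfolding G2_def using F[OF that] by (auto intro!: derivative_eq_intros)
    have H1: "0 \<le> H t - c1" "0 \<le> c2 - H t" if "t \<in> {\<eta>..\<xi>}" for t using H[OF that] by auto
    have t1: "a \<le> b \<Longrightarrow> G1 a \<le> G1 b" "0 \<le> g1 b - g1 a - G1 a * (b - a)" if "a \<in> {\<eta>..\<xi>}" "b \<in> {\<eta>..\<xi>}" for a b
      using taylor_bounds[of \<eta> \<xi> g1 G1 "\<lambda>t. H t - c1" a b] d1 e1 H1(1) that by blast+
    have t2: "a \<le> b \<Longrightarrow> G2 a \<le> G2 b" "0 \<le> g2 b - g2 a - G2 a * (b - a)" if "a \<in> {\<eta>..\<xi>}" "b \<in> {\<eta>..\<xi>}" for a b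
      using taylor_bounds[of \<eta> \<xi> g2 G2 "\<lambda>t. c2 - H t" a b] d2 e2 H1(2) that by blast+
    have "g1 y - g1 x - G1 x * (y - x) = f y - f x - F x * (y - x) - c1 / 2 * (y - x)\<^sup>2"
      by (simp add: g1_def G1_def power2_eq_square algebra_simps)
    then have 1: "c1 / 2 * (y - x)\<^sup>2 \<le> f y - f x - F x * (y - x)" using t1(2)[OF xy] by simp
    have "g2 y - g2 x - G2 x * (y - x) = c2 / 2 * (y - x)\<^sup>2 - (f y - f x - F x * (y - x))"
      by (simp add: g2_def G2_def power2_eq_square algebra_simps)
    then have "f y - f x - F x * (y - x) \<le> c2 / 2 * (y - x)\<^sup>2" using t2(2)[OF xy] by simp
    also have "\<dots> \<le> c2 * (y - x)\<^sup>2" using c2 by (intro mult_right_mono) auto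
    finally have 2: "f y - f x - F x * (y - x) \<le> c2 * (y - x)\<^sup>2" .
    have 3: "c1 * (b - a) \<le> F b - F a \<and> F b - F a \<le> c2 * (b - a)"
      if "a \<in> {\<eta>..\<xi>}" "b \<in> {\<eta>..\<xi>}" "a \<le> b" for a b
      using t1(1)[OF that] t2(1)[OF that] by (simp add: G1_def G2_def algebra_simps)
    have 4: "c1 * \<bar>y - x\<bar> \<le> \<bar>F y - F x\<bar> \<and> \<bar>F y - F x\<bar> \<le> c2 * \<bar>y - x\<bar>"
    proof (cases "x \<le> y")
      case True
      have "0 \<le> c1 * (y - x)" using c1 True by simp
      then show ?thesis using 3[OF xy True] True by simp
    next
      case False
      have "0 \<le> c1 * (x - y)" using c1 False by simp
      then show ?thesis using 3[OF xy(2,1)] False by simp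
    qed
    have "c1 / 2 * \<bar>y - x\<bar> \<le> c1 * \<bar>y - x\<bar>" using c1 by (intro mult_right_mono) auto
    then show ?thesis using 1 2 4 xy by auto
  qed
  then show ?thesis unfolding contact_def graph_def by auto
qed

lemma nonvanishing_constant_sign:
  fixes H :: "real \<Rightarrow> real"
  assumes "continuous_on {\<eta>..\<xi>} H" "\<And>x. x \<in> {\<eta>..\<xi>} \<Longrightarrow> H x \<noteq> 0"
  shows "(\<forall>x\<in>{\<eta>..\<xi>}. 0 < H x) \<or> (\<forall>x\<in>{\<eta>..\<xi>}. H x < 0)"
proof (rule ccontr)
  assume "\<not> ?thesis"
  then obtain x y where xy: "x \<in> {\<eta>..\<xi>}" "y \<in> {\<eta>..\<xi>}" "H x \<le> 0" "0 \<le> H y" by force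
  have "connected (H ` {\<eta>..\<xi>})" using assms(1) by (intro connected_continuous_image) auto
  then have "0 \<in> H ` {\<eta>..\<xi>}" using xy by (meson connectedD_interval imageI)
  then show False using assms(2) by auto
qed

text \<open>\<open>contact\<close> asks for a convex curve; the reflection of \<open>b\<close> to
  \<open>-b\<close> reduces the concave case to it.\<close>

lemma near_triples_uminus: "card (near_triples (\<lambda>x. - f x) \<eta> \<xi> Q \<delta>) = card (near_triples f \<eta> \<xi> Q \<delta>)"
  "finite (near_triples (\<lambda>x. - f x) \<eta> \<xi> Q \<delta>) \<longleftrightarrow> finite (near_triples f \<eta> \<xi> Q \<delta>)"
proof -
  let ?h = "\<lambda>(a,b,q). (a,-b,q) :: int \<times> int \<times> int"
  have ab: "den (?h v) = den v" "abscissa (?h v) = abscissa v" "ordinate (?h v) = - ordinate v" for v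
    by (cases v; simp add: den_def abscissa_def ordinate_def)+
  have hh: "?h (?h v) = v" for v by (cases v) simp
  have mem: "?h v \<in> near_triples f \<eta> \<xi> Q \<delta> \<longleftrightarrow> v \<in> near_triples (\<lambda>x. - f x) \<eta> \<xi> Q \<delta>" for v
    unfolding near_triples_def mem_Collect_eq ab by (auto simp: abs_minus_commute)
  have mem2: "?h v \<in> near_triples (\<lambda>x. - f x) \<eta> \<xi> Q \<delta> \<longleftrightarrow> v \<in> near_triples f \<eta> \<xi> Q \<delta>" for v
    using mem[of "?h v"] unfolding hh by simp
  have b: "bij_betw ?h (near_triples (\<lambda>x. - f x) \<eta> \<xi> Q \<delta>) (near_triples f \<eta> \<xi> Q \<delta>)"
    by (rule bij_betw_byWitness[where f' = ?h]) (use hh mem mem2 in blast)+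
  show "card (near_triples (\<lambda>x. - f x) \<eta> \<xi> Q \<delta>) = card (near_triples f \<eta> \<xi> Q \<delta>)"
    "finite (near_triples (\<lambda>x. - f x) \<eta> \<xi> Q \<delta>) \<longleftrightarrow> finite (near_triples f \<eta> \<xi> Q \<delta>)"
    using bij_betw_same_card[OF b] bij_betw_finite[OF b] by auto
qed

subsection \<open>Primitive triples\<close>

lemma curve_near_triples_card:
  fixes \<eta> \<xi> c1 c2 \<epsilon> :: real
  assumes X: "\<eta> < \<xi>" and c1: "0 < c1" and \<epsilon>: "0 < \<epsilon>" "\<epsilon> < 1"
  shows "\<exists>Q0\<ge>1. \<forall>f\<in>curve_class {\<eta>..\<xi>} c1 c2. \<forall>Q \<delta>. Q0 \<le> Q \<longrightarrow> Q powr (- 1 + \<epsilon>) \<le> \<delta> \<longrightarrow> \<delta> \<le> 1 / 2 \<longrightarrow>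
    finite (near_triples f \<eta> \<xi> Q \<delta>) \<and> 0.6 * ((\<xi> - \<eta>) * \<delta> * Q\<^sup>2) \<le> real (card (near_triples f \<eta> \<xi> Q \<delta>)) \<and>
    real (card (near_triples f \<eta> \<xi> Q \<delta>)) \<le> 0.75 * ((\<xi> - \<eta>) * \<delta> * Q\<^sup>2)"
proof -
  define c C where "c = min 1 (c1 / 2)" and "C = max 1 c2"
  have c: "0 < c" "c \<le> 1" "1 \<le> C" using c1 by (auto simp: c_def C_def)
  obtain Q0 where Q0: "1 \<le> Q0" and main: "\<And>f F Q \<delta>. contact c C (\<xi> - \<eta>) (graph \<eta> \<xi> f F) \<Longrightarrow> Q0 \<le> Q \<Longrightarrow>
      Q powr (- 1 + \<epsilon>) \<le> \<delta> \<Longrightarrow> \<delta> \<le> 1 / 2 \<Longrightarrow>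
    finite (near_triples f \<eta> \<xi> Q \<delta>) \<and> 0.6 * ((\<xi> - \<eta>) * \<delta> * Q\<^sup>2) \<le> real (card (near_triples f \<eta> \<xi> Q \<delta>)) \<and>
    real (card (near_triples f \<eta> \<xi> Q \<delta>)) \<le> 0.75 * ((\<xi> - \<eta>) * \<delta> * Q\<^sup>2)"
    using near_triples_card[OF c X \<epsilon>] by blast
  have con: "contact c C (\<xi> - \<eta>) (graph \<eta> \<xi> g G)"
    if "\<And>x. x \<in> {\<eta>..\<xi>} \<Longrightarrow> (g has_real_derivative G x) (at x within {\<eta>..\<xi>})"
      "\<And>x. x \<in> {\<eta>..\<xi>} \<Longrightarrow> (G has_real_derivative H x) (at x within {\<eta>..\<xi>})"
      "\<And>x. x \<in> {\<eta>..\<xi>} \<Longrightarrow> c1 \<le> H x \<and> H x \<le> c2" for g G H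
    by (rule contact_mono[OF contact_graph[OF that]]) (use c1 in \<open>auto simp: c_def C_def\<close>)
  show ?thesis
  proof (intro exI[of _ Q0] conjI[OF Q0] ballI allI impI)
    fix f Q \<delta> assume f: "f \<in> curve_class {\<eta>..\<xi>} c1 c2" and Q: "Q0 \<le> Q" "Q powr (- 1 + \<epsilon>) \<le> \<delta>" "\<delta> \<le> 1 / 2"
    define F where "F = deriv_on {\<eta>..\<xi>} f"
    define H where "H = deriv_on {\<eta>..\<xi>} F"
    have d: "f differentiable_on {\<eta>..\<xi>}" "F differentiable_on {\<eta>..\<xi>}" "continuous_on {\<eta>..\<xi>} H"
      and b: "\<And>x. x \<in> {\<eta>..\<xi>} \<Longrightarrow> c1 \<le> \<bar>H x\<bar> \<and> \<bar>H x\<bar> \<le> c2"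
      using f by (auto simp: curve_class_def C2_on_def F_def H_def)
    have f1: "(f has_real_derivative F x) (at x within {\<eta>..\<xi>})" if "x \<in> {\<eta>..\<xi>}" for x
      unfolding F_def by (rule within_interval_DERIV[OF d(1) that])
    have f2: "(F has_real_derivative H x) (at x within {\<eta>..\<xi>})" if "x \<in> {\<eta>..\<xi>}" for x
      unfolding H_def by (rule within_interval_DERIV[OF d(2) that])
    have "H x \<noteq> 0" if "x \<in> {\<eta>..\<xi>}" for x using b[OF that] c1 by auto
    from nonvanishing_constant_sign[OF d(3) this]
    show "finite (near_triples f \<eta> \<xi> Q \<delta>) \<and> 0.6 * ((\<xi> - \<eta>) * \<delta> * Q\<^sup>2) \<le> real (card (near_triples f \<eta> \<xi> Q \<delta>)) \<and>
      real (card (near_triples f \<eta> \<xi> Q \<delta>)) \<le> 0.75 * ((\<xi> - \<eta>) * \<delta> * Q\<^sup>2)"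
    proof
      assume pos: "\<forall>x\<in>{\<eta>..\<xi>}. 0 < H x"
      have "c1 \<le> H x \<and> H x \<le> c2" if "x \<in> {\<eta>..\<xi>}" for x using b[OF that] pos that by fastforce
      from main[OF con[OF f1 f2 this] Q] show ?thesis by blast
    next
      assume neg: "\<forall>x\<in>{\<eta>..\<xi>}. H x < 0"
      have n: "c1 \<le> - H x \<and> - H x \<le> c2" if "x \<in> {\<eta>..\<xi>}" for x using b[OF that] neg that by fastforce
      have "contact c C (\<xi> - \<eta>) (graph \<eta> \<xi> (\<lambda>x. - f x) (\<lambda>x. - F x))"
        by (rule con[where H = "\<lambda>x. - H x"]) (use n in \<open>auto intro!: DERIV_minus f1 f2\<close>)
      from main[OF this Q] show ?thesis unfolding near_triples_uminus by blast
    qed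
  qed
qed

text \<open>For each \<open>a / q\<close> there are at most three choices of \<open>b\<close>. The
  resulting order Q^2 lacks the factor \<delta>, but it holds for arbitrary \<open>f\<close> and
  suffices wherever \<open>Q\<close> is bounded.\<close>

lemma near_triples_trivial:
  assumes X: "\<eta> < \<xi>" and Q: "1 \<le> Q" and \<delta>: "0 \<le> \<delta>" "\<delta> \<le> 1"
  shows "finite (near_triples f \<eta> \<xi> Q \<delta>)" "real (card (near_triples f \<eta> \<xi> Q \<delta>)) \<le> 3 * (1 + (\<xi> - \<eta>) * Q) * Q"
proof -
  define A where "A q = {a::int. \<eta> * of_int q \<le> of_int a \<and> of_int a \<le> \<eta> * of_int q + (\<xi> - \<eta>) * of_int q}" for q :: int
  define B where "B q a = {b::int. of_int q * f (of_int a / of_int q) - 1 \<le> of_int b \<and> of_int b \<le> (of_int q * f (of_int a / of_int q) - 1) + 2}" for q a :: int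
  define P where "P = Sigma {1..\<lfloor>Q\<rfloor>} (\<lambda>q. Sigma (A q) (B q))"
  have A: "finite (A q)" "real (card (A q)) \<le> 1 + (\<xi> - \<eta>) * Q" if "q \<in> {1..\<lfloor>Q\<rfloor>}" for q
  proof -
    have q: "0 \<le> (\<xi> - \<eta>) * of_int q" "(\<xi> - \<eta>) * of_int q \<le> (\<xi> - \<eta>) * Q"
      using X that by (auto simp: le_floor_iff)
    show "finite (A q)" unfolding A_def by (rule card_int_interval_le(1)[OF q(1)])
    show "real (card (A q)) \<le> 1 + (\<xi> - \<eta>) * Q"
      using card_int_interval_le(2)[OF q(1), of "\<eta> * of_int q"] q(2) unfolding A_def by linarith
  qed
  have B: "finite (B q a)" "real (card (B q a)) \<le> 3" for q a
    using card_int_interval_le[of 2 "of_int q * f (of_int a / of_int q) - 1"] unfolding B_def by auto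
  have sub: "near_triples f \<eta> \<xi> Q \<delta> \<subseteq> (\<lambda>(q,a,b). (a,b,q)) ` P"
  proof
    fix v assume v: "v \<in> near_triples f \<eta> \<xi> Q \<delta>"
    obtain a b q where ve: "v = (a,b,q)" by (cases v)
    have q: "1 \<le> q" "real_of_int q \<le> Q" "\<eta> \<le> of_int a / of_int q" "of_int a / of_int q \<le> \<xi>"
      "\<bar>f (of_int a / of_int q) - of_int b / of_int q\<bar> < \<delta> / Q"
      using v by (auto simp: near_triples_def ve den_def abscissa_def ordinate_def)
    have q0: "0 < real_of_int q" using q by simp
    have "of_int q * f (of_int a / of_int q) - of_int b = of_int q * (f (of_int a / of_int q) - of_int b / of_int q)"
      using q0 by (simp add: algebra_simps)
    then have "\<bar>of_int q * f (of_int a / of_int q) - of_int b\<bar> = of_int q * \<bar>f (of_int a / of_int q) - of_int b / of_int q\<bar>"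
      using q0 by (simp add: abs_mult)
    also have "\<dots> \<le> Q * (\<delta> / Q)" using q q0 by (intro mult_mono) auto
    also have "\<dots> \<le> 1" using Q \<delta> by simp
    finally have "b \<in> B q a" unfolding B_def by (auto simp: abs_le_iff)
    moreover have "a \<in> A q" using q(3,4) q0 by (auto simp: A_def field_simps)
    moreover have "q \<in> {1..\<lfloor>Q\<rfloor>}" using q by (simp add: le_floor_iff)
    ultimately have "(q,a,b) \<in> P" by (auto simp: P_def)
    then show "v \<in> (\<lambda>(q,a,b). (a,b,q)) ` P" unfolding ve by force
  qed
  have fP: "finite P" unfolding P_def using A B by auto
  show "finite (near_triples f \<eta> \<xi> Q \<delta>)" using finite_subset[OF sub] fP by simp
  have X0: "0 \<le> (\<xi> - \<eta>) * Q" using X Q by simp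
  have "card (near_triples f \<eta> \<xi> Q \<delta>) \<le> card P" by (rule surj_card_le[OF fP sub])
  also have "card P = (\<Sum>q\<in>{1..\<lfloor>Q\<rfloor>}. \<Sum>a\<in>A q. card (B q a))"
    unfolding P_def using A B by (subst card_SigmaI) (auto intro!: sum.cong card_SigmaI)
  finally have "real (card (near_triples f \<eta> \<xi> Q \<delta>)) \<le> (\<Sum>q\<in>{1..\<lfloor>Q\<rfloor>}. \<Sum>a\<in>A q. real (card (B q a)))"
    by (simp flip: of_nat_sum)
  also have "\<dots> \<le> (\<Sum>q\<in>{1..\<lfloor>Q\<rfloor>}. \<Sum>a\<in>A q. 3)" using B by (intro sum_mono) auto
  also have "\<dots> = (\<Sum>q\<in>{1..\<lfloor>Q\<rfloor>}. 3 * real (card (A q)))" by (simp add: mult.commute)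
  also have "\<dots> \<le> (\<Sum>q\<in>{1..\<lfloor>Q\<rfloor>}. 3 * (1 + (\<xi> - \<eta>) * Q))" using A by (intro sum_mono mult_left_mono) auto
  also have "\<dots> = real (nat \<lfloor>Q\<rfloor>) * (3 * (1 + (\<xi> - \<eta>) * Q))" by simp
  also have "\<dots> \<le> Q * (3 * (1 + (\<xi> - \<eta>) * Q))" using Q X0 by (intro mult_right_mono) auto
  finally show "real (card (near_triples f \<eta> \<xi> Q \<delta>)) \<le> 3 * (1 + (\<xi> - \<eta>) * Q) * Q" by (simp add: mult_ac)
qed

section \<open>From all triples to reduced fractions\<close>

definition primitive :: "int \<times> int \<times> int \<Rightarrow> bool" where
  "primitive v \<longleftrightarrow> (case v of (a,b,q) \<Rightarrow> gcd a (gcd b q) = 1)"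

lemma near_points_eq:
  "near_points {\<eta>..\<xi>} f Q \<delta> = (\<lambda>v. (abscissa v, ordinate v)) ` {v \<in> near_triples f \<eta> \<xi> Q \<delta>. primitive v}"
proof (intro equalityI subsetI)
  fix z assume "z \<in> near_points {\<eta>..\<xi>} f Q \<delta>"
  then obtain a b q where z: "z = (real_of_int a / real q, real_of_int b / real q)" "1 \<le> q" "real q \<le> Q"
    "real_of_int a / real q \<in> {\<eta>..\<xi>}" "gcd (gcd a b) (int q) = 1" "\<bar>f (real_of_int a / real q) - real_of_int b / real q\<bar> < \<delta> / Q"
    unfolding near_points_def by (elim CollectE exE conjE) (rule that)
  have "(a, b, int q) \<in> {v \<in> near_triples f \<eta> \<xi> Q \<delta>. primitive v}"
    using z by (auto simp: near_triples_def primitive_def den_def abscissa_def ordinate_def gcd.assoc)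
  moreover have "z = (abscissa (a, b, int q), ordinate (a, b, int q))" using z by (simp add: abscissa_def ordinate_def den_def)
  ultimately show "z \<in> (\<lambda>v. (abscissa v, ordinate v)) ` {v \<in> near_triples f \<eta> \<xi> Q \<delta>. primitive v}" by blast
next
  fix z assume "z \<in> (\<lambda>v. (abscissa v, ordinate v)) ` {v \<in> near_triples f \<eta> \<xi> Q \<delta>. primitive v}"
  then obtain a b q where v: "(a,b,q) \<in> near_triples f \<eta> \<xi> Q \<delta>" "primitive (a,b,q)" "z = (abscissa (a,b,q), ordinate (a,b,q))" by force
  define n where "n = nat q"
  have q: "q = int n" "1 \<le> n" using v(1) by (auto simp: near_triples_def den_def n_def)
  have "z = (real_of_int a / real n, real_of_int b / real n) \<and> 1 \<le> n \<and> real n \<le> Q \<and> real_of_int a / real n \<in> {\<eta>..\<xi>} \<and>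
    gcd (gcd a b) (int n) = 1 \<and> \<bar>f (real_of_int a / real n) - real_of_int b / real n\<bar> < \<delta> / Q"
    using v q by (auto simp: near_triples_def primitive_def den_def abscissa_def ordinate_def gcd.assoc)
  then show "z \<in> near_points {\<eta>..\<xi>} f Q \<delta>"
    unfolding near_points_def by (intro CollectI exI[of _ a] exI[of _ b] exI[of _ n])
qed

lemma num_near_points_eq:
  "num_near_points {\<eta>..\<xi>} f Q \<delta> = card {v \<in> near_triples f \<eta> \<xi> Q \<delta>. primitive v}"
proof -
  have "inj_on (\<lambda>v. (abscissa v, ordinate v)) {v \<in> near_triples f \<eta> \<xi> Q \<delta>. primitive v}"
  proof (rule inj_onI)
    fix v w assume v: "v \<in> {v \<in> near_triples f \<eta> \<xi> Q \<delta>. primitive v}" and w: "w \<in> {v \<in> near_triples f \<eta> \<xi> Q \<delta>. primitive v}"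
      and eq: "(abscissa v, ordinate v) = (abscissa w, ordinate w)"
    obtain a b q where ve: "v = (a,b,q)" by (cases v)
    obtain a' b' q' where we: "w = (a',b',q')" by (cases w)
    have q: "1 \<le> q" "1 \<le> q'" "gcd a (gcd b q) = 1" "gcd a' (gcd b' q') = 1"
      using v w by (auto simp: ve we near_triples_def primitive_def den_def)
    have "real_of_int (a * q') = of_int (a' * q)" "real_of_int (b * q') = of_int (b' * q)"
      using eq q by (auto simp: ve we abscissa_def ordinate_def den_def field_simps)
    then have "a * q' = a' * q" "b * q' = b' * q" by linarith+
    then show "v = w" unfolding ve we by (rule primitive_eqI[OF q(3,4,1,2)])
  qed
  then show ?thesis unfolding num_near_points_def near_points_eq by (rule card_image)
qed

text \<open>A triple with common factor \<open>d\<close> is \<open>d\<close> times a triple counted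
  for \<open>Q / d\<close>, and dividing \<delta> by \<open>d\<close> as well keeps the tolerance
  \<delta> / Q. Only this inequality is needed, so repeated counting on the right is harmless and
  replaces Moebius inversion.\<close>

lemma near_triples_le_primitive:
  assumes X: "\<eta> < \<xi>" and Q: "1 \<le> Q" and \<delta>: "0 < \<delta>" "\<delta> \<le> 1"
  shows "real (card (near_triples f \<eta> \<xi> Q \<delta>)) \<le> real (card {v \<in> near_triples f \<eta> \<xi> Q \<delta>. primitive v}) +
    (\<Sum>d=2..nat \<lfloor>Q\<rfloor>. real (card (near_triples f \<eta> \<xi> (Q / real d) (\<delta> / real d))))"
proof -
  define N where "N d = near_triples f \<eta> \<xi> (Q / real d) (\<delta> / real d)" for d :: nat
  define sc where "sc d = (\<lambda>(a,b,q). (int d * a, int d * b, int d * q))" for d :: nat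
  have fin: "finite (near_triples f \<eta> \<xi> Q \<delta>)" using near_triples_trivial(1)[OF X Q] \<delta> by simp
  have fN: "finite (N d)" if "d \<in> {2..nat \<lfloor>Q\<rfloor>}" for d
  proof -
    have "real d \<le> real (nat \<lfloor>Q\<rfloor>)" using that by simp
    also have "\<dots> \<le> Q" using Q by (intro of_nat_floor) simp
    finally have "real d \<le> Q" .
    then have "1 \<le> Q / real d" "\<delta> / real d \<le> 1" "0 \<le> \<delta> / real d" using that \<delta> by (auto simp: le_divide_eq divide_le_eq)
    then show ?thesis unfolding N_def using near_triples_trivial(1)[OF X] by blast
  qed
  have sub: "near_triples f \<eta> \<xi> Q \<delta> \<subseteq> {v \<in> near_triples f \<eta> \<xi> Q \<delta>. primitive v} \<union> (\<Union>d\<in>{2..nat \<lfloor>Q\<rfloor>}. sc d ` N d)"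
  proof
    fix v assume v: "v \<in> near_triples f \<eta> \<xi> Q \<delta>"
    show "v \<in> {v \<in> near_triples f \<eta> \<xi> Q \<delta>. primitive v} \<union> (\<Union>d\<in>{2..nat \<lfloor>Q\<rfloor>}. sc d ` N d)"
    proof (cases "primitive v")
      case False
      obtain a b q where ve: "v = (a,b,q)" by (cases v)
      have q: "1 \<le> q" "real_of_int q \<le> Q" "\<eta> \<le> of_int a / of_int q" "of_int a / of_int q \<le> \<xi>"
        "\<bar>f (of_int a / of_int q) - of_int b / of_int q\<bar> < \<delta> / Q"
        using v by (auto simp: near_triples_def ve den_def abscissa_def ordinate_def)
      define g where "g = gcd a (gcd b q)"
      have g: "g dvd a" "g dvd b" "g dvd q" "0 < g" "g \<noteq> 1"
        using False q unfolding g_def by (auto simp: primitive_def ve intro: dvd_trans gcd_pos_int)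
      define d where "d = nat g"
      have gd: "g = int d" "2 \<le> d" using g by (auto simp: d_def)
      obtain a' where a': "a = int d * a'" using g(1) gd by (auto elim: dvdE)
      obtain b' where b': "b = int d * b'" using g(2) gd by (auto elim: dvdE)
      obtain q' where q': "q = int d * q'" using g(3) gd by (auto elim: dvdE)
      have q'1: "1 \<le> q'" using q(1) gd unfolding q' by (simp add: zero_less_mult_iff int_one_le_iff_zero_less)
      have d0: "0 < real d" using gd by simp
      have "int d \<le> q" using mult_left_mono[of 1 q' "int d"] q'1 unfolding q' by simp
      then have "real d \<le> Q" using q(2) by linarith
      then have dm: "d \<in> {2..nat \<lfloor>Q\<rfloor>}" using gd by (simp add: le_nat_floor)
      have "(a',b',q') \<in> N d"
        using q q'1 d0 unfolding N_def near_triples_def den_def abscissa_def ordinate_def a' b' q'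
        by (simp add: field_simps)
      moreover have "v = sc d (a',b',q')" by (simp add: ve sc_def a' b' q')
      ultimately show ?thesis using dm by blast
    qed (use v in blast)
  qed
  have fU: "finite (\<Union>d\<in>{2..nat \<lfloor>Q\<rfloor>}. sc d ` N d)" using fN by auto
  have "card (near_triples f \<eta> \<xi> Q \<delta>) \<le> card ({v \<in> near_triples f \<eta> \<xi> Q \<delta>. primitive v} \<union> (\<Union>d\<in>{2..nat \<lfloor>Q\<rfloor>}. sc d ` N d))"
    using fin fU by (intro card_mono[OF _ sub]) auto
  also have "\<dots> \<le> card {v \<in> near_triples f \<eta> \<xi> Q \<delta>. primitive v} + card (\<Union>d\<in>{2..nat \<lfloor>Q\<rfloor>}. sc d ` N d)"
    by (rule card_Un_le)
  also have "card (\<Union>d\<in>{2..nat \<lfloor>Q\<rfloor>}. sc d ` N d) \<le> (\<Sum>d\<in>{2..nat \<lfloor>Q\<rfloor>}. card (sc d ` N d))"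
    by (rule card_UN_le) simp
  also have "\<dots> \<le> (\<Sum>d\<in>{2..nat \<lfloor>Q\<rfloor>}. card (N d))" using fN by (intro sum_mono card_image_le)
  finally have "real (card (near_triples f \<eta> \<xi> Q \<delta>)) \<le> real (card {v \<in> near_triples f \<eta> \<xi> Q \<delta>. primitive v} + (\<Sum>d\<in>{2..nat \<lfloor>Q\<rfloor>}. card (N d)))"
    by (simp only: of_nat_le_iff add_left_mono)
  then show ?thesis by (simp add: N_def)
qed

text \<open>Comparison of 1 / (x + 1)^3 with 1 / (x (x + 1) (x + 2)), which telescopes to 1 /
  4.\<close>

lemma sum_inverse_cubes: "1 \<le> n \<Longrightarrow> (\<Sum>d=2..n. 1 / real d ^ 3) \<le> 1/4 - 1 / (2 * real n * (real n + 1))"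
proof (induction n rule: nat_induct_at_least)
  case (Suc n)
  define x where "x = real n"
  have x: "1 \<le> x" using Suc.hyps by (simp add: x_def)
  have "1 / (x + 1) ^ 3 \<le> 1 / (x * (x + 1) * (x + 2))"
  proof (rule divide_left_mono)
    show "x * (x + 1) * (x + 2) \<le> (x + 1) ^ 3" using x by (simp add: power3_eq_cube algebra_simps)
  qed (use x in auto)
  also have "\<dots> = 1 / (2 * x * (x + 1)) - 1 / (2 * (x + 1) * (x + 2))" using x by (simp add: divide_simps) (simp add: algebra_simps)
  finally have "1 / (x + 1) ^ 3 \<le> 1 / (2 * x * (x + 1)) - 1 / (2 * (x + 1) * (x + 2))" .
  moreover have "{2..Suc n} = insert (Suc n) {2..n}" using Suc.hyps by auto
  then have "(\<Sum>d=2..Suc n. 1 / real d ^ 3) = (\<Sum>d=2..n. 1 / real d ^ 3) + 1 / (x + 1) ^ 3"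
    by (simp add: x_def add.commute)
  moreover have "1 / (2 * real (Suc n) * (real (Suc n) + 1)) = 1 / (2 * (x + 1) * (x + 2))"
    by (simp add: x_def add.commute)
  ultimately show ?case using Suc.IH unfolding x_def[symmetric] by linarith
qed simp

lemma zeta_3_bounds: "1 \<le> zeta 3" "zeta 3 \<le> 5 / 4"
proof -
  define f where "f n = 1 / real (Suc n) powr 3" for n
  have f: "f n = 1 / real (Suc n) ^ 3" for n
    unfolding f_def using powr_numeral[of "real (Suc n)" "num.Bit1 num.One"] by simp
  have f0: "0 \<le> f n" for n by (simp add: f)
  have part: "(\<Sum>k<n. f k) \<le> 5 / 4" for n
  proof (cases n)
    case (Suc m)
    have "(\<Sum>k<n. f k) = (\<Sum>d=1..n. 1 / real d ^ 3)"
      unfolding f by (rule sum.reindex_bij_witness[of _ "\<lambda>d. d - 1" Suc]) auto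
    also have "\<dots> = 1 + (\<Sum>d=2..n. 1 / real d ^ 3)"
    proof -
      have "{1..n} = insert 1 {2..n}" using Suc by auto
      then show ?thesis by simp
    qed
    also have "\<dots> \<le> 1 + (1/4 - 1 / (2 * real n * (real n + 1)))" using sum_inverse_cubes[of n] Suc by simp
    also have "\<dots> \<le> 5 / 4" by simp
    finally show ?thesis .
  qed simp
  have sm: "summable f" by (rule summableI_nonneg_bounded[OF f0 part])
  have "f = (\<lambda>n. 1 / real (Suc n) powr 3)" by (rule ext) (rule f_def)
  then have z: "zeta 3 = suminf f" by (simp only: zeta_def)
  show "zeta 3 \<le> 5 / 4" unfolding z by (rule suminf_le_const[OF sm part])
  have "(\<Sum>k\<in>{0}. f k) \<le> suminf f" using sm f0 by (intro sum_le_suminf) auto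
  then show "1 \<le> zeta 3" by (simp add: z f)
qed

text \<open>0.3925 is 0.6 - 0.75 / 4 - 0.02: the full count, less the inverse cubes at the levels d
  \<ge> 2, less an error of lower order.\<close>

lemma primitive_triples_card:
  fixes \<eta> \<xi> c1 c2 \<epsilon> :: real
  assumes X: "\<eta> < \<xi>" and c1: "0 < c1" and \<epsilon>: "0 < \<epsilon>" "\<epsilon> < 1"
  shows "\<exists>Q0\<ge>1. \<forall>f\<in>curve_class {\<eta>..\<xi>} c1 c2. \<forall>Q \<delta>. Q0 \<le> Q \<longrightarrow> Q powr (- 1 + \<epsilon>) \<le> \<delta> \<longrightarrow> \<delta> \<le> 1 / 2 \<longrightarrow>
    0.3925 * ((\<xi> - \<eta>) * \<delta> * Q\<^sup>2) \<le> real (card {v \<in> near_triples f \<eta> \<xi> Q \<delta>. primitive v}) \<and>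
    real (card {v \<in> near_triples f \<eta> \<xi> Q \<delta>. primitive v}) \<le> 0.75 * ((\<xi> - \<eta>) * \<delta> * Q\<^sup>2)"
proof -
  define W where "W = \<xi> - \<eta>"
  have W: "0 < W" using X by (simp add: W_def)
  obtain Qa where Qa: "1 \<le> Qa" and near_triples_card: "\<And>f Q \<delta>. f \<in> curve_class {\<eta>..\<xi>} c1 c2 \<Longrightarrow> Qa \<le> Q \<Longrightarrow>
      Q powr (- 1 + \<epsilon>) \<le> \<delta> \<Longrightarrow> \<delta> \<le> 1 / 2 \<Longrightarrow>
      finite (near_triples f \<eta> \<xi> Q \<delta>) \<and> 0.6 * (W * \<delta> * Q\<^sup>2) \<le> real (card (near_triples f \<eta> \<xi> Q \<delta>)) \<and>
      real (card (near_triples f \<eta> \<xi> Q \<delta>)) \<le> 0.75 * (W * \<delta> * Q\<^sup>2)"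
    using curve_near_triples_card[OF X c1 \<epsilon>] unfolding W_def by blast
  \<comment> \<open>At a level \<open>d \<ge> 2\<close> the window \<delta> / d may be narrower than
    the exponent \<epsilon> admits for \<open>Q / d\<close>, so the count is applied there with
    \<epsilon> / 2.\<close>
  have \<epsilon>2: "0 < \<epsilon> / 2" "\<epsilon> / 2 < 1" using \<epsilon> by auto
  obtain Qb where Qb: "1 \<le> Qb" and asym2: "\<And>f Q \<delta>. f \<in> curve_class {\<eta>..\<xi>} c1 c2 \<Longrightarrow> Qb \<le> Q \<Longrightarrow>
      Q powr (- 1 + \<epsilon> / 2) \<le> \<delta> \<Longrightarrow> \<delta> \<le> 1 / 2 \<Longrightarrow>
      finite (near_triples f \<eta> \<xi> Q \<delta>) \<and> 0.6 * (W * \<delta> * Q\<^sup>2) \<le> real (card (near_triples f \<eta> \<xi> Q \<delta>)) \<and>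
      real (card (near_triples f \<eta> \<xi> Q \<delta>)) \<le> 0.75 * (W * \<delta> * Q\<^sup>2)"
    using curve_near_triples_card[OF X c1 \<epsilon>2] unfolding W_def by blast
  \<comment> \<open>The value 4 ensures \<open>R powr (- 1 + \<epsilon> / 2) \<le> 4 powr (- (1 /
    2)) = 1 / 2\<close> for all \<open>R \<ge> Q1\<close>, so that the widened window stays
    admissible.\<close>
  define Q1 where "Q1 = max Qb 4"
  have Q1: "Qb \<le> Q1" "4 \<le> Q1" by (auto simp: Q1_def)
  define C0 where "C0 = 3 * (1 + W * Q1) * Q1"
  have C0: "0 \<le> C0" using W Q1 by (simp add: C0_def)
  define T where "T = (0.75 * W * (1 + 4 / \<epsilon>) + C0) / (0.02 * W)"
  define Q0 where "Q0 = max Qa (max 1 (T powr (4 / \<epsilon>)))"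
  have T0: "0 \<le> T" using W C0 \<epsilon> by (simp add: T_def)
  have Q0: "Qa \<le> Q0" "1 \<le> Q0" "T powr (4 / \<epsilon>) \<le> Q0" by (auto simp: Q0_def)
  show ?thesis unfolding W_def[symmetric]
  proof (intro exI[of _ Q0] conjI[OF Q0(2)] ballI allI impI)
    fix f Q \<delta> assume f: "f \<in> curve_class {\<eta>..\<xi>} c1 c2" and Q: "Q0 \<le> Q" and \<delta>: "Q powr (- 1 + \<epsilon>) \<le> \<delta>" "\<delta> \<le> 1 / 2"
    have Qp: "1 \<le> Q" "0 < Q" using Q Q0 by linarith+
    have "0 < Q powr (- 1 + \<epsilon>)" using Qp by simp
    then have \<delta>0: "0 < \<delta>" using \<delta> by linarith
    note as = near_triples_card[OF f order_trans[OF Q0(1) Q] \<delta>]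
    let ?P = "{v \<in> near_triples f \<eta> \<xi> Q \<delta>. primitive v}"
    have up: "real (card ?P) \<le> 0.75 * (W * \<delta> * Q\<^sup>2)"
    proof -
      have "card ?P \<le> card (near_triples f \<eta> \<xi> Q \<delta>)" using as by (intro card_mono) auto
      then show ?thesis using as by linarith
    qed
    have level: "real (card (near_triples f \<eta> \<xi> (Q / real d) (\<delta> / real d))) \<le>
        0.75 * (W * \<delta> * Q\<^sup>2) * (1 / real d ^ 3) + 0.75 * W * Q powr (1 + \<epsilon> / 2) * (1 / real d) + C0"
      if d: "d \<in> {2..nat \<lfloor>Q\<rfloor>}" for d
    proof -
      have d2: "2 \<le> real d" using d by simp
      have "real d \<le> real (nat \<lfloor>Q\<rfloor>)" using d by simp
      also have "\<dots> \<le> Q" using Qp by (intro of_nat_floor) simp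
      finally have dQ: "real d \<le> Q" .
      have Qd: "1 \<le> Q / real d" using dQ d2 by simp
      have nn: "0 \<le> 0.75 * (W * \<delta> * Q\<^sup>2) * (1 / real d ^ 3)" "0 \<le> 0.75 * W * Q powr (1 + \<epsilon> / 2) * (1 / real d)"
        using W \<delta>0 by simp_all
      show ?thesis
      proof (cases "Q1 \<le> Q / real d")
        case True
        define R where "R = Q / real d"
        have R: "Q1 \<le> R" "4 \<le> R" using True Q1 by (auto simp: R_def)
        \<comment> \<open>Widening the window only adds triples. The extra
          \<open>R powr (1 + \<epsilon> / 2)\<close> per level sums over \<open>d\<close> to
          O(\<open>Q powr (1 + \<epsilon> / 2) * (1 + ln Q)\<close>), which is small against
          \<open>\<delta> * Q\<^sup>2 \<ge> Q powr (1 + \<epsilon>)\<close>.\<close>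
        define \<delta>' where "\<delta>' = max (\<delta> / real d) (R powr (- 1 + \<epsilon> / 2))"
        have "R powr (- 1 + \<epsilon> / 2) \<le> R powr (- (1 / 2))" using R \<epsilon> by (intro powr_mono) auto
        also have "\<dots> \<le> 4 powr (- (1 / 2))" using R by (intro powr_mono2') auto
        also have "\<dots> = 1 / 2" by (simp add: powr_minus powr_half_sqrt)
        finally have r2: "R powr (- 1 + \<epsilon> / 2) \<le> 1 / 2" .
        have "\<delta> / real d \<le> \<delta> / 1" using d2 \<delta>0 by (intro divide_left_mono) auto
        then have \<delta>2: "\<delta>' \<le> 1 / 2" using r2 \<delta>(2) unfolding \<delta>'_def by (intro max.boundedI) linarith+
        have as2: "finite (near_triples f \<eta> \<xi> R \<delta>')" "real (card (near_triples f \<eta> \<xi> R \<delta>')) \<le> 0.75 * (W * \<delta>' * R\<^sup>2)"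
          using asym2[OF f order_trans[OF Q1(1) R(1)], of \<delta>'] \<delta>2 by (auto simp: \<delta>'_def)
        have "\<delta> / real d / R \<le> \<delta>' / R" using R by (intro divide_right_mono) (auto simp: \<delta>'_def)
        then have "near_triples f \<eta> \<xi> R (\<delta> / real d) \<subseteq> near_triples f \<eta> \<xi> R \<delta>'"
          by (auto simp: near_triples_def)
        then have "card (near_triples f \<eta> \<xi> R (\<delta> / real d)) \<le> card (near_triples f \<eta> \<xi> R \<delta>')"
          by (rule card_mono[OF as2(1)])
        then have "real (card (near_triples f \<eta> \<xi> R (\<delta> / real d))) \<le> 0.75 * (W * \<delta>' * R\<^sup>2)"
          using as2(2) by linarith
        also have "\<dots> \<le> 0.75 * (W * (\<delta> / real d + R powr (- 1 + \<epsilon> / 2)) * R\<^sup>2)"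
          using W d2 \<delta>0 by (intro mult_left_mono mult_right_mono) (auto simp: \<delta>'_def)
        also have "\<dots> = 0.75 * (W * \<delta> * Q\<^sup>2) * (1 / real d ^ 3) + 0.75 * W * (R powr (- 1 + \<epsilon> / 2) * R\<^sup>2)"
          by (simp add: R_def power_divide power2_eq_square power3_eq_cube algebra_simps add_divide_distrib)
        also have "R powr (- 1 + \<epsilon> / 2) * R\<^sup>2 = R powr (1 + \<epsilon> / 2)"
        proof -
          have "R powr (- 1 + \<epsilon> / 2) * R\<^sup>2 = R powr (- 1 + \<epsilon> / 2) * R powr 2" using R by (simp add: powr_numeral)
          also have "\<dots> = R powr (1 + \<epsilon> / 2)" by (simp add: powr_add[symmetric])
          finally show ?thesis .
        qed
        also have "R powr (1 + \<epsilon> / 2) \<le> Q powr (1 + \<epsilon> / 2) * (1 / real d)"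
        proof -
          have "R powr (1 + \<epsilon> / 2) = R * R powr (\<epsilon> / 2)" using R powr_mult_base[of R "\<epsilon> / 2"] by simp
          also have "\<dots> \<le> R * Q powr (\<epsilon> / 2)"
          proof -
            have "R \<le> Q" using d2 Qp by (simp add: R_def divide_le_eq mult_le_cancel_left1)
            then show ?thesis using R \<epsilon> by (intro mult_left_mono powr_mono2) auto
          qed
          also have "\<dots> = Q powr (1 + \<epsilon> / 2) * (1 / real d)"
            using Qp powr_mult_base[of Q "\<epsilon> / 2"] by (simp add: R_def)
          finally show ?thesis .
        qed
        finally have "real (card (near_triples f \<eta> \<xi> R (\<delta> / real d))) \<le>
            0.75 * (W * \<delta> * Q\<^sup>2) * (1 / real d ^ 3) + 0.75 * W * (Q powr (1 + \<epsilon> / 2) * (1 / real d))"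
          using W by (simp add: mult_left_mono)
        then show ?thesis using C0 unfolding R_def by simp
      next
        case False
        have "\<delta> / real d \<le> 1" using \<delta> d2 by (simp add: divide_le_eq)
        then have "real (card (near_triples f \<eta> \<xi> (Q / real d) (\<delta> / real d))) \<le> 3 * (1 + W * (Q / real d)) * (Q / real d)"
          using near_triples_trivial(2)[OF X Qd, of "\<delta> / real d" f] \<delta>0 unfolding W_def by simp
        also have "\<dots> \<le> C0"
        proof -
          have "3 * (1 + W * y) * y \<le> 3 * (1 + W * Q1) * Q1" if "1 \<le> y" "y \<le> Q1" for y
            using that W by (intro mult_mono add_left_mono) auto
          from this[OF Qd] show ?thesis unfolding C0_def using False by linarith
        qed
        finally show ?thesis using nn by linarith
      qed
    qed
    define N where "N = nat \<lfloor>Q\<rfloor>"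
    have N: "1 \<le> N" "real N \<le> Q" using Qp by (simp_all add: N_def le_nat_floor of_nat_floor)
    have cubes: "(\<Sum>d=2..N. 1 / real d ^ 3) \<le> 1 / 4"
    proof -
      have "0 \<le> 1 / (2 * real N * (real N + 1))" by simp
      then show ?thesis using sum_inverse_cubes[OF N(1)] by linarith
    qed
    have harm: "(\<Sum>d=2..N. 1 / real d) \<le> 1 + ln Q"
    proof -
      have "(\<Sum>d=2..N. 1 / real d) \<le> (\<Sum>d=1..N. 1 / real d)" by (intro sum_mono2) auto
      also have "\<dots> \<le> 1 + ln (real N)" by (rule harmonic_le[OF N(1)])
      also have "\<dots> \<le> 1 + ln Q" using N by simp
      finally show ?thesis .
    qed
    define U where "U = Q powr (\<epsilon> / 4)"
    have U1: "1 \<le> U" using Qp \<epsilon> by (simp add: U_def ge_one_powr_ge_zero)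
    have lnU: "1 + ln Q \<le> (1 + 4 / \<epsilon>) * U"
    proof -
      have "ln Q \<le> Q powr (\<epsilon> / 4) / (\<epsilon> / 4)" using Qp \<epsilon> by (intro ln_powr_bound) auto
      then show ?thesis using U1 by (simp add: U_def algebra_simps)
    qed
    have TU: "T \<le> U"
    proof (cases "T = 0")
      case False
      have "T = (T powr (4 / \<epsilon>)) powr (\<epsilon> / 4)" using T0 False \<epsilon> by (simp add: powr_powr)
      also have "\<dots> \<le> U" unfolding U_def using order_trans[OF Q0(3) Q] \<epsilon> by (intro powr_mono2) auto
      finally show ?thesis .
    qed (use U1 in simp)
    have main: "Q * U ^ 4 \<le> \<delta> * Q\<^sup>2"
    proof -
      have "U ^ 4 = Q powr \<epsilon>" using Qp by (simp add: U_def powr_power)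
      also have "\<dots> = Q powr (- 1 + \<epsilon>) * Q" using Qp powr_mult_base[of Q "- 1 + \<epsilon>"] by (simp add: mult.commute)
      also have "\<dots> \<le> \<delta> * Q" using \<delta> Qp by (intro mult_right_mono) auto
      finally have "Q * U ^ 4 \<le> Q * (\<delta> * Q)" using Qp by (intro mult_left_mono) auto
      then show ?thesis by (simp add: power2_eq_square mult_ac)
    qed
    have small: "0.75 * W * Q powr (1 + \<epsilon> / 2) * (1 + ln Q) + C0 * Q \<le> 0.02 * (W * \<delta> * Q\<^sup>2)"
    proof -
      have q: "Q powr (1 + \<epsilon> / 2) = Q * U\<^sup>2"
        using Qp powr_mult_base[of Q "\<epsilon> / 2"] by (simp add: U_def powr_power)
      have "0.75 * W * Q powr (1 + \<epsilon> / 2) * (1 + ln Q) \<le> 0.75 * W * (Q * U\<^sup>2) * ((1 + 4 / \<epsilon>) * U)"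
        unfolding q using lnU W Qp by (intro mult_left_mono) auto
      moreover have "C0 * Q * 1 \<le> C0 * Q * U ^ 3" using C0 Qp U1 by (intro mult_left_mono) (auto simp: one_le_power)
      ultimately have "0.75 * W * Q powr (1 + \<epsilon> / 2) * (1 + ln Q) + C0 * Q \<le>
          0.75 * W * (Q * U\<^sup>2) * ((1 + 4 / \<epsilon>) * U) + C0 * Q * U ^ 3" by linarith
      also have "\<dots> = (0.75 * W * (1 + 4 / \<epsilon>) + C0) * (Q * U ^ 3)"
        by (simp add: power2_eq_square power3_eq_cube algebra_simps)
      also have "0.75 * W * (1 + 4 / \<epsilon>) + C0 = 0.02 * W * T" using W by (simp add: T_def)
      also have "0.02 * W * T * (Q * U ^ 3) \<le> 0.02 * W * U * (Q * U ^ 3)"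
        using TU W Qp U1 by (intro mult_right_mono mult_left_mono) auto
      also have "\<dots> = 0.02 * W * (Q * U ^ 4)" by (simp add: power_numeral_reduce)
      also have "\<dots> \<le> 0.02 * W * (\<delta> * Q\<^sup>2)" using main W by (intro mult_left_mono) auto
      finally show ?thesis by (simp add: mult_ac)
    qed
    have "(\<Sum>d=2..N. real (card (near_triples f \<eta> \<xi> (Q / real d) (\<delta> / real d)))) \<le>
       (\<Sum>d=2..N. 0.75 * (W * \<delta> * Q\<^sup>2) * (1 / real d ^ 3) + 0.75 * W * Q powr (1 + \<epsilon> / 2) * (1 / real d) + C0)"
      unfolding N_def by (intro sum_mono level)
    also have "\<dots> = 0.75 * (W * \<delta> * Q\<^sup>2) * (\<Sum>d=2..N. 1 / real d ^ 3) + 0.75 * W * Q powr (1 + \<epsilon> / 2) * (\<Sum>d=2..N. 1 / real d) + real (card {2..N}) * C0"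
      by (simp only: sum.distrib sum_distrib_left sum_constant)
    also have "\<dots> \<le> 0.75 * (W * \<delta> * Q\<^sup>2) * (1 / 4) + 0.75 * W * Q powr (1 + \<epsilon> / 2) * (1 + ln Q) + Q * C0"
      using cubes harm W \<delta>0 N C0 by (intro add_mono mult_left_mono mult_right_mono) auto
    also have "\<dots> \<le> 0.2075 * (W * \<delta> * Q\<^sup>2)" using small by (simp add: mult.commute)
    finally have s: "(\<Sum>d=2..N. real (card (near_triples f \<eta> \<xi> (Q / real d) (\<delta> / real d)))) \<le> 0.2075 * (W * \<delta> * Q\<^sup>2)" .
    have "real (card (near_triples f \<eta> \<xi> Q \<delta>)) \<le> real (card ?P) + 0.2075 * (W * \<delta> * Q\<^sup>2)"
      using near_triples_le_primitive[OF X Qp(1) \<delta>0, of f] s \<delta> unfolding N_def by simp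
    then have "0.3925 * (W * \<delta> * Q\<^sup>2) \<le> real (card ?P)" using as by simp
    then show "0.3925 * (W * \<delta> * Q\<^sup>2) \<le> real (card ?P) \<and> real (card ?P) \<le> 0.75 * (W * \<delta> * Q\<^sup>2)"
      using up by blast
  qed
qed

theorem theorem2:
  fixes \<eta> \<xi> c1 c2 \<epsilon> L :: real
  assumes "\<eta> < \<xi>" and "0 < c1" and "c1 \<le> c2" and "0 < \<epsilon>" and "\<epsilon> < 1"
  shows "\<exists>C::real. \<forall>f \<in> curve_class {\<eta>..\<xi>} c1 c2.
    L-lipschitz_on {\<eta>..\<xi>} (deriv_on {\<eta>..\<xi>} (deriv_on {\<eta>..\<xi>} f)) \<longrightarrow>
    (\<forall>(Q::nat) (\<delta>::real). Q > 1 \<and> real Q powr (- 1 + \<epsilon>) < \<delta> \<and> \<delta> \<le> 1 / 2 \<longrightarrow>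
       2 * sqrt 3 / (9 * zeta 3) - C * real Q powr (- \<epsilon> / 2)
         \<le> real (num_near_points {\<eta>..\<xi>} f (real Q) \<delta>) / ((\<xi> - \<eta>) * \<delta> * (real Q)\<^sup>2) \<and>
       real (num_near_points {\<eta>..\<xi>} f (real Q) \<delta>) / ((\<xi> - \<eta>) * \<delta> * (real Q)\<^sup>2)
         \<le> 1 / zeta 3 + C * real Q powr (- \<epsilon> / 2))"
proof -
  define X where "X = \<xi> - \<eta>"
  have X: "0 < X" using assms(1) by (simp add: X_def)
  obtain Q0 where Q0: "1 \<le> Q0" and main: "\<And>f Q \<delta>. f \<in> curve_class {\<eta>..\<xi>} c1 c2 \<Longrightarrow> Q0 \<le> Q \<Longrightarrow>
      Q powr (- 1 + \<epsilon>) \<le> \<delta> \<Longrightarrow> \<delta> \<le> 1 / 2 \<Longrightarrow>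
      0.3925 * (X * \<delta> * Q\<^sup>2) \<le> real (num_near_points {\<eta>..\<xi>} f Q \<delta>) \<and>
      real (num_near_points {\<eta>..\<xi>} f Q \<delta>) \<le> 0.75 * (X * \<delta> * Q\<^sup>2)"
    using primitive_triples_card[OF assms(1,2,4,5)] unfolding X_def num_near_points_eq by blast
  \<comment> \<open>\<open>K\<close> is a trivial bound for the ratio when \<open>Q < Q0\<close>.
    Multiplying it by \<open>Q0 powr (\<epsilon> / 2)\<close> makes the error term at least
    \<open>K\<close> on that range, where both inequalities then hold without further work.\<close>
  define K where "K = max 1 (3 * (1 + X * Q0) / X)"
  have K: "1 \<le> K" "3 * (1 + X * Q0) / X \<le> K" by (auto simp: K_def)
  define C where "C = K * Q0 powr (\<epsilon> / 2)"
  have C: "0 \<le> C" using K by (simp add: C_def)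
  have z: "1 \<le> zeta 3" "zeta 3 \<le> 5 / 4" by (rule zeta_3_bounds)+
  \<comment> \<open>Numerically 2 sqrt 3 / 9 is about 0.3849, and 1 / zeta(3) is at least 0.8; the
    proven 0.3925 and 0.75 lie between the two claimed main terms.\<close>
  have lowc: "2 * sqrt 3 / (9 * zeta 3) \<le> 0.3925"
  proof -
    have "sqrt 3 \<le> 1.7325" by (rule real_le_lsqrt) (auto simp: power2_eq_square)
    then have "2 * sqrt 3 / (9 * zeta 3) \<le> 2 * 1.7325 / (9 * 1)" using z by (intro frac_le) auto
    then show ?thesis by simp
  qed
  have upc: "0.75 \<le> 1 / zeta 3" using z by (simp add: field_simps)
  show ?thesis unfolding X_def[symmetric]
  proof (intro exI[of _ C] ballI impI allI)
    fix f Q \<delta> assume f: "f \<in> curve_class {\<eta>..\<xi>} c1 c2"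
      and h: "1 < Q \<and> real Q powr (- 1 + \<epsilon>) < \<delta> \<and> \<delta> \<le> 1 / 2"
    define R where "R = real (num_near_points {\<eta>..\<xi>} f (real Q) \<delta>) / (X * \<delta> * (real Q)\<^sup>2)"
    define t where "t = real Q powr (- \<epsilon> / 2)"
    have Q1: "1 \<le> real Q" using h by simp
    have "0 < real Q powr (- 1 + \<epsilon>)" using Q1 by simp
    then have \<delta>: "0 < \<delta>" "\<delta> \<le> 1" using h by linarith+
    have pos: "0 < X * \<delta> * (real Q)\<^sup>2" using X \<delta> Q1 by simp
    have R0: "0 \<le> R" using pos by (simp add: R_def)
    have t0: "0 \<le> t" by (simp add: t_def)
    have "2 * sqrt 3 / (9 * zeta 3) - C * t \<le> R \<and> R \<le> 1 / zeta 3 + C * t"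
    proof (cases "Q0 \<le> real Q")
      case True
      have "0.3925 \<le> R" "R \<le> 0.75"
        using main[OF f True, of \<delta>] h pos unfolding R_def by (auto simp: pos_le_divide_eq pos_divide_le_eq)
      moreover have "0 \<le> C * t" using C t0 by simp
      ultimately show ?thesis using lowc upc by linarith
    next
      case False
      have "Q0 powr (- \<epsilon> / 2) \<le> t" unfolding t_def using False Q1 assms(4) by (intro powr_mono2') auto
      then have "C * Q0 powr (- \<epsilon> / 2) \<le> C * t" using C by (intro mult_left_mono) auto
      moreover have "C * Q0 powr (- \<epsilon> / 2) = K" using Q0 by (simp add: C_def mult.assoc powr_add[symmetric])
      ultimately have Kt: "K \<le> C * t" by simp
      have "num_near_points {\<eta>..\<xi>} f (real Q) \<delta> \<le> card (near_triples f \<eta> \<xi> (real Q) \<delta>)"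
        unfolding num_near_points_eq using near_triples_trivial(1)[OF assms(1) Q1, of \<delta> f] \<delta>
        by (intro card_mono) auto
      then have "real (num_near_points {\<eta>..\<xi>} f (real Q) \<delta>) \<le> 3 * (1 + X * real Q) * real Q"
        using near_triples_trivial(2)[OF assms(1) Q1, of \<delta> f] \<delta> unfolding X_def by linarith
      also have "\<dots> \<le> (3 * (1 + X * Q0) / X) * (X * real Q)"
      proof -
        have "3 * (1 + X * real Q) * real Q \<le> 3 * (1 + X * Q0) * real Q"
          using False X by (intro mult_right_mono mult_left_mono add_left_mono) auto
        then show ?thesis using X by simp
      qed
      also have "\<dots> \<le> K * (X * \<delta> * (real Q)\<^sup>2)"
      proof (rule mult_mono)
        have "1 = real Q powr (- 1) * real Q" using Q1 powr_mult_base[of "real Q" "- 1"] by (simp add: mult.commute)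
        also have "\<dots> \<le> real Q powr (- 1 + \<epsilon>) * real Q" using Q1 assms(4) by (intro mult_right_mono powr_mono) auto
        also have "\<dots> \<le> \<delta> * real Q" using h by (intro mult_right_mono) auto
        finally have "X * real Q * 1 \<le> X * real Q * (\<delta> * real Q)" using X by (intro mult_left_mono) auto
        then show "X * real Q \<le> X * \<delta> * (real Q)\<^sup>2" by (simp add: power2_eq_square mult_ac)
      qed (use K X in auto)
      finally have "R \<le> K" using pos by (simp add: R_def pos_divide_le_eq)
      moreover have "0 \<le> 1 / zeta 3" using z by simp
      moreover have "2 * sqrt 3 / (9 * zeta 3) \<le> 1" using lowc by (rule order_trans) simp
      ultimately show ?thesis using Kt K(1) R0 by linarith
    qed
    then show "2 * sqrt 3 / (9 * zeta 3) - C * real Q powr (- \<epsilon> / 2)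
         \<le> real (num_near_points {\<eta>..\<xi>} f (real Q) \<delta>) / (X * \<delta> * (real Q)\<^sup>2) \<and>
       real (num_near_points {\<eta>..\<xi>} f (real Q) \<delta>) / (X * \<delta> * (real Q)\<^sup>2)
         \<le> 1 / zeta 3 + C * real Q powr (- \<epsilon> / 2)"
      unfolding R_def t_def .
  qed
qed

end
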